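(* For $n\ge3$, the homotopy type of the complex $\mathcal{C}_n$ is given by $$\mathcal{C}_n\simeq\begin{cases}S^{k-1}\vee S^{k-1},&\text{if }n=3k;\\S^{k-1},&\text{if }n=3k+1;\\S^k,&\text{if }n=3k+2.\end{cases}$$ Therefore, for the double directed cycle $C_n$, $n\ge3$, $$\Delta(C_n)\simeq\begin{cases}S^{2k-1}\vee S^{2k-1}\vee S^{3k-2}\vee S^{3k-2},&\text{if }n=3k;\\S^{2k}\vee S^{3k-1}\vee S^{3k-1},&\text{if }n=3k+1;\\S^{2k}\vee S^{3k}\vee S^{3k},&\text{if }n=3k+2.\end{cases}$$
   Context: $\mathcal{C}_n$ is the simplicial complex on $n$ vertices indexed by $\mathbb{Z}_n$ whose faces are the subsets of $\mathbb{Z}_n$ that do not contain $\{i,i+1\}$ for any $i\in\mathbb{Z}_n$. The double directed cycle $C_n$ is the directed graph with $V(C_n)=\mathbb{Z}_n$, $E(C_n)=\{(i\to i+1),(i+1\to i): i\in\mathbb{Z}_n\}$. For a directed graph $G$, $\Delta(G)$ is the simplicial complex whose vertices are the edges of $G$ and whose faces are the edge sets of all directed forests that are subgraphs of $G$; a directed forest is a disjoint union of directed trees, where a directed tree with root $x$ is a directed graph in which every vertex is reached from $x$ by a unique directed path. *)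

theory Defs
  imports "HOL-Analysis.Analysis" "Graph_Theory.Graph_Theory"
begin

text \<open>
  An abstract simplicial complex is given by its set of faces. A point of the realization is
  a tuple of barycentric coordinates, extended by zero off its support. The subspace topology of
  the product is the usual topology of the realization for finite complexes, the only ones
  considered here; it is also the topology that HOL-Homology puts on standard simplices.
  Whether the empty set is listed as a face is immaterial, as no support is empty.
\<close>

definition geometric_realization :: "'a set set \<Rightarrow> ('a \<Rightarrow> real) topology" where
  "geometric_realization K = subtopology (powertop_real UNIV)
     {f. (\<forall>v. 0 \<le> f v) \<and> finite {v. f v \<noteq> 0} \<and> {v. f v \<noteq> 0} \<in> K \<and> (\<Sum>v | f v \<noteq> 0. f v) = 1}"

definition quotient_topology :: "'a topology \<Rightarrow> ('a \<Rightarrow> 'b) \<Rightarrow> 'b topology" where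
  "quotient_topology X f =
     topology (\<lambda>U. U \<subseteq> f ` topspace X \<and> openin X {x \<in> topspace X. f x \<in> U})"

lemma openin_quotient_topology:
  "openin (quotient_topology X f) U \<longleftrightarrow> U \<subseteq> f ` topspace X \<and> openin X {x \<in> topspace X. f x \<in> U}"
proof -
  have 1: "{x \<in> topspace X. f x \<in> S \<inter> T} = {x \<in> topspace X. f x \<in> S} \<inter> {x \<in> topspace X. f x \<in> T}"
    for S T by auto
  have 2: "{x \<in> topspace X. f x \<in> \<Union>\<K>} = (\<Union>S\<in>\<K>. {x \<in> topspace X. f x \<in> S})" for \<K>
    by auto
  have "istopology (\<lambda>U. U \<subseteq> f ` topspace X \<and> openin X {x \<in> topspace X. f x \<in> U})"
    unfolding istopology_def 1 2 by blast
  then show ?thesis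
    by (simp add: quotient_topology_def)
qed

lemma quotient_map_quotient_topology: "quotient_map X (quotient_topology X f) f"
proof -
  have "{x \<in> topspace X. f x \<in> f ` topspace X} = topspace X"
    by auto
  then have "openin (quotient_topology X f) (f ` topspace X)"
    by (simp add: openin_quotient_topology)
  then have "topspace (quotient_topology X f) = f ` topspace X"
    by (metis openin_quotient_topology openin_subset openin_topspace subset_antisym)
  then show ?thesis
    by (simp add: quotient_map_def openin_quotient_topology)
qed

text \<open>The points \<open>(i, p i)\<close> of the disjoint union are all sent to \<open>None\<close>, and no others are
  identified. The index set is meant to be nonempty.\<close>

definition wedge :: "'i set \<Rightarrow> ('i \<Rightarrow> 'a topology) \<Rightarrow> ('i \<Rightarrow> 'a) \<Rightarrow> ('i \<times> 'a) option topology" where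
  "wedge I X p =
     quotient_topology (sum_topology X I) (\<lambda>(i, x). if x = p i then None else Some (i, x))"

text \<open>The wedge of the spheres whose dimensions are listed in \<open>ds\<close>, with base points
  \<open>(1, 0, 0, \<dots>)\<close>.\<close>

definition wedge_of_spheres :: "nat list \<Rightarrow> (nat \<times> (nat \<Rightarrow> real)) option topology" where
  "wedge_of_spheres ds =
     wedge {..<length ds} (\<lambda>i. nsphere (ds ! i)) (\<lambda>i j. if j = 0 then 1 else 0)"

text \<open>The integers modulo \<open>n\<close> are represented by \<open>{..<n}\<close>.\<close>

definition cycle_complex :: "nat \<Rightarrow> nat set set" where
  "cycle_complex n = {S. S \<subseteq> {..<n} \<and> (\<forall>i<n. \<not> {i, (i + 1) mod n} \<subseteq> S)}"

definition double_directed_cycle :: "nat \<Rightarrow> (nat, nat \<times> nat) pre_digraph" where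
  "double_directed_cycle n =
     \<lparr>verts = {..<n},
      arcs = (\<Union>i<n. {(i, (i + 1) mod n), ((i + 1) mod n, i)}),
      tail = fst, head = snd\<rparr>"

text \<open>
  Paths are walks here, so vertices may repeat: with the library's simple paths
  (\<open>apath\<close>), a directed 2-cycle would count as a tree. In particular the root is reached from
  itself by the empty walk only.
\<close>

definition directed_tree :: "('a, 'b) pre_digraph \<Rightarrow> 'a \<Rightarrow> bool" where
  "directed_tree T x \<longleftrightarrow> wf_digraph T \<and> x \<in> verts T \<and>
     (\<forall>v \<in> verts T. \<exists>!p. pre_digraph.awalk T x p v)"

definition directed_forest :: "('a, 'b) pre_digraph \<Rightarrow> bool" where
  "directed_forest F \<longleftrightarrow> (\<exists>\<T>.
     (\<forall>T \<in> \<T>. subgraph T F \<and> (\<exists>x. directed_tree T x)) \<and>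
     (\<forall>T \<in> \<T>. \<forall>T' \<in> \<T>. T \<noteq> T' \<longrightarrow> verts T \<inter> verts T' = {}) \<and>
     verts F = (\<Union>T \<in> \<T>. verts T) \<and> arcs F = (\<Union>T \<in> \<T>. arcs T))"

definition directed_forest_complex :: "('a, 'b) pre_digraph \<Rightarrow> 'b set set" where
  "directed_forest_complex G = {arcs F | F. subgraph F G \<and> directed_forest F}"

end

theory Submission
  imports Defs
begin

text \<open>
  If a finite complex is the union of a contractible subcomplex and some facets, then collapsing the
  subcomplex to a point turns each facet into a sphere of the same dimension and does not change
  the homotopy type. The contractibility of the subcomplexes follows from collapses: the faces
  that contain \<open>\<sigma>\<close> can be removed if \<open>p \<notin> \<sigma>\<close> can be added to each of them.

  The cycle complexes are independence complexes of cycles. For \<open>n = 3 m\<close> the facets are two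
  residue classes modulo 3, for \<open>n = 3 m + 2\<close> it is \<open>{0, 3, \<dots>, 3 m}\<close>; for \<open>n = 3 m + 1\<close> the set
  \<open>{2, 5, \<dots>, 3 m - 1}\<close> becomes a facet after some collapses.

  The arcs of the double directed cycle can be arranged in a cycle of length \<open>2 n\<close> such that
  neighbours are incompatible in a forest. The forests are then the independent sets apart from
  the two directed cycles, which are the even and the odd positions. Removing these two facets
  from the independence complex has the same effect as attaching two spheres of
  dimension \<open>n - 2\<close>: the faces \<open>E - {0}\<close> and \<open>O - {1}\<close> lie in no other face than \<open>E\<close> and \<open>O\<close>, and
  become facets.
\<close>

section \<open>Finite simplicial complexes and collapses\<close>

text \<open>No attaching map is ever studied: apart from relabelling, every equivalence is a
  collapse given by an explicit formula or the quotient by a contractible subcomplex. What has to be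
  found is facets of the right dimension. Consecutive elements of a maximal independent set of a
  cycle are at most 3 apart, so it has at least a third of the vertices; the classes modulo 3 come
  close to this bound. For length \<open>3 * m + 1\<close> the minimum is \<open>m + 1\<close>
  vertices, one more than a sphere of dimension \<open>m - 1\<close> allows, which forces the
  preliminary collapses. For the digraph the length is \<open>2 * n\<close>, so
  \<open>n = 3 * k\<close>, \<open>3 * k + 1\<close>, \<open>3 * k + 2\<close> lead to the lengths
  \<open>3 * (2 * k)\<close>, \<open>3 * (2 * k) + 2\<close>, \<open>3 * (2 * k + 1) + 1\<close>:
  the last two cases change places. There the residue facets and the sets of the preliminary
  collapses contain numbers of both parities. This keeps them apart from the two directed cycles, so
  that both constructions work side by side on one complex.\<close>

definition finite_complex :: "'a set \<Rightarrow> 'a set set \<Rightarrow> bool" where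
  "finite_complex V K \<longleftrightarrow>
     finite V \<and> K \<subseteq> Pow V \<and> (\<forall>S\<in>K. \<forall>S'. S' \<subseteq> S \<and> S' \<noteq> {} \<longrightarrow> S' \<in> K)"

lemma finite_complexD:
  assumes "finite_complex V K"
  shows "finite V" "S \<in> K \<Longrightarrow> S \<subseteq> V" "S \<in> K \<Longrightarrow> finite S"
    "S \<in> K \<Longrightarrow> S' \<subseteq> S \<Longrightarrow> S' \<noteq> {} \<Longrightarrow> S' \<in> K"
  using assms unfolding finite_complex_def by (auto intro: finite_subset)

abbreviation support :: "('a \<Rightarrow> real) \<Rightarrow> 'a set" where
  "support f \<equiv> {v. f v \<noteq> 0}"

lemma support_nonempty: "sum f A = 1 \<Longrightarrow> support f \<noteq> {}"
  by (rule ccontr) (simp add: sum.neutral)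

text \<open>\<open>V\<close> is only a bound for the vertices, shared by a complex and its
  subcomplexes. Summing over it instead of the varying support makes the normalization a single
  linear equation.\<close>

lemma topspace_realization:
  assumes "finite_complex V K"
  shows "f \<in> topspace (geometric_realization K) \<longleftrightarrow>
    (\<forall>v. 0 \<le> f v) \<and> support f \<in> K \<and> sum f V = 1"
proof -
  have "sum f (support f) = sum f V" if "support f \<in> K"
    using finite_complexD(1,2)[OF assms] that by (intro sum.mono_neutral_left) auto
  then show ?thesis
    using finite_complexD(3)[OF assms] unfolding geometric_realization_def by auto
qed

lemma realizationD:
  assumes "finite_complex V K" "f \<in> topspace (geometric_realization K)"
  shows "0 \<le> f v" "support f \<in> K" "sum f V = 1" "f v \<noteq> 0 \<Longrightarrow> v \<in> V" "support f \<noteq> {}"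
    "f v \<le> 1"
proof -
  note f = assms(2)[unfolded topspace_realization[OF assms(1)]]
  show "0 \<le> f v" and 2: "support f \<in> K" and 1: "sum f V = 1" using f by auto
  show 3: "f v \<noteq> 0 \<Longrightarrow> v \<in> V" for v using 2 finite_complexD(2)[OF assms(1) 2] by auto
  show "support f \<noteq> {}" using 1 by (rule support_nonempty)
  show "f v \<le> 1"
  proof (cases "v \<in> V")
    case True
    then have "f v \<le> sum f V"
      using f finite_complexD(1)[OF assms(1)] by (intro member_le_sum) auto
    then show ?thesis using 1 by simp
  qed (use 3 in force)
qed

lemma continuous_map_realization_coord:
  "continuous_map (geometric_realization K) euclideanreal (\<lambda>f. f v)"
  unfolding geometric_realization_def
  by (intro continuous_map_from_subtopology continuous_map_product_projection) auto

lemma continuous_map_realization_coord_compose: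
  "continuous_map X (geometric_realization K) f \<Longrightarrow> continuous_map X euclideanreal (\<lambda>x. f x v)"
  using continuous_map_compose[OF _ continuous_map_realization_coord] by (force simp: o_def)

lemma continuous_map_into_realization:
  assumes "\<And>v. continuous_map X euclideanreal (\<lambda>x. f x v)"
    "\<And>x. x \<in> topspace X \<Longrightarrow> f x \<in> topspace (geometric_realization K)"
  shows "continuous_map X (geometric_realization K) f"
  using assms unfolding geometric_realization_def continuous_map_in_subtopology
  by (auto simp: continuous_map_componentwise_UNIV)

lemma continuous_map_realization_mono:
  assumes "continuous_map X (geometric_realization T) f" "T \<subseteq> K"
  shows "continuous_map X (geometric_realization K) f"
proof (rule continuous_map_into_realization)
  show "continuous_map X euclideanreal (\<lambda>x. f x v)" for v
    by (rule continuous_map_realization_coord_compose[OF assms(1)])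
  have "topspace (geometric_realization T) \<subseteq> topspace (geometric_realization K)"
    using assms(2) unfolding geometric_realization_def by auto
  then show "f x \<in> topspace (geometric_realization K)" if "x \<in> topspace X" for x
    using continuous_map_image_subset_topspace[OF assms(1)] that by blast
qed

lemma continuous_map_Min:
  fixes g :: "'i \<Rightarrow> 'b \<Rightarrow> real"
  assumes "finite A" "A \<noteq> {}" "\<And>i. i \<in> A \<Longrightarrow> continuous_map X euclideanreal (g i)"
  shows "continuous_map X euclideanreal (\<lambda>x. Min ((\<lambda>i. g i x) ` A))"
  using assms
  by (induction A rule: finite_ne_induct) (auto intro!: continuous_map_real_min)

text \<open>The segment from \<open>f x\<close> to \<open>g x\<close> stays in the simplex of the
  common face: the two maps are contiguous. Collapses and cones both rest on this.\<close>

lemma homotopic_straight_line: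
  fixes f g :: "'b \<Rightarrow> 'a \<Rightarrow> real"
  assumes K: "finite_complex V K"
    and f: "continuous_map X (geometric_realization K) f"
    and g: "continuous_map X (geometric_realization K) g"
    and un: "\<And>x. x \<in> topspace X \<Longrightarrow> \<exists>S\<in>K. support (f x) \<union> support (g x) \<subseteq> S"
  shows "homotopic_with (\<lambda>x. True) X (geometric_realization K) f g"
proof -
  let ?h = "\<lambda>(t, x) v. (1 - t) * f x v + t * g x v"
  have "continuous_map (prod_topology (top_of_set {0..1}) X) (geometric_realization K) ?h"
  proof (rule continuous_map_into_realization)
    fix v
    have t: "continuous_map (prod_topology (top_of_set {0..1::real}) X) euclideanreal fst"
      using continuous_map_fst continuous_map_into_fulltopology by blast
    have c: "continuous_map (prod_topology (top_of_set {0..1::real}) X) euclideanreal (\<lambda>z. k (snd z) v)"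
      if "continuous_map X (geometric_realization K) k" for k
      using continuous_map_compose[OF continuous_map_snd
          continuous_map_realization_coord_compose[OF that]] by (simp add: o_def)
    show "continuous_map (prod_topology (top_of_set {0..1}) X) euclideanreal (\<lambda>z::real \<times> 'b. ?h z v)"
      unfolding case_prod_beta by (intro continuous_intros t c f g)
  next
    fix z :: "real \<times> 'b" assume "z \<in> topspace (prod_topology (top_of_set {0..1}) X)"
    then obtain t x where z: "z = (t, x)" and t: "0 \<le> t" "t \<le> 1" and x: "x \<in> topspace X"
      by auto
    have fx: "f x \<in> topspace (geometric_realization K)" and gx: "g x \<in> topspace (geometric_realization K)"
      using x f g continuous_map_image_subset_topspace by blast+
    obtain S where S: "S \<in> K" "support (f x) \<union> support (g x) \<subseteq> S" using un x by blast
    have sum: "sum (?h z) V = 1"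
      using realizationD(3)[OF K fx] realizationD(3)[OF K gx]
      by (simp add: z sum.distrib flip: sum_distrib_left)
    have "?h z v = 0" if "f x v = 0" "g x v = 0" for v using that by (simp add: z)
    then have "support (?h z) \<subseteq> S" using S(2) by blast
    moreover have "support (?h z) \<noteq> {}" using sum by (rule support_nonempty)
    ultimately have "support (?h z) \<in> K" using finite_complexD(4)[OF K S(1)] by blast
    then show "?h z \<in> topspace (geometric_realization K)"
      unfolding topspace_realization[OF K] using sum t realizationD(1)[OF K fx] realizationD(1)[OF K gx]
      by (auto simp: z)
  qed
  then show ?thesis
    unfolding homotopic_with_def by (intro exI[of _ ?h]) auto
qed

lemma finite_complex_subset:
  assumes "finite_complex V K" "T \<subseteq> K"
    "\<And>S S'. S \<in> T \<Longrightarrow> S' \<subseteq> S \<Longrightarrow> S' \<noteq> {} \<Longrightarrow> S' \<in> T"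
  shows "finite_complex V T"
  using assms(1,2) unfolding finite_complex_def
  by (intro conjI ballI allI impI) (auto intro: assms(3))

lemma finite_complex_avoid:
  assumes "finite_complex V K"
  shows "finite_complex V {S \<in> K. \<forall>\<sigma>\<in>A. \<not> \<sigma> \<subseteq> S}"
proof (rule finite_complex_subset[OF assms])
  fix S S' assume "S \<in> {S \<in> K. \<forall>\<sigma>\<in>A. \<not> \<sigma> \<subseteq> S}" "S' \<subseteq> S" "S' \<noteq> {}"
  then show "S' \<in> {S \<in> K. \<forall>\<sigma>\<in>A. \<not> \<sigma> \<subseteq> S}"
    using finite_complexD(4)[OF assms, of S S'] by blast
qed blast

text \<open>On a face containing \<open>\<sigma>\<close>, the minimal coordinate over \<open>\<sigma>\<close> is moved to the apex \<open>p\<close>;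
  on the other faces this minimum is \<open>0\<close>, so that one formula defines the retraction.\<close>

lemma realization_collapse:
  assumes K: "finite_complex V K" and \<sigma>: "finite \<sigma>" "\<sigma> \<noteq> {}" and p: "p \<in> V" "p \<notin> \<sigma>"
    and cone: "\<And>S. S \<in> K \<Longrightarrow> \<sigma> \<subseteq> S \<Longrightarrow> insert p S \<in> K"
  shows "geometric_realization K homotopy_equivalent_space geometric_realization {S \<in> K. \<not> \<sigma> \<subseteq> S}"
proof -
  define K' where "K' = {S \<in> K. \<not> \<sigma> \<subseteq> S}"
  have K': "finite_complex V K'"
    using finite_complex_avoid[OF K, of "{\<sigma>}"] by (simp add: K'_def)
  have sub: "topspace (geometric_realization K') \<subseteq> topspace (geometric_realization K)"
    unfolding subset_iff topspace_realization[OF K] topspace_realization[OF K'] by (auto simp: K'_def)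
  define m where "m f = Min (f ` \<sigma>)" for f :: "'a \<Rightarrow> real"
  \<comment> \<open>Each of the \<open>card \<sigma>\<close> vertices loses \<open>m f\<close>, so
    \<open>p\<close> has to gain \<open>card \<sigma> * m f\<close> for the sum to stay 1.\<close>
  define r where "r f = (\<lambda>v. f v - (if v \<in> \<sigma> then m f else 0) + (if v = p then card \<sigma> * m f else 0))"
    for f :: "'a \<Rightarrow> real"
  have m_le: "m f \<le> f v" if "v \<in> \<sigma>" for f v
    using \<sigma> that by (auto simp: m_def)
  have m_attained: "\<exists>v\<in>\<sigma>. f v = m f" for f
  proof -
    have "m f \<in> f ` \<sigma>" unfolding m_def by (rule Min_in) (use \<sigma> in auto)
    then show ?thesis by auto
  qed
  have m_pos: "\<sigma> \<subseteq> support f" if "0 < m f" for f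
  proof
    fix v assume "v \<in> \<sigma>"
    then have "0 < f v" using m_le[of v f] that by linarith
    then show "v \<in> support f" by simp
  qed
  have m_zero: "m f = 0" if "f \<in> topspace (geometric_realization K)" "\<not> \<sigma> \<subseteq> support f" for f
    using m_attained[of f] m_pos[of f] realizationD(1)[OF K that(1)] that(2) less_eq_real_def by metis
  have m_nn: "0 \<le> m f" if "f \<in> topspace (geometric_realization K)" for f
    using m_attained[of f] realizationD(1)[OF K that] by metis
  have r_id: "r f = f" if "f \<in> topspace (geometric_realization K)" "\<not> \<sigma> \<subseteq> support f" for f
    by (auto simp: r_def m_zero[OF that])
  have r_support: "\<exists>S\<in>K. support f \<union> support (r f) \<subseteq> S" if f: "f \<in> topspace (geometric_realization K)" for f
  proof (cases "\<sigma> \<subseteq> support f")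
    case True
    have "support (r f) \<subseteq> insert p (support f)" using True by (auto simp: r_def)
    then show ?thesis using cone[OF realizationD(2)[OF K f] True] by blast
  next
    case False
    then show ?thesis using r_id[OF f] realizationD(2)[OF K f] by auto
  qed
  have r_mem: "r f \<in> topspace (geometric_realization K')" if f: "f \<in> topspace (geometric_realization K)" for f
  proof (cases "\<sigma> \<subseteq> support f")
    case False
    then show ?thesis
      using f r_id[OF f] unfolding topspace_realization[OF K'] topspace_realization[OF K] by (auto simp: K'_def)
  next
    case True
    have \<sigma>V: "\<sigma> \<subseteq> V" using True realizationD(4)[OF K f] by blast
    have nn: "0 \<le> r f v" for v
      using m_le[of v f] m_nn[OF f] realizationD(1)[OF K f, of v] by (auto simp: r_def)
    have "sum (r f) V = sum f V - (\<Sum>v\<in>V. if v \<in> \<sigma> then m f else 0) + (\<Sum>v\<in>V. if v = p then card \<sigma> * m f else 0)"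
      by (simp add: r_def sum.distrib sum_subtractf)
    also have "(\<Sum>v\<in>V. if v \<in> \<sigma> then m f else 0) = card \<sigma> * m f"
      using finite_complexD(1)[OF K] \<sigma>V by (simp add: sum.If_cases Int_absorb1)
    finally have sum: "sum (r f) V = 1"
      using p finite_complexD(1)[OF K] realizationD(3)[OF K f] by simp
    obtain S where S: "S \<in> K" "support f \<union> support (r f) \<subseteq> S" using r_support[OF f] by blast
    have "support (r f) \<noteq> {}" using sum by (rule support_nonempty)
    then have "support (r f) \<in> K" using S finite_complexD(4)[OF K S(1)] by blast
    \<comment> \<open>A vertex where the minimum is attained drops to 0, and since \<open>p\<close>
      is not in \<sigma>, nothing is added back there.\<close>
    moreover have "\<not> \<sigma> \<subseteq> support (r f)"
      using m_attained[of f] p by (auto simp: r_def)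
    ultimately show ?thesis unfolding topspace_realization[OF K'] using nn sum by (auto simp: K'_def)
  qed
  have cm: "continuous_map (geometric_realization K) euclideanreal m"
    unfolding m_def by (rule continuous_map_Min[OF \<sigma> continuous_map_realization_coord])
  have cr: "continuous_map (geometric_realization K) (geometric_realization K') r"
  proof (rule continuous_map_into_realization)
    show "continuous_map (geometric_realization K) euclideanreal (\<lambda>f. r f v)" for v
      unfolding r_def
      by (cases "v \<in> \<sigma>"; cases "v = p"; simp; intro continuous_intros cm continuous_map_realization_coord)
  qed (rule r_mem)
  have ci: "continuous_map (geometric_realization K') (geometric_realization K) id"
    by (rule continuous_map_into_realization) (use sub continuous_map_realization_coord in auto)
  have "homotopic_with (\<lambda>x. True) (geometric_realization K) (geometric_realization K) (id \<circ> r) id"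
    by (rule homotopic_straight_line[OF K continuous_map_compose[OF cr ci]])
      (use r_support in \<open>auto simp: Un_commute\<close>)
  moreover have "homotopic_with (\<lambda>x. True) (geometric_realization K') (geometric_realization K') (r \<circ> id) id"
  proof (rule homotopic_with_equal)
    show "continuous_map (geometric_realization K') (geometric_realization K') (r \<circ> id)"
      using continuous_map_compose[OF ci cr] .
    fix f assume f: "f \<in> topspace (geometric_realization K')"
    then have "\<not> \<sigma> \<subseteq> support f" using realizationD(2)[OF K' f] by (simp add: K'_def)
    then show "(r \<circ> id) f = id f" using r_id sub f by auto
  qed auto
  ultimately show ?thesis
    unfolding homotopy_equivalent_space_def K'_def[symmetric] using cr ci by blast
qed

text \<open>The faces containing \<open>\<sigma> (M - 1)\<close> go first and those containing
  \<open>\<sigma> 0\<close> last. At stage \<open>j\<close> the cone condition may therefore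
  presuppose that no \<open>\<sigma> i\<close> with \<open>i > j\<close> lies in \<open>S\<close>,
  and it must preserve this. In effect a face is matched according to the largest \<open>j\<close>
  with \<open>\<sigma> j \<subseteq> S\<close>.\<close>

lemma realization_collapse_sequence:
  fixes M :: nat
  assumes K: "finite_complex V K"
    and \<sigma>: "\<And>j. j < M \<Longrightarrow> finite (\<sigma> j) \<and> \<sigma> j \<noteq> {} \<and> p j \<in> V - \<sigma> j"
    and cone: "\<And>j S. j < M \<Longrightarrow> S \<in> K \<Longrightarrow> \<sigma> j \<subseteq> S \<Longrightarrow> (\<And>i. j < i \<Longrightarrow> i < M \<Longrightarrow> \<not> \<sigma> i \<subseteq> S)
      \<Longrightarrow> insert (p j) S \<in> K \<and> (\<forall>i. j < i \<longrightarrow> i < M \<longrightarrow> \<not> \<sigma> i \<subseteq> insert (p j) S)"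
  shows "geometric_realization K homotopy_equivalent_space
    geometric_realization {S \<in> K. \<forall>j<M. \<not> \<sigma> j \<subseteq> S}"
proof -
  let ?K = "\<lambda>j. {S \<in> K. \<forall>i\<in>{j..<M}. \<not> \<sigma> i \<subseteq> S}"
  have "geometric_realization K homotopy_equivalent_space geometric_realization (?K (M - d))"
    if "d \<le> M" for d
    using that
  proof (induction d)
    case 0
    then show ?case by (simp add: homotopy_equivalent_space_refl)
  next
    case (Suc d)
    define j where "j = M - Suc d"
    have j: "M - d = Suc j" "j < M" using Suc.prems by (auto simp: j_def)
    have "finite_complex V (?K (Suc j))"
      using finite_complex_avoid[OF K, of "\<sigma> ` {Suc j..<M}"] by simp
    then have "geometric_realization (?K (Suc j)) homotopy_equivalent_space
      geometric_realization {S \<in> ?K (Suc j). \<not> \<sigma> j \<subseteq> S}"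
    proof (rule realization_collapse)
      fix S assume S: "S \<in> ?K (Suc j)" "\<sigma> j \<subseteq> S"
      then have "insert (p j) S \<in> K \<and> (\<forall>i. j < i \<longrightarrow> i < M \<longrightarrow> \<not> \<sigma> i \<subseteq> insert (p j) S)"
        using cone[OF j(2)] by auto
      then show "insert (p j) S \<in> ?K (Suc j)" by auto
    qed (use \<sigma>[OF j(2)] in auto)
    moreover have "{S \<in> ?K (Suc j). \<not> \<sigma> j \<subseteq> S} = ?K j"
    proof -
      have "{j..<M} = insert j {Suc j..<M}" using j(2) by auto
      then show ?thesis by auto
    qed
    moreover have "geometric_realization K homotopy_equivalent_space geometric_realization (?K (Suc j))"
      using Suc unfolding j(1) by simp
    ultimately show ?case
      unfolding j_def[symmetric] by (metis (no_types, lifting) homotopy_eqv_trans)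
  qed
  from this[of M] show ?thesis by (simp add: atLeast0LessThan lessThan_iff Ball_def)
qed

lemma contractible_cone:
  assumes K: "finite_complex V K" and p: "{p} \<in> K" and cone: "\<And>S. S \<in> K \<Longrightarrow> insert p S \<in> K"
  shows "contractible_space (geometric_realization K)"
proof -
  define e where "e = (\<lambda>v. if v = p then 1 else 0 :: real)"
  have supp: "support e = {p}" by (auto simp: e_def)
  have "p \<in> V" using finite_complexD(2)[OF K p] by simp
  then have e: "e \<in> topspace (geometric_realization K)"
    unfolding topspace_realization[OF K] supp using p finite_complexD(1)[OF K] by (auto simp: e_def)
  have "homotopic_with (\<lambda>x. True) (geometric_realization K) (geometric_realization K) id (\<lambda>x. e)"
  proof (rule homotopic_straight_line[OF K])
    fix f assume "f \<in> topspace (geometric_realization K)"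
    then show "\<exists>S\<in>K. support (id f) \<union> support e \<subseteq> S"
      unfolding supp by (intro bexI[OF _ cone[OF realizationD(2)[OF K]]]) auto
  qed (use e in auto)
  then show ?thesis unfolding contractible_space_def by blast
qed

text \<open>Serves to replace sets of arcs by sets of positions in a cyclic enumeration of the
  arcs.\<close>

lemma homeomorphic_realization_image:
  assumes K: "finite_complex V K" and inj: "inj_on \<phi> V"
  shows "geometric_realization K homeomorphic_space geometric_realization ((`) \<phi> ` K)"
    and "finite_complex (\<phi> ` V) ((`) \<phi> ` K)"
proof -
  let ?K' = "(`) \<phi> ` K"
  show K': "finite_complex (\<phi> ` V) ?K'"
    unfolding finite_complex_def
  proof (intro conjI ballI allI impI)
    show "finite (\<phi> ` V)" using finite_complexD(1)[OF K] by simp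
    show "?K' \<subseteq> Pow (\<phi> ` V)" using finite_complexD(2)[OF K] by blast
    fix S S' assume "S \<in> ?K'" "S' \<subseteq> S \<and> S' \<noteq> {}"
    then obtain U where U: "U \<in> K" "S' \<subseteq> \<phi> ` U" "S' \<noteq> {}" by auto
    then obtain U' where "U' \<subseteq> U" "S' = \<phi> ` U'" by (auto simp: subset_image_iff)
    then show "S' \<in> ?K'" using finite_complexD(4)[OF K U(1), of U'] U(3) by blast
  qed
  \<comment> \<open>Points are functions on the whole type, so both maps must be set to 0 off the
    vertex sets, where \<open>\<phi>\<close> is not controlled.\<close>
  define F where "F f = (\<lambda>w. if w \<in> \<phi> ` V then f (the_inv_into V \<phi> w) else 0 :: real)" for f :: "'a \<Rightarrow> real"
  define G where "G g = (\<lambda>v. if v \<in> V then g (\<phi> v) else 0 :: real)" for g :: "'b \<Rightarrow> real"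
  have F_app: "F f (\<phi> v) = f v" if "v \<in> V" for f v
    using that inj by (simp add: F_def the_inv_into_f_f)
  have F_supp: "support (F f) = \<phi> ` support f" if "f \<in> topspace (geometric_realization K)" for f
  proof (intro subset_antisym subsetI)
    fix w assume w: "w \<in> support (F f)"
    then obtain v where "v \<in> V" "w = \<phi> v" by (auto simp: F_def split: if_splits)
    then show "w \<in> \<phi> ` support f" using w F_app[of v f] by simp
  next
    fix w assume "w \<in> \<phi> ` support f"
    then obtain v where "f v \<noteq> 0" "w = \<phi> v" by auto
    then show "w \<in> support (F f)" using F_app[of v f] realizationD(4)[OF K that, of v] by simp
  qed
  have G_supp: "\<phi> ` support (G g) = support g" if g: "g \<in> topspace (geometric_realization ?K')" for g
  proof
    show "support g \<subseteq> \<phi> ` support (G g)"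
    proof
      fix w assume w: "w \<in> support g"
      then obtain v where "v \<in> V" "w = \<phi> v" using realizationD(4)[OF K' g, of w] by auto
      then show "w \<in> \<phi> ` support (G g)" using w by (auto simp: G_def)
    qed
  qed (auto simp: G_def split: if_splits)
  have "homeomorphic_maps (geometric_realization K) (geometric_realization ?K') F G"
    unfolding homeomorphic_maps_def
  proof (intro conjI ballI)
    show "continuous_map (geometric_realization K) (geometric_realization ?K') F"
    proof (rule continuous_map_into_realization)
      show "continuous_map (geometric_realization K) euclideanreal (\<lambda>f. F f w)" for w
        by (cases "w \<in> \<phi> ` V") (simp_all add: F_def continuous_map_realization_coord)
      fix f assume f: "f \<in> topspace (geometric_realization K)"
      have "sum (F f) (\<phi> ` V) = sum f V" using inj F_app by (simp add: sum.reindex)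
      moreover have "0 \<le> F f w" for w using realizationD(1)[OF K f] by (simp add: F_def)
      ultimately show "F f \<in> topspace (geometric_realization ?K')"
        unfolding topspace_realization[OF K'] F_supp[OF f]
        using realizationD(2,3)[OF K f] by auto
    qed
    show "continuous_map (geometric_realization ?K') (geometric_realization K) G"
    proof (rule continuous_map_into_realization)
      show "continuous_map (geometric_realization ?K') euclideanreal (\<lambda>g. G g v)" for v
        by (cases "v \<in> V") (simp_all add: G_def continuous_map_realization_coord)
      fix g assume g: "g \<in> topspace (geometric_realization ?K')"
      have "sum (G g) V = sum g (\<phi> ` V)" using inj by (simp add: sum.reindex G_def)
      moreover have "support (G g) \<in> K"
      proof -
        obtain S where S: "S \<in> K" "support g = \<phi> ` S" using realizationD(2)[OF K' g] by auto
        have "support (G g) \<subseteq> V" by (auto simp: G_def)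
        moreover have "S \<subseteq> V" using finite_complexD(2)[OF K S(1)] .
        moreover have "\<phi> ` support (G g) = \<phi> ` S" using G_supp[OF g] S(2) by simp
        ultimately have "support (G g) = S"
          using inj_on_image_eq_iff[OF inj, of "support (G g)" S] by blast
        then show ?thesis using S by simp
      qed
      moreover have "0 \<le> G g w" for w using realizationD(1)[OF K' g] by (simp add: G_def)
      ultimately show "G g \<in> topspace (geometric_realization K)"
        unfolding topspace_realization[OF K] using realizationD(3)[OF K' g] by auto
    qed
    show "G (F f) = f" if "f \<in> topspace (geometric_realization K)" for f
    proof
      fix v
      show "G (F f) v = f v" using F_app[of v f] realizationD(4)[OF K that, of v] by (auto simp: G_def)
    qed
    show "F (G g) = g" if "g \<in> topspace (geometric_realization ?K')" for g
    proof
      fix w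
      show "F (G g) w = g w"
      proof (cases "w \<in> \<phi> ` V")
        case True
        then show ?thesis using F_app by (auto simp: G_def)
      next
        case False
        then show ?thesis using realizationD(4)[OF K' that, of w] by (auto simp: F_def)
      qed
    qed
  qed
  then show "geometric_realization K homeomorphic_space geometric_realization ?K'"
    by (auto simp: homeomorphic_space_def)
qed

section \<open>Extending a contraction of a skeleton over facets\<close>

text \<open>The classical argument for collapsing a contractible subspace with the homotopy
  extension property: \<open>g\<close> factors through the quotient and gives the inverse up to
  homotopy, and the homotopy itself descends because it keeps \<open>A\<close> inside
  \<open>A\<close> at all times.\<close>

lemma homotopy_equivalent_quotient:
  assumes q: "quotient_map X W q"
    and fib: "\<And>x y. x \<in> topspace X \<Longrightarrow> y \<in> topspace X \<Longrightarrow> q x = q y \<longleftrightarrow> x = y \<or> x \<in> A \<and> y \<in> A"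
    and A: "A \<subseteq> topspace X"
    and H: "homotopic_with (\<lambda>\<phi>. \<phi> ` A \<subseteq> A) X X id g"
    and const: "\<And>x y. x \<in> A \<Longrightarrow> y \<in> A \<Longrightarrow> g x = g y"
  shows "X homotopy_equivalent_space W"
proof -
  let ?I = "top_of_set {0..1::real}"
  note qc = quotient_imp_continuous_map[OF q]
  note qs = quotient_imp_surjective_map[OF q]
  have gc: "continuous_map X X g" using homotopic_with_imp_continuous_maps[OF H] by simp
  obtain g' where g': "continuous_map W X g'" "\<And>x. x \<in> topspace X \<Longrightarrow> g' (q x) = g x"
    using quotient_map_lift_exists[OF q gc] fib const by metis
  obtain k where k: "continuous_map (prod_topology ?I X) X k"
    and k01: "\<And>x. k (0, x) = x" "\<And>x. k (1, x) = g x"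
    and kA: "\<And>t. t \<in> {0..1} \<Longrightarrow> (\<lambda>x. k (t, x)) ` A \<subseteq> A"
    using H unfolding homotopic_with_def by auto
  \<comment> \<open>The product of a quotient map with the locally compact interval is again a
    quotient map, which yields joint continuity of the induced homotopy.\<close>
  have Q: "quotient_map (prod_topology ?I X) (prod_topology ?I W) (\<lambda>(t, x). (t, q x))"
    by (rule quotient_map_prod_right[OF _ _ q])
      (auto simp: Hausdorff_space_subtopology compact_imp_locally_compact_space compact_space_subtopology)
  have qk: "continuous_map (prod_topology ?I X) W (q \<circ> k)"
    by (rule continuous_map_compose[OF k qc])
  have "(q \<circ> k) z = (q \<circ> k) z'"
    if z: "z \<in> topspace (prod_topology ?I X)" and z': "z' \<in> topspace (prod_topology ?I X)"
      and eq: "(case z of (t, x) \<Rightarrow> (t, q x)) = (case z' of (t, x) \<Rightarrow> (t, q x))" for z z'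
  proof -
    obtain t x x' where zz: "z = (t, x)" "z' = (t, x')" "q x = q x'" and t: "t \<in> {0..1}"
      and x: "x \<in> topspace X" "x' \<in> topspace X"
      using z z' eq by (cases z; cases z') auto
    have kt: "k (t, x) \<in> topspace X" "k (t, x') \<in> topspace X"
      using continuous_map_image_subset_topspace[OF k] z z' zz by auto
    show ?thesis
    proof (cases "x = x'")
      case False
      then have "x \<in> A" "x' \<in> A" using fib[OF x] zz by auto
      then have "k (t, x) \<in> A" "k (t, x') \<in> A" using kA[OF t] by auto
      then show ?thesis using fib[OF kt] zz by simp
    qed (simp add: zz)
  qed
  then obtain K where K: "continuous_map (prod_topology ?I W) W K"
    "\<And>z. z \<in> topspace (prod_topology ?I X) \<Longrightarrow> K (case z of (t, x) \<Rightarrow> (t, q x)) = (q \<circ> k) z"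
    using quotient_map_lift_exists[OF Q qk] by metis
  have Kq: "K (t, q x) = q (k (t, x))" if "t \<in> {0..1}" "x \<in> topspace X" for t x
    using K(2)[of "(t, x)"] that by simp
  have "homotopic_with (\<lambda>x. True) W W id (q \<circ> g')"
  proof (subst homotopic_with)
    have "K (0, w) = id w \<and> K (1, w) = (q \<circ> g') w" if "w \<in> topspace W" for w
    proof -
      obtain x where x: "x \<in> topspace X" "w = q x" using qs \<open>w \<in> topspace W\<close> by auto
      then show ?thesis using Kq[of 0 x] Kq[of 1 x] k01 g' by simp
    qed
    then show "\<exists>h. continuous_map (prod_topology ?I W) W h \<and>
      (\<forall>x\<in>topspace W. h (0, x) = id x) \<and> (\<forall>x\<in>topspace W. h (1, x) = (q \<circ> g') x) \<and>
      (\<forall>t\<in>{0..1}. True)"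
      using K(1) by blast
  qed auto
  moreover have "homotopic_with (\<lambda>x. True) X X (g' \<circ> q) id"
  proof -
    have "homotopic_with (\<lambda>x. True) X X g id"
      using homotopic_with_mono[OF H] by (simp add: homotopic_with_sym)
    moreover have "homotopic_with (\<lambda>x. True) X X (g' \<circ> q) g"
      by (rule homotopic_with_equal) (use g' qc continuous_map_compose in auto)
    ultimately show ?thesis by (rule homotopic_with_trans[rotated])
  qed
  ultimately show ?thesis
    unfolding homotopy_equivalent_space_def using qc g'(1) homotopic_with_sym by blast
qed

text \<open>Needed because a continuous surjection from a compact space onto a Hausdorff space is a
  quotient map; this settles the topology of the collapse map without inspecting open sets.\<close>

lemma compact_realization:
  assumes K: "finite_complex V K"
  shows "compact_space (geometric_realization K)"
proof -
  \<comment> \<open>The closed simplex spanned by \<open>S\<close>, as a closed part of a product of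
    compact sets.\<close>
  let ?C = "\<lambda>S. PiE UNIV (\<lambda>v. if v \<in> S then {0..1::real} else {0}) \<inter>
    {f \<in> topspace (powertop_real UNIV). sum f V \<in> {1}}"
  have "compactin (powertop_real UNIV) (?C S)" for S
  proof (rule compact_Int_closedin)
    show "compactin (powertop_real UNIV) (PiE UNIV (\<lambda>v. if v \<in> S then {0..1} else {0}))"
      unfolding compactin_PiE by auto
    show "closedin (powertop_real UNIV) {f \<in> topspace (powertop_real UNIV). sum f V \<in> {1}}"
      by (rule closedin_continuous_map_preimage[where Y = euclideanreal])
        (use finite_complexD(1)[OF K] in \<open>auto intro!: continuous_intros continuous_map_product_projection\<close>)
  qed
  moreover have "finite K" using finite_complexD(1,2)[OF K] by (meson PowI finite_Pow_iff finite_subset subsetI)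
  ultimately have "compactin (powertop_real UNIV) (\<Union>S\<in>K. ?C S)"
    by (intro compactin_Union) auto
  moreover have "(\<Union>S\<in>K. ?C S) = topspace (geometric_realization K)"
  proof (intro subset_antisym subsetI)
    fix f assume "f \<in> (\<Union>S\<in>K. ?C S)"
    then obtain S where S: "S \<in> K" "\<And>v. f v \<in> (if v \<in> S then {0..1} else {0})" "sum f V = 1"
      by (auto simp: PiE_iff)
    have "v \<in> S" if "f v \<noteq> 0" for v using S(2)[of v] that by (auto split: if_splits)
    then have "support f \<subseteq> S" by blast
    then have "support f \<in> K" using finite_complexD(4)[OF K S(1)] support_nonempty[OF S(3)] by blast
    moreover have "0 \<le> f v" for v using S(2)[of v] by (auto split: if_splits)
    ultimately show "f \<in> topspace (geometric_realization K)"
      unfolding topspace_realization[OF K] using S(3) by simp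
  next
    fix f assume f: "f \<in> topspace (geometric_realization K)"
    have "f \<in> ?C (support f)" using realizationD[OF K f] by (auto simp: PiE_iff)
    then show "f \<in> (\<Union>S\<in>K. ?C S)" using realizationD(2)[OF K f] by blast
  qed
  moreover have "geometric_realization K = subtopology (powertop_real UNIV) (topspace (geometric_realization K))"
    unfolding geometric_realization_def by simp
  ultimately show ?thesis by (metis compactin_subspace)
qed

text \<open>By \<open>facet\<close> the members of \<Sigma> are pairwise incomparable, and their
  proper nonempty subsets lie in \<open>T\<close>. Each is thus a cell attached to \<open>T\<close>
  along its whole boundary.\<close>

locale facet_attachment =
  fixes V :: "'a set" and K T \<Sigma> :: "'a set set"
  assumes complex_K: "finite_complex V K" and complex_T: "finite_complex V T"
    and K_eq: "K = T \<union> \<Sigma>" and disjoint: "T \<inter> \<Sigma> = {}" and nonempty: "{} \<notin> \<Sigma>"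
    and facet: "\<And>S \<sigma>. S \<in> K \<Longrightarrow> \<sigma> \<in> \<Sigma> \<Longrightarrow> \<sigma> \<subseteq> S \<Longrightarrow> S = \<sigma>"
begin

abbreviation "X \<equiv> geometric_realization K"
abbreviation "A \<equiv> topspace (geometric_realization T)"

definition depth :: "'a set \<Rightarrow> ('a \<Rightarrow> real) \<Rightarrow> real" where
  "depth \<sigma> f = Min (f ` \<sigma>)"

text \<open>At a point of \<open>X\<close> at most one summand is nonzero, namely that of the open
  facet containing it. The sum gives one formula that is visibly continuous on all of
  \<open>X\<close>.\<close>

definition depth_vector :: "('a \<Rightarrow> real) \<Rightarrow> 'a \<Rightarrow> real" where
  "depth_vector f v = (\<Sum>\<sigma>\<in>\<Sigma>. if v \<in> \<sigma> then depth \<sigma> f else 0)"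

definition total_depth :: "('a \<Rightarrow> real) \<Rightarrow> real" where
  "total_depth f = sum (depth_vector f) V"

text \<open>Pushes points of the facets radially away from the barycenter; at \<open>\<tau> = 1\<close> the boundary is
  reached. The barycenter has \<open>total_depth\<close> 1.\<close>

definition push :: "real \<Rightarrow> ('a \<Rightarrow> real) \<Rightarrow> 'a \<Rightarrow> real" where
  "push \<tau> f v = (f v - \<tau> * depth_vector f v) / (1 - \<tau> * total_depth f)"

lemma A_subset: "A \<subseteq> topspace X"
  using K_eq unfolding geometric_realization_def by auto

lemma facetD:
  assumes "\<sigma> \<in> \<Sigma>"
  shows "finite \<sigma>" "\<sigma> \<noteq> {}" "\<sigma> \<subseteq> V" "0 < card \<sigma>"
  using assms finite_complexD(2,3)[OF complex_K] nonempty K_eq by (auto simp: card_gt_0_iff)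

lemma finite_facets: "finite \<Sigma>"
  using finite_complexD(1,2)[OF complex_K] K_eq by (metis PowI finite_Pow_iff finite_Un finite_subset subsetI)

lemma depth_le: "\<sigma> \<in> \<Sigma> \<Longrightarrow> v \<in> \<sigma> \<Longrightarrow> depth \<sigma> f \<le> f v"
  using facetD(1) by (auto simp: depth_def)

lemma depth_attained: "\<sigma> \<in> \<Sigma> \<Longrightarrow> \<exists>v\<in>\<sigma>. f v = depth \<sigma> f"
  using Min_in[of "f ` \<sigma>"] facetD(1,2)[of \<sigma>] unfolding depth_def by fastforce

lemma depth_nonneg: "f \<in> topspace X \<Longrightarrow> \<sigma> \<in> \<Sigma> \<Longrightarrow> 0 \<le> depth \<sigma> f"
  using depth_attained[of \<sigma> f] realizationD(1)[OF complex_K] by metis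

text \<open>Positive coordinates on \<sigma> only give
  \<open>\<sigma> \<subseteq> support f\<close>; the facet condition turns this into
  equality.\<close>

lemma depth_pos_iff:
  assumes f: "f \<in> topspace X" and \<sigma>: "\<sigma> \<in> \<Sigma>"
  shows "0 < depth \<sigma> f \<longleftrightarrow> support f = \<sigma>"
proof
  assume "0 < depth \<sigma> f"
  then have "f v \<noteq> 0" if "v \<in> \<sigma>" for v using depth_le[OF \<sigma> that, of f] by linarith
  then have "\<sigma> \<subseteq> support f" by blast
  then show "support f = \<sigma>" using facet realizationD(2)[OF complex_K f] \<sigma> by blast
next
  assume "support f = \<sigma>"
  then have "depth \<sigma> f \<noteq> 0" using depth_attained[OF \<sigma>, of f] by auto
  then show "0 < depth \<sigma> f" using depth_nonneg[OF f \<sigma>] by linarith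
qed

lemma depth_eq_0: "f \<in> topspace X \<Longrightarrow> \<sigma> \<in> \<Sigma> \<Longrightarrow> support f \<noteq> \<sigma> \<Longrightarrow> depth \<sigma> f = 0"
  using depth_pos_iff depth_nonneg less_eq_real_def by metis

lemma depth_vector_cases:
  assumes f: "f \<in> topspace X"
  obtains (skeleton) "f \<in> A" "\<And>v. depth_vector f v = 0" "total_depth f = 0"
  | (cell) \<sigma> where "\<sigma> \<in> \<Sigma>" "support f = \<sigma>" "f \<notin> A"
      "\<And>v. depth_vector f v = (if v \<in> \<sigma> then depth \<sigma> f else 0)"
      "total_depth f = card \<sigma> * depth \<sigma> f"
proof (cases "support f \<in> T")
  case True
  then have "f \<in> A" using f unfolding topspace_realization[OF complex_T] topspace_realization[OF complex_K] by simp
  moreover have "depth \<sigma> f = 0" if "\<sigma> \<in> \<Sigma>" for \<sigma>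
    using depth_eq_0[OF f that] True that disjoint by blast
  then have "depth_vector f v = 0" for v unfolding depth_vector_def by (intro sum.neutral) simp
  ultimately show thesis using that(1) by (simp add: total_depth_def)
next
  case False
  then have \<sigma>: "support f \<in> \<Sigma>" using realizationD(2)[OF complex_K f] K_eq by blast
  have "f \<notin> A" using False realizationD(2)[OF complex_T] by blast
  moreover have dv: "depth_vector f v = (if v \<in> support f then depth (support f) f else 0)" for v
  proof -
    have "depth_vector f v = (\<Sum>\<sigma>\<in>\<Sigma>. if \<sigma> = support f then (if v \<in> \<sigma> then depth \<sigma> f else 0) else 0)"
      unfolding depth_vector_def using depth_eq_0[OF f] by (intro sum.cong) auto
    then show ?thesis using \<sigma> finite_facets by simp
  qed
  moreover have "total_depth f = card (support f) * depth (support f) f"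
    unfolding total_depth_def dv using facetD(3)[OF \<sigma>] finite_complexD(1)[OF complex_K]
    by (simp add: sum.If_cases Int_absorb1)
  ultimately show thesis using that(2)[OF \<sigma> refl] by blast
qed

lemma depth_vector_bounds:
  assumes f: "f \<in> topspace X"
  shows "0 \<le> depth_vector f v" "depth_vector f v \<le> f v"
  using depth_vector_cases[OF f]
  by (cases; use depth_nonneg[OF f] depth_le realizationD(1)[OF complex_K f] in auto)+

lemma total_depth_bounds:
  assumes f: "f \<in> topspace X"
  shows "0 \<le> total_depth f" "total_depth f \<le> 1"
proof -
  show "0 \<le> total_depth f"
    unfolding total_depth_def by (rule sum_nonneg) (rule depth_vector_bounds(1)[OF f])
  have "total_depth f \<le> sum f V"
    unfolding total_depth_def by (rule sum_mono) (rule depth_vector_bounds(2)[OF f])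
  then show "total_depth f \<le> 1" using realizationD(3)[OF complex_K f] by simp
qed

lemma push_in_X:
  assumes f: "f \<in> topspace X" and \<tau>: "0 \<le> \<tau>" "\<tau> \<le> 1" "\<tau> * total_depth f < 1"
  shows "push \<tau> f \<in> topspace X" "support (push \<tau> f) \<subseteq> support f"
proof -
  have "\<tau> * depth_vector f v \<le> f v" for v
    using mult_mono[OF \<tau>(2) depth_vector_bounds(2)[OF f, of v]] depth_vector_bounds(1)[OF f, of v] by simp
  then have nn: "0 \<le> push \<tau> f v" for v using \<tau> by (simp add: push_def)
  have "sum (push \<tau> f) V = (sum f V - \<tau> * total_depth f) / (1 - \<tau> * total_depth f)"
    by (simp add: push_def total_depth_def sum_subtractf sum_distrib_left flip: sum_divide_distrib)
  then have sum: "sum (push \<tau> f) V = 1" using \<tau> realizationD(3)[OF complex_K f] by simp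
  have "push \<tau> f v = 0" if "f v = 0" for v
    using depth_vector_bounds[OF f, of v] that by (simp add: push_def)
  then show sub: "support (push \<tau> f) \<subseteq> support f" by auto
  have "support (push \<tau> f) \<in> K"
    using finite_complexD(4)[OF complex_K realizationD(2)[OF complex_K f] sub support_nonempty[OF sum]] .
  then show "push \<tau> f \<in> topspace X"
    unfolding topspace_realization[OF complex_K] using nn sum by simp
qed

lemma push_on_A: "f \<in> A \<Longrightarrow> push \<tau> f = f"
proof -
  assume f: "f \<in> A"
  then have "f \<in> topspace X" using A_subset by blast
  then show ?thesis
  proof (cases rule: depth_vector_cases)
    case skeleton
    then show ?thesis by (intro ext) (simp add: push_def)
  qed (use f in blast)
qed

text \<open>At \<open>\<tau> = 1\<close> the vertices attaining the minimum over the facet lose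
  their whole coordinate, so the support shrinks to a proper face. The bound on
  \<open>total_depth\<close> excludes the barycenter, where the quotient would be 0/0.\<close>

lemma push_1_in_A:
  assumes f: "f \<in> topspace X" and lt: "total_depth f < 1"
  shows "push 1 f \<in> A"
  using f
proof (cases rule: depth_vector_cases)
  case skeleton
  then show ?thesis using push_on_A by simp
next
  case (cell \<sigma>)
  have p: "push 1 f \<in> topspace X" "support (push 1 f) \<subseteq> \<sigma>"
    using push_in_X[OF f, of 1] lt cell(2) by auto
  obtain v where v: "v \<in> \<sigma>" "f v = depth \<sigma> f" using depth_attained[OF cell(1)] by blast
  have "push 1 f v = 0" using v by (simp add: push_def cell(4))
  then have "support (push 1 f) \<noteq> \<sigma>" using v(1) by blast
  then have "support (push 1 f) \<notin> \<Sigma>"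
    using facet[of \<sigma> "support (push 1 f)"] p(2) cell(1) K_eq by auto
  then have "support (push 1 f) \<in> T" using realizationD(2)[OF complex_K p(1)] K_eq by simp
  then show ?thesis
    using p(1) unfolding topspace_realization[OF complex_T] topspace_realization[OF complex_K] by simp
qed

lemma continuous_depth: "\<sigma> \<in> \<Sigma> \<Longrightarrow> continuous_map X euclideanreal (depth \<sigma>)"
  unfolding depth_def by (rule continuous_map_Min[OF facetD(1,2) continuous_map_realization_coord])

lemma continuous_depth_vector: "continuous_map X euclideanreal (\<lambda>f. depth_vector f v)"
proof -
  have "continuous_map X euclideanreal (\<lambda>f. if v \<in> \<sigma> then depth \<sigma> f else 0)" if "\<sigma> \<in> \<Sigma>" for \<sigma>
    using continuous_depth[OF that] by (cases "v \<in> \<sigma>") auto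
  then show ?thesis unfolding depth_vector_def using finite_facets by (intro continuous_map_sum) auto
qed

lemma continuous_total_depth: "continuous_map X euclideanreal total_depth"
  unfolding total_depth_def using finite_complexD(1)[OF complex_K] continuous_depth_vector
  by (intro continuous_map_sum) auto

lemma continuous_push:
  assumes "continuous_map Y X f" "continuous_map Y euclideanreal \<tau>"
    "\<And>y. y \<in> topspace Y \<Longrightarrow> \<tau> y * total_depth (f y) < 1"
  shows "continuous_map Y euclideanreal (\<lambda>y. push (\<tau> y) (f y) v)"
proof -
  have "continuous_map Y euclideanreal (\<lambda>y. depth_vector (f y) v)"
    "continuous_map Y euclideanreal (\<lambda>y. total_depth (f y))"
    using continuous_map_compose[OF assms(1) continuous_depth_vector]
      continuous_map_compose[OF assms(1) continuous_total_depth] by (simp_all add: o_def)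
  then show ?thesis unfolding push_def using assms(3)
    by (intro continuous_intros assms(2) continuous_map_realization_coord_compose[OF assms(1)]) force+
qed

text \<open>The homotopy extension property of the pair, in the form needed for the quotient: the
  cutoff \<open>min 1 (2 - 2 \<mu>)\<close> moves the collar \<open>\<mu> \<le> 1/2\<close> into the skeleton, after which the contraction of
  the skeleton, slowed down by \<open>1 - 2 \<mu>\<close>, extends over the facets.\<close>

lemma contraction_extends:
  assumes "contractible_space (geometric_realization T)"
  obtains g where "homotopic_with (\<lambda>\<phi>. \<phi> ` A \<subseteq> A) X X id g" "\<And>x y. x \<in> A \<Longrightarrow> y \<in> A \<Longrightarrow> g x = g y"
proof -
  let ?I = "top_of_set {0..1::real}"
  let ?P = "\<lambda>\<phi> :: ('a \<Rightarrow> real) \<Rightarrow> 'a \<Rightarrow> real. \<phi> ` A \<subseteq> A"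
  have P_cong: "?P h \<longleftrightarrow> ?P k" if "\<And>x. x \<in> topspace X \<Longrightarrow> h x = k x" for h k
    using A_subset that by (metis (no_types, lifting) image_cong subsetD)
  obtain a h where h: "continuous_map (prod_topology ?I (geometric_realization T)) (geometric_realization T) h"
    and h0: "\<And>x. h (0, x) = x" and h1: "\<And>x. h (1, x) = a"
    using assms unfolding contractible_space_def homotopic_with_def by auto
  have hA: "h (t, x) \<in> A" if "t \<in> {0..1}" "x \<in> A" for t x
    using continuous_map_image_subset_topspace[OF h] that by auto
  define cut where "cut f = min 1 (2 - 2 * total_depth f)" for f
  have cut: "0 \<le> cut f" "cut f \<le> 1" "t * cut f * total_depth f < 1"
    if f: "f \<in> topspace X" and t: "t \<in> {0..1}" for f t
  proof -
    show c: "0 \<le> cut f" "cut f \<le> 1" using total_depth_bounds[OF f] by (auto simp: cut_def)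
    have *: "t * cut f \<le> cut f" using t c by (simp add: mult_left_le_one_le)
    show "t * cut f * total_depth f < 1"
    \<comment> \<open>Only at a barycenter could the denominator vanish, and there the cutoff is
      0.\<close>
    proof (cases "total_depth f = 1")
      case True
      then show ?thesis by (simp add: cut_def)
    next
      case False
      have "t * cut f * total_depth f \<le> 1 * total_depth f"
        using total_depth_bounds[OF f] * c by (intro mult_right_mono) auto
      then show ?thesis using False total_depth_bounds[OF f] by simp
    qed
  qed
  have fst: "continuous_map (prod_topology ?I X) euclideanreal fst"
    using continuous_map_fst continuous_map_into_fulltopology by blast
  have td: "continuous_map (prod_topology ?I X) euclideanreal (\<lambda>z. total_depth (snd z))"
    using continuous_map_compose[OF continuous_map_snd continuous_total_depth] by (simp add: o_def)
  have ccut: "continuous_map (prod_topology ?I X) euclideanreal (\<lambda>z. cut (snd z))"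
    unfolding cut_def by (intro continuous_intros continuous_map_real_min td)
  define g1 where "g1 f = push (cut f) f" for f
  have g1: "homotopic_with ?P X X id g1"
  proof (subst homotopic_with[OF P_cong], assumption)
    let ?h = "\<lambda>z. push (fst z * cut (snd z)) (snd z)"
    have "continuous_map (prod_topology ?I X) X ?h"
    proof (rule continuous_map_into_realization)
      show "continuous_map (prod_topology ?I X) euclideanreal (\<lambda>z. ?h z v)" for v
        by (rule continuous_push[OF continuous_map_snd])
          (use cut in \<open>auto intro!: continuous_intros fst ccut\<close>)
      show "?h z \<in> topspace X" if "z \<in> topspace (prod_topology ?I X)" for z
        using that cut[of "snd z" "fst z"] by (intro push_in_X) (auto intro: mult_le_one)
    qed
    moreover have "?h (0, f) = id f" for f by (simp add: push_def fun_eq_iff)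
    ultimately show "\<exists>h. continuous_map (prod_topology ?I X) X h \<and>
      (\<forall>x\<in>topspace X. h (0, x) = id x) \<and> (\<forall>x\<in>topspace X. h (1, x) = g1 x) \<and>
      (\<forall>t\<in>{0..1}. ?P (\<lambda>x. h (t, x)))"
      by (intro exI[of _ ?h]) (auto simp: g1_def push_on_A)
  qed
  \<comment> \<open>The branches agree at depth 1/2: there the time passed to \<open>h\<close> is 0,
    where \<open>h\<close> is the identity, and \<open>cut\<close> is 1, so that \<open>g1\<close>
    is \<open>push 1\<close> as well.\<close>
  define H where "H z = (if total_depth (snd z) \<le> 1/2
    then h (fst z * (1 - 2 * total_depth (snd z)), push 1 (snd z)) else g1 (snd z))" for z
  have H_A: "H (t, x) = h (t, x)" if "x \<in> A" for t x
  proof -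
    have "x \<in> topspace X" using A_subset that by blast
    then have "total_depth x = 0" by (cases rule: depth_vector_cases) (use that in auto)
    then show ?thesis by (simp add: H_def push_on_A[OF that])
  qed
  have "homotopic_with ?P X X g1 (\<lambda>x. H (1, x))"
  proof (subst homotopic_with[OF P_cong], assumption)
    have "continuous_map (prod_topology ?I X) X H"
      unfolding H_def
    proof (rule continuous_map_cases_le[OF td])
      let ?Y = "subtopology (prod_topology ?I X) {z \<in> topspace (prod_topology ?I X). total_depth (snd z) \<le> 1/2}"
      have in1: "fst z * (1 - 2 * total_depth (snd z)) \<in> {0..1}" if "z \<in> topspace ?Y" for z
      proof -
        have "0 \<le> fst z" "fst z \<le> 1" "0 \<le> total_depth (snd z)" "total_depth (snd z) \<le> 1/2"
          using that total_depth_bounds(1)[of "snd z"] by auto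
        then show ?thesis using mult_le_one[of "fst z" "1 - 2 * total_depth (snd z)"] by simp
      qed
      have "continuous_map ?Y ?I (\<lambda>z. fst z * (1 - 2 * total_depth (snd z)))"
        using in1 unfolding continuous_map_in_subtopology
        by (auto intro!: continuous_intros continuous_map_from_subtopology fst td)
      moreover have "continuous_map ?Y (geometric_realization T) (\<lambda>z. push 1 (snd z))"
      proof (rule continuous_map_into_realization)
        show "continuous_map ?Y euclideanreal (\<lambda>z. push 1 (snd z) v)" for v
          by (rule continuous_push)
            (auto intro!: continuous_map_from_subtopology continuous_map_snd)
        show "push 1 (snd z) \<in> A" if "z \<in> topspace ?Y" for z
          using that by (intro push_1_in_A) auto
      qed
      ultimately have "continuous_map ?Y (prod_topology ?I (geometric_realization T))
        (\<lambda>z. (fst z * (1 - 2 * total_depth (snd z)), push 1 (snd z)))"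
        by (simp add: continuous_map_pairedI)
      from continuous_map_compose[OF this h]
      have "continuous_map ?Y (geometric_realization T)
        (\<lambda>z. h (fst z * (1 - 2 * total_depth (snd z)), push 1 (snd z)))" by (simp add: o_def)
      then show "continuous_map ?Y X (\<lambda>z. h (fst z * (1 - 2 * total_depth (snd z)), push 1 (snd z)))"
        by (rule continuous_map_realization_mono) (simp add: K_eq)
      let ?Y' = "subtopology (prod_topology ?I X) {z \<in> topspace (prod_topology ?I X). 1/2 \<le> total_depth (snd z)}"
      have "continuous_map (prod_topology ?I X) X (\<lambda>z. g1 (snd z))"
        using continuous_map_compose[OF continuous_map_snd] homotopic_with_imp_continuous_maps[OF g1]
        by (force simp: o_def)
      then show "continuous_map ?Y' X (\<lambda>z. g1 (snd z))" by (rule continuous_map_from_subtopology)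
      show "h (fst z * (1 - 2 * total_depth (snd z)), push 1 (snd z)) = g1 (snd z)"
        if "total_depth (snd z) = 1/2" for z
        unfolding that by (simp add: h0 g1_def cut_def that)
    qed simp
    moreover have "H (0, f) = g1 f" for f using h0 by (simp add: H_def g1_def cut_def)
    ultimately show "\<exists>h. continuous_map (prod_topology ?I X) X h \<and>
      (\<forall>x\<in>topspace X. h (0, x) = g1 x) \<and> (\<forall>x\<in>topspace X. h (1, x) = H (1, x)) \<and>
      (\<forall>t\<in>{0..1}. ?P (\<lambda>x. h (t, x)))"
      by (intro exI[of _ H]) (auto simp: H_A hA)
  qed
  then have "homotopic_with ?P X X id (\<lambda>x. H (1, x))" by (rule homotopic_with_trans[OF g1])
  moreover have "H (1, x) = H (1, y)" if "x \<in> A" "y \<in> A" for x y using that H_A h1 by simp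
  ultimately show thesis using that by blast
qed

end

section \<open>Collapsing a contractible skeleton to a wedge of spheres\<close>

lemma sum_atMost_head: "(\<Sum>i\<le>d. h i) = h 0 + (\<Sum>i\<in>{1..d}. h i)" for h :: "nat \<Rightarrow> real"
  using sum.atLeast_Suc_atMost[of 0 d h] by (simp add: atMost_atLeast0)

lemma continuous_map_from_sum_topology:
  assumes "\<And>i. i \<in> I \<Longrightarrow> continuous_map (X i) Y (\<lambda>x. f (i, x))"
  shows "continuous_map (sum_topology X I) Y f"
  unfolding continuous_map_def
proof (intro conjI allI impI)
  show "f \<in> topspace (sum_topology X I) \<rightarrow> topspace Y"
    using continuous_map_image_subset_topspace[OF assms] by fastforce
  fix U assume U: "openin Y U"
  have "{x. (i, x) \<in> {z \<in> topspace (sum_topology X I). f z \<in> U}} = {x \<in> topspace (X i). f (i, x) \<in> U}"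
    if "i \<in> I" for i using that by auto
  then show "openin (sum_topology X I) {z \<in> topspace (sum_topology X I). f z \<in> U}"
    using openin_continuous_map_preimage[OF assms U] unfolding openin_sum_topology by auto
qed

section \<open>Spheres and their wedges\<close>

definition sphere_base :: "nat \<Rightarrow> real" where
  "sphere_base = (\<lambda>j. if j = 0 then 1 else 0)"

lemma nsphere_eq_base:
  assumes "x \<in> topspace (nsphere d)" "x 0 = 1"
  shows "x = sphere_base"
proof
  fix j
  have x: "(\<Sum>i\<le>d. (x i)\<^sup>2) = 1" "\<And>i. i > d \<Longrightarrow> x i = 0" using assms(1) by (auto simp: nsphere)
  have "(\<Sum>i\<le>d. (x i)\<^sup>2) = (x 0)\<^sup>2 + (\<Sum>i\<in>{1..d}. (x i)\<^sup>2)"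
    by (rule sum_atMost_head)
  then have "(\<Sum>i\<in>{1..d}. (x i)\<^sup>2) = 0" using x assms(2) by simp
  then have "x i = 0" if "1 \<le> i" "i \<le> d" for i
    using that by (simp add: sum_nonneg_eq_0_iff)
  then show "x j = sphere_base j"
    using assms(2) x(2)[of j] by (cases "j = 0"; cases "j \<le> d") (auto simp: sphere_base_def)
qed

definition wedge_point :: "nat \<times> (nat \<Rightarrow> real) \<Rightarrow> (nat \<times> (nat \<Rightarrow> real)) option" where
  "wedge_point = (\<lambda>(i, x). if x = sphere_base then None else Some (i, x))"

lemma quotient_map_wedge_of_spheres:
  "quotient_map (sum_topology (\<lambda>i. nsphere (ds ! i)) {..<length ds}) (wedge_of_spheres ds) wedge_point"
  unfolding wedge_of_spheres_def wedge_def wedge_point_def sphere_base_def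
  by (rule quotient_map_quotient_topology)

lemma continuous_map_wedge_point:
  assumes "i < length ds"
  shows "continuous_map (nsphere (ds ! i)) (wedge_of_spheres ds) (\<lambda>x. wedge_point (i, x))"
  using continuous_map_compose[OF continuous_map_component_injection
      quotient_imp_continuous_map[OF quotient_map_wedge_of_spheres], of i ds] assms
  by (simp add: o_def)

lemma topspace_wedge_of_spheres:
  "topspace (wedge_of_spheres ds) = wedge_point ` Sigma {..<length ds} (\<lambda>i. topspace (nsphere (ds ! i)))"
  using quotient_imp_surjective_map[OF quotient_map_wedge_of_spheres, of ds] by (simp add: o_def)

text \<open>The wedge maps injectively into the product of its spheres, onto the points with at most
  one component off the base point. A continuous injection into a Hausdorff space suffices;
  \<open>E\<close> lists the components in all coordinates.\<close>

lemma Hausdorff_wedge_of_spheres: "Hausdorff_space (wedge_of_spheres ds)"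
proof -
  define E :: "(nat \<times> (nat \<Rightarrow> real)) option \<Rightarrow> nat \<times> nat \<Rightarrow> real" where
    "E w = (\<lambda>(j, c). case w of None \<Rightarrow> sphere_base c | Some (i, x) \<Rightarrow> if j = i then x c else sphere_base c)" for w
  have E: "E (wedge_point (i, x)) (j, c) = (if j = i then x c else sphere_base c)" for i x j c
    by (simp add: E_def wedge_point_def)
  have "continuous_map (sum_topology (\<lambda>i. nsphere (ds ! i)) {..<length ds}) (powertop_real UNIV) (E \<circ> wedge_point)"
  proof (rule continuous_map_from_sum_topology)
    fix i
    have "continuous_map (nsphere (ds ! i)) euclideanreal (\<lambda>x. E (wedge_point (i, x)) p)" for p
      using continuous_map_nsphere_projection by (cases p) (auto simp: E)
    then show "continuous_map (nsphere (ds ! i)) (powertop_real UNIV) (\<lambda>x. (E \<circ> wedge_point) (i, x))"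
      by (simp add: continuous_map_componentwise_UNIV)
  qed
  then have "continuous_map (wedge_of_spheres ds) (powertop_real UNIV) E"
    by (rule continuous_compose_quotient_map[OF quotient_map_wedge_of_spheres])
  moreover have "inj_on E (topspace (wedge_of_spheres ds))"
  proof (rule inj_onI)
    fix w w' assume "w \<in> topspace (wedge_of_spheres ds)" "w' \<in> topspace (wedge_of_spheres ds)"
      and eq: "E w = E w'"
    then obtain i x j y where w: "w = wedge_point (i, x)" "w' = wedge_point (j, y)"
      unfolding topspace_wedge_of_spheres by auto
    have *: "(if k = i then x c else sphere_base c) = (if k = j then y c else sphere_base c)" for k c
      using eq unfolding w by (metis E)
    show "w = w'"
    proof (cases "i = j")
      case True
      then have "x = y" using * by (intro ext) metis
      then show ?thesis using True w by simp
    next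
      case False
      then have "x c = sphere_base c" "y c = sphere_base c" for c using *[of i c] *[of j c] by auto
      then have "x = sphere_base" "y = sphere_base" by auto
      then show ?thesis by (simp add: w wedge_point_def)
    qed
  qed
  moreover have "Hausdorff_space (powertop_real (UNIV :: (nat \<times> nat) set))"
    by (simp add: Hausdorff_space_product_topology)
  ultimately show ?thesis by (metis Hausdorff_space_injective_preimage)
qed

lemma wedge_of_one_sphere: "wedge_of_spheres [d] homeomorphic_space nsphere d"
proof -
  let ?W = "wedge_of_spheres [d]"
  let ?S = "sum_topology (\<lambda>i. nsphere ([d] ! i)) {..<length [d]}"
  have c: "continuous_map ?S (nsphere d) snd"
    by (rule continuous_map_from_sum_topology) simp
  have e: "snd z = snd z'"
    if "z \<in> topspace ?S" "z' \<in> topspace ?S" "wedge_point z = wedge_point z'" for z z'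
    using that by (cases z; cases z') (auto simp: wedge_point_def split: if_splits)
  obtain g where g: "continuous_map ?W (nsphere d) g"
    "\<And>z. z \<in> topspace ?S \<Longrightarrow> g (wedge_point z) = snd z"
    by (rule quotient_map_lift_exists[OF quotient_map_wedge_of_spheres c e]) auto
  have gi: "g (wedge_point (0, x)) = x" if "x \<in> topspace (nsphere d)" for x
    using g(2)[of "(0, x)"] that by simp
  have "homeomorphic_maps ?W (nsphere d) g (\<lambda>x. wedge_point (0, x))"
    unfolding homeomorphic_maps_def
    using g(1) continuous_map_wedge_point[of 0 "[d]"] gi by (auto simp: topspace_wedge_of_spheres)
  then show ?thesis by (auto simp: homeomorphic_space_def)
qed

section \<open>Open facets as spheres without base point\<close>

context facet_attachment
begin

definition enum :: "'a set \<Rightarrow> nat \<Rightarrow> 'a" where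
  "enum \<sigma> = (SOME e. bij_betw e {..card \<sigma> - 1} \<sigma>)"

text \<open>The offset at index 0 is always 0. Only the indices from 1 to
  \<open>card \<sigma> - 1\<close> carry information, which leaves coordinate 0 of the sphere free
  for the axis of the projection.\<close>

definition offset :: "'a set \<Rightarrow> ('a \<Rightarrow> real) \<Rightarrow> nat \<Rightarrow> real" where
  "offset \<sigma> f i = f (enum \<sigma> i) - f (enum \<sigma> 0)"

definition spread :: "'a set \<Rightarrow> ('a \<Rightarrow> real) \<Rightarrow> real" where
  "spread \<sigma> f = (\<Sum>i\<le>card \<sigma> - 1. (offset \<sigma> f i)\<^sup>2) + (1 - sum f \<sigma>)\<^sup>2"

text \<open>The inverse stereographic projection of \<open>offset / depth\<close>, with denominators cleared. The second
  summand of \<open>spread\<close> vanishes on the facet and keeps the denominator positive outside of it.\<close>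

definition to_sphere :: "'a set \<Rightarrow> ('a \<Rightarrow> real) \<Rightarrow> nat \<Rightarrow> real" where
  "to_sphere \<sigma> f i =
    (if i = 0 then (spread \<sigma> f - (depth \<sigma> f)\<^sup>2) / (spread \<sigma> f + (depth \<sigma> f)\<^sup>2)
     else if i \<le> card \<sigma> - 1 then 2 * depth \<sigma> f * offset \<sigma> f i / (spread \<sigma> f + (depth \<sigma> f)\<^sup>2)
     else 0)"

lemma enum: "\<sigma> \<in> \<Sigma> \<Longrightarrow> bij_betw (enum \<sigma>) {..card \<sigma> - 1} \<sigma>"
proof -
  assume \<sigma>: "\<sigma> \<in> \<Sigma>"
  have "{..card \<sigma> - 1} = {0..<card \<sigma>}" using facetD(4)[OF \<sigma>] by auto
  then have "\<exists>e. bij_betw e {..card \<sigma> - 1} \<sigma>"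
    using ex_bij_betw_nat_finite[OF facetD(1)[OF \<sigma>]] by simp
  then show ?thesis unfolding enum_def by (rule someI_ex)
qed

lemma enum_cases:
  assumes "\<sigma> \<in> \<Sigma>" "v \<in> \<sigma>"
  obtains i where "i \<le> card \<sigma> - 1" "v = enum \<sigma> i"
  using bij_betw_imp_surj_on[OF enum[OF assms(1)]] assms(2) by auto

lemma enum_in: "\<sigma> \<in> \<Sigma> \<Longrightarrow> i \<le> card \<sigma> - 1 \<Longrightarrow> enum \<sigma> i \<in> \<sigma>"
  using bij_betwE[OF enum] by blast

lemma sum_enum: "\<sigma> \<in> \<Sigma> \<Longrightarrow> sum f \<sigma> = (\<Sum>i\<le>card \<sigma> - 1. f (enum \<sigma> i))"
  using sum.reindex_bij_betw[OF enum, of \<sigma> f] by simp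

lemma spread_nonneg: "0 \<le> spread \<sigma> f"
  by (simp add: spread_def sum_nonneg)

text \<open>If both terms vanished, \<open>f\<close> would be constant on \<sigma> with minimum 0,
  and yet sum to 1 there.\<close>

lemma denominator_pos:
  assumes \<sigma>: "\<sigma> \<in> \<Sigma>"
  shows "0 < spread \<sigma> f + (depth \<sigma> f)\<^sup>2"
proof (rule ccontr)
  assume "\<not> 0 < spread \<sigma> f + (depth \<sigma> f)\<^sup>2"
  then have "spread \<sigma> f + (depth \<sigma> f)\<^sup>2 = 0"
    using spread_nonneg[of \<sigma> f] zero_le_power2[of "depth \<sigma> f"] by linarith
  then have z: "depth \<sigma> f = 0" "spread \<sigma> f = 0"
    using spread_nonneg[of \<sigma> f] by (auto simp: add_nonneg_eq_0_iff)
  then have "(\<Sum>i\<le>card \<sigma> - 1. (offset \<sigma> f i)\<^sup>2) = 0" and s: "sum f \<sigma> = 1"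
    unfolding spread_def by (auto simp: add_nonneg_eq_0_iff sum_nonneg)
  then have o: "offset \<sigma> f i = 0" if "i \<le> card \<sigma> - 1" for i
    using that by (simp add: sum_nonneg_eq_0_iff)
  obtain v where v: "v \<in> \<sigma>" "f v = 0" using depth_attained[OF \<sigma>, of f] z by auto
  obtain i where i: "i \<le> card \<sigma> - 1" "v = enum \<sigma> i" using enum_cases[OF \<sigma> v(1)] .
  have "f (enum \<sigma> 0) = 0" using o[OF i(1)] i v by (simp add: offset_def)
  then have "f (enum \<sigma> j) = 0" if "j \<le> card \<sigma> - 1" for j using o[OF that] by (simp add: offset_def)
  then have "sum f \<sigma> = 0" unfolding sum_enum[OF \<sigma>] by simp
  then show False using s by simp
qed

lemma sum_facet:
  assumes f: "f \<in> topspace X" and \<sigma>: "\<sigma> \<in> \<Sigma>" and d: "depth \<sigma> f \<noteq> 0"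
  shows "support f = \<sigma>" "sum f \<sigma> = 1" "0 < depth \<sigma> f"
proof -
  show d': "0 < depth \<sigma> f" using d depth_nonneg[OF f \<sigma>] by simp
  then show s: "support f = \<sigma>" using depth_pos_iff[OF f \<sigma>] by simp
  have "sum f \<sigma> = sum f V"
    using s facetD(3)[OF \<sigma>] finite_complexD(1)[OF complex_K] by (intro sum.mono_neutral_left) auto
  then show "sum f \<sigma> = 1" using realizationD(3)[OF complex_K f] by simp
qed

lemma to_sphere_in_nsphere:
  assumes f: "f \<in> topspace X" and \<sigma>: "\<sigma> \<in> \<Sigma>"
  shows "to_sphere \<sigma> f \<in> topspace (nsphere (card \<sigma> - 1))"
proof -
  define m S D d where "m = depth \<sigma> f" and "S = spread \<sigma> f" and "D = S + m\<^sup>2" and "d = card \<sigma> - 1"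
  have D: "0 < D" using denominator_pos[OF \<sigma>] by (simp add: D_def S_def m_def)
  \<comment> \<open>Off the open facet both sides vanish with \<open>m\<close>; inside it the extra
    summand of \<open>spread\<close> is 0.\<close>
  have mS: "m\<^sup>2 * (\<Sum>i\<le>d. (offset \<sigma> f i)\<^sup>2) = m\<^sup>2 * S"
    using sum_facet(2)[OF f \<sigma>] by (cases "m = 0") (simp_all add: m_def S_def spread_def d_def)
  have o0: "offset \<sigma> f 0 = 0" by (simp add: offset_def)
  have "(\<Sum>i\<le>d. (to_sphere \<sigma> f i)\<^sup>2) = ((S - m\<^sup>2) / D)\<^sup>2 + (\<Sum>i\<in>{1..d}. (2 * m * offset \<sigma> f i / D)\<^sup>2)"
    unfolding sum_atMost_head by (auto simp: to_sphere_def S_def m_def D_def d_def intro!: sum.cong)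
  also have "(\<Sum>i\<in>{1..d}. (2 * m * offset \<sigma> f i / D)\<^sup>2) = 4 * (m\<^sup>2 * (\<Sum>i\<in>{1..d}. (offset \<sigma> f i)\<^sup>2)) / D\<^sup>2"
    by (simp add: power_divide power_mult_distrib sum_distrib_left sum_divide_distrib mult.assoc)
  also have "(\<Sum>i\<in>{1..d}. (offset \<sigma> f i)\<^sup>2) = (\<Sum>i\<le>d. (offset \<sigma> f i)\<^sup>2)"
    unfolding sum_atMost_head by (simp add: o0)
  also have "((S - m\<^sup>2) / D)\<^sup>2 + 4 * (m\<^sup>2 * (\<Sum>i\<le>d. (offset \<sigma> f i)\<^sup>2)) / D\<^sup>2
    = ((S - m\<^sup>2)\<^sup>2 + 4 * (m\<^sup>2 * S)) / D\<^sup>2"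
    unfolding mS by (simp add: power_divide add_divide_distrib)
  also have "(S - m\<^sup>2)\<^sup>2 + 4 * (m\<^sup>2 * S) = D\<^sup>2" by (simp add: D_def power2_eq_square algebra_simps)
  finally have "(\<Sum>i\<le>d. (to_sphere \<sigma> f i)\<^sup>2) = 1" using D by simp
  moreover have "\<forall>i>d. to_sphere \<sigma> f i = 0" by (simp add: to_sphere_def d_def)
  ultimately show ?thesis by (simp add: nsphere d_def)
qed

lemma to_sphere_eq_base_iff:
  assumes f: "f \<in> topspace X" and \<sigma>: "\<sigma> \<in> \<Sigma>"
  shows "to_sphere \<sigma> f = sphere_base \<longleftrightarrow> depth \<sigma> f = 0"
proof
  assume "to_sphere \<sigma> f = sphere_base"
  then have "to_sphere \<sigma> f 0 = 1" by (simp add: sphere_base_def)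
  then show "depth \<sigma> f = 0" using denominator_pos[OF \<sigma>, of f] by (simp add: to_sphere_def)
next
  assume "depth \<sigma> f = 0"
  then show "to_sphere \<sigma> f = sphere_base"
    using denominator_pos[OF \<sigma>, of f] by (auto simp: to_sphere_def sphere_base_def)
qed

text \<open>This is stereographic projection from \<open>sphere_base\<close>, undoing the formula in
  \<open>to_sphere\<close>; injectivity on the open facet follows from it.\<close>

lemma to_sphere_ratio:
  assumes f: "f \<in> topspace X" and \<sigma>: "\<sigma> \<in> \<Sigma>" and d: "0 < depth \<sigma> f" and i: "i \<le> card \<sigma> - 1"
  shows "offset \<sigma> f i / depth \<sigma> f = (if i = 0 then 0 else to_sphere \<sigma> f i / (1 - to_sphere \<sigma> f 0))"
proof -
  define m D where "m = depth \<sigma> f" and "D = spread \<sigma> f + m\<^sup>2"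
  have D: "0 < D" and m: "0 < m" using denominator_pos[OF \<sigma>, of f] d by (auto simp: D_def m_def)
  have "1 - to_sphere \<sigma> f 0 = (D - (spread \<sigma> f - m\<^sup>2)) / D"
    using D by (simp add: to_sphere_def diff_divide_distrib flip: m_def D_def)
  also have "\<dots> = 2 * m\<^sup>2 / D" by (simp add: D_def)
  finally have 1: "1 - to_sphere \<sigma> f 0 = 2 * m\<^sup>2 / D" .
  show ?thesis
  proof (cases "i = 0")
    case False
    then have "to_sphere \<sigma> f i = 2 * m * offset \<sigma> f i / D" using i by (simp add: to_sphere_def m_def D_def)
    then show ?thesis using False D m unfolding 1 m_def[symmetric] by (simp add: field_simps power2_eq_square)
  qed (simp add: offset_def)
qed

text \<open>Equal projections mean that \<open>f\<close> and \<open>g\<close>, each divided by its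
  depth, differ on \<sigma> by a constant. Both quotients have minimum 1, so the constant is 0, and
  the normalization of the sums then makes the depths equal.\<close>

lemma to_sphere_inj:
  assumes f: "f \<in> topspace X" and g: "g \<in> topspace X" and \<sigma>: "\<sigma> \<in> \<Sigma>"
    and d: "0 < depth \<sigma> f" "0 < depth \<sigma> g" and eq: "to_sphere \<sigma> f = to_sphere \<sigma> g"
  shows "f = g"
proof -
  let ?m = "depth \<sigma> f" and ?n = "depth \<sigma> g"
  define c where "c = f (enum \<sigma> 0) / ?m - g (enum \<sigma> 0) / ?n"
  have r: "f v / ?m = g v / ?n + c" if v: "v \<in> \<sigma>" for v
  proof -
    obtain i where i: "i \<le> card \<sigma> - 1" "v = enum \<sigma> i" using enum_cases[OF \<sigma> v] .
    have "offset \<sigma> f i / ?m = offset \<sigma> g i / ?n"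
      using to_sphere_ratio[OF f \<sigma> d(1) i(1)] to_sphere_ratio[OF g \<sigma> d(2) i(1)] eq by simp
    then show ?thesis by (simp add: offset_def i c_def diff_divide_distrib)
  qed
  have "c \<le> 0"
  proof -
    obtain v where v: "v \<in> \<sigma>" "f v = ?m" using depth_attained[OF \<sigma>, of f] by auto
    have "1 \<le> g v / ?n" using depth_le[OF \<sigma> v(1), of g] d by simp
    moreover have "f v / ?m = 1" using v d by simp
    ultimately show ?thesis using r[OF v(1)] by linarith
  qed
  moreover have "0 \<le> c"
  proof -
    obtain v where v: "v \<in> \<sigma>" "g v = ?n" using depth_attained[OF \<sigma>, of g] by auto
    have "1 \<le> f v / ?m" using depth_le[OF \<sigma> v(1), of f] d by simp
    moreover have "g v / ?n = 1" using v d by simp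
    ultimately show ?thesis using r[OF v(1)] by linarith
  qed
  ultimately have r': "f v / ?m = g v / ?n" if "v \<in> \<sigma>" for v using r[OF that] by simp
  have F: "support f = \<sigma>" "sum f \<sigma> = 1" and G: "support g = \<sigma>" "sum g \<sigma> = 1"
    using sum_facet[OF f \<sigma>] sum_facet[OF g \<sigma>] d by auto
  have "1 / ?m = (\<Sum>v\<in>\<sigma>. f v / ?m)" by (simp add: F flip: sum_divide_distrib)
  also have "\<dots> = (\<Sum>v\<in>\<sigma>. g v / ?n)" using r' by simp
  also have "\<dots> = 1 / ?n" by (simp add: G flip: sum_divide_distrib)
  finally have "?m = ?n" by simp
  show ?thesis
  proof
    fix v
    show "f v = g v"
    proof (cases "v \<in> \<sigma>")
      case True
      then show ?thesis using r'[OF True] \<open>?m = ?n\<close> d by simp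
    next
      case False
      then have "v \<notin> support f" "v \<notin> support g" using F(1) G(1) by auto
      then show ?thesis by simp
    qed
  qed
qed

lemma to_sphere_surj:
  assumes \<sigma>: "\<sigma> \<in> \<Sigma>" and x: "x \<in> topspace (nsphere (card \<sigma> - 1))" "x \<noteq> sphere_base"
  obtains f where "f \<in> topspace X" "support f = \<sigma>" "to_sphere \<sigma> f = x"
proof -
  define d where "d = card \<sigma> - 1"
  have xs: "(\<Sum>i\<le>d. (x i)\<^sup>2) = 1" "\<And>i. i > d \<Longrightarrow> x i = 0" using x(1) by (auto simp: nsphere d_def)
  have x0: "x 0 \<noteq> 1" using nsphere_eq_base[OF x(1)] x(2) by blast
  have "(x 0)\<^sup>2 \<le> (\<Sum>i\<le>d. (x i)\<^sup>2)" by (rule member_le_sum) auto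
  then have x0': "x 0 < 1" using x0 xs(1) abs_square_le_1[of "x 0"] by auto
  define z where "z i = (if i = 0 then 0 else x i / (1 - x 0))" for i
  define mn where "mn = Min (z ` {..d})"
  \<comment> \<open>\<open>z\<close> is the stereographic projection of \<open>x\<close>, with
    \<open>z 0 = 0\<close> to match the offsets. Shifted to minimum 1 and divided by its sum
    \<open>s\<close>, it becomes a point of depth \<open>1 / s\<close> with offsets
    \<open>z i / s\<close>, whose ratios are \<open>z i\<close> again.\<close>
  define g where "g i = z i + 1 - mn" for i
  have g1: "1 \<le> g i" if "i \<le> d" for i
  proof -
    have "mn \<le> z i" unfolding mn_def using that by (intro Min_le) auto
    then show ?thesis by (simp add: g_def)
  qed
  obtain i0 where i0: "i0 \<le> d" "g i0 = 1"
  proof -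
    have "mn \<in> z ` {..d}" unfolding mn_def by (rule Min_in) auto
    then show thesis using that by (auto simp: g_def)
  qed
  define s where "s = (\<Sum>i\<le>d. g i)"
  have "g 0 \<le> s" unfolding s_def by (rule member_le_sum) (use g1 in \<open>force+\<close>)
  then have s: "0 < s" using g1[of 0] by simp
  define f where "f v = (if v \<in> \<sigma> then g (the_inv_into {..d} (enum \<sigma>) v) / s else 0)" for v
  have fe: "f (enum \<sigma> i) = g i / s" if "i \<le> d" for i
    using that enum_in[OF \<sigma>, of i] the_inv_into_f_f[OF bij_betw_imp_inj_on[OF enum[OF \<sigma>]], of i]
    by (simp add: f_def d_def)
  have f1: "1 / s \<le> f v" if v: "v \<in> \<sigma>" for v
  proof -
    obtain i where i: "i \<le> d" "v = enum \<sigma> i" using enum_cases[OF \<sigma> v] d_def by metis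
    show ?thesis unfolding i(2) fe[OF i(1)] using g1[OF i(1)] s by (simp add: divide_right_mono)
  qed
  have supp: "support f = \<sigma>"
  proof (intro subset_antisym subsetI)
    fix v assume "v \<in> \<sigma>"
    then have "0 < f v" using f1[of v] s by (meson less_le_trans zero_less_divide_1_iff)
    then show "v \<in> support f" by simp
  qed (auto simp: f_def split: if_splits)
  have sum\<sigma>: "sum f \<sigma> = 1" unfolding sum_enum[OF \<sigma>] d_def[symmetric]
    using s by (simp add: fe s_def flip: sum_divide_distrib)
  have "sum f V = sum f \<sigma>"
    using facetD(3)[OF \<sigma>] finite_complexD(1)[OF complex_K] by (intro sum.mono_neutral_right) (auto simp: f_def)
  moreover have "0 \<le> f v" for v using f1[of v] s by (cases "v \<in> \<sigma>") (auto simp: f_def intro: order_trans[rotated])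
  ultimately have fX: "f \<in> topspace X"
    unfolding topspace_realization[OF complex_K] supp using \<sigma> K_eq sum\<sigma> by simp
  have dep: "depth \<sigma> f = 1 / s"
    unfolding depth_def
  proof (rule Min_eqI)
    show "1 / s \<in> f ` \<sigma>" using fe[OF i0(1)] i0(2) enum_in[OF \<sigma>, of i0] i0(1) d_def by (metis image_eqI)
  qed (use facetD(1)[OF \<sigma>] f1 in auto)
  have off: "offset \<sigma> f i = z i / s" if "i \<le> d" for i
    using fe[OF that] fe[of 0] by (simp add: offset_def g_def z_def diff_divide_distrib add_divide_distrib)
  define Q where "Q = (\<Sum>i\<le>d. (z i)\<^sup>2)"
  have "Q = (\<Sum>i\<in>{1..d}. (z i)\<^sup>2)"
    unfolding Q_def sum_atMost_head by (simp add: z_def)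
  also have "\<dots> = (\<Sum>i\<in>{1..d}. (x i)\<^sup>2) / (1 - x 0)\<^sup>2"
    by (simp add: z_def power_divide sum_divide_distrib)
  also have "(\<Sum>i\<in>{1..d}. (x i)\<^sup>2) = 1 - (x 0)\<^sup>2"
    using xs(1) unfolding sum_atMost_head by simp
  also have "1 - (x 0)\<^sup>2 = (1 + x 0) * (1 - x 0)" by (simp add: power2_eq_square algebra_simps)
  finally have Q: "Q = (1 + x 0) / (1 - x 0)" using x0' by (simp add: power2_eq_square)
  have spr: "spread \<sigma> f = Q / s\<^sup>2"
    unfolding spread_def d_def[symmetric] sum\<sigma> Q_def by (simp add: off power_divide sum_divide_distrib)
  have Q1: "Q + 1 = 2 / (1 - x 0)" "Q - 1 = 2 * x 0 / (1 - x 0)" using x0' by (simp_all add: Q field_simps)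
  have "to_sphere \<sigma> f i = x i" for i
  proof -
    consider "i = 0" | "i \<noteq> 0" "i \<le> d" | "i > d" by linarith
    then show ?thesis
    proof cases
      case 1
      have "to_sphere \<sigma> f i = ((Q - 1) / s\<^sup>2) / ((Q + 1) / s\<^sup>2)"
        using 1 by (simp add: to_sphere_def spr dep power_divide diff_divide_distrib add_divide_distrib)
      also have "\<dots> = (Q - 1) / (Q + 1)" using s by simp
      also have "\<dots> = x 0" unfolding Q1 using x0' by simp
      finally show ?thesis using 1 by simp
    next
      case 2
      have "to_sphere \<sigma> f i = (2 * z i / s\<^sup>2) / ((Q + 1) / s\<^sup>2)"
        using 2 by (simp add: to_sphere_def spr dep off power_divide add_divide_distrib power2_eq_square d_def)
      also have "\<dots> = 2 * z i / (Q + 1)" using s by simp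
      also have "\<dots> = x i" unfolding Q1 using x0' 2 by (simp add: z_def)
      finally show ?thesis .
    next
      case 3
      then show ?thesis using xs(2) by (simp add: to_sphere_def d_def)
    qed
  qed
  then show thesis using that fX supp by blast
qed

lemma continuous_to_sphere:
  assumes \<sigma>: "\<sigma> \<in> \<Sigma>"
  shows "continuous_map X (nsphere (card \<sigma> - 1)) (to_sphere \<sigma>)"
proof -
  have o: "continuous_map X euclideanreal (\<lambda>f. offset \<sigma> f i)" for i
    unfolding offset_def by (intro continuous_intros continuous_map_realization_coord)
  have s: "continuous_map X euclideanreal (spread \<sigma>)"
    unfolding spread_def using facetD(1)[OF \<sigma>]
    by (intro continuous_intros continuous_map_realization_coord o) auto
  have "continuous_map X euclideanreal (\<lambda>f. to_sphere \<sigma> f i)" for i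
    unfolding to_sphere_def using denominator_pos[OF \<sigma>]
    by (cases "i = 0"; cases "i \<le> card \<sigma> - 1"; simp;
        intro continuous_intros s o continuous_depth[OF \<sigma>]; simp add: less_imp_neq[symmetric])
  moreover have "to_sphere \<sigma> f \<in> topspace (nsphere (card \<sigma> - 1))" if "f \<in> topspace X" for f
    using to_sphere_in_nsphere[OF that \<sigma>] .
  ultimately show ?thesis
    unfolding nsphere by (auto simp: continuous_map_in_subtopology continuous_map_componentwise_UNIV)
qed

text \<open>The map \<open>q\<close> sends \<open>A\<close> to the wedge point and each open facet
  bijectively onto a sphere without its base point. Compactness of \<open>X\<close> and the
  Hausdorff property of the wedge make it a quotient map, so what remains is to know its fibres and
  to contract \<open>A\<close>.\<close>

theorem equivalent_wedge_of_spheres: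
  assumes contractible: "contractible_space (geometric_realization T)" and ne: "S \<in> T" "S \<noteq> {}"
    and \<sigma>s: "set \<sigma>s = \<Sigma>" "distinct \<sigma>s" "\<sigma>s \<noteq> []"
  shows "X homotopy_equivalent_space wedge_of_spheres (map (\<lambda>\<sigma>. card \<sigma> - 1) \<sigma>s)"
proof -
  let ?ds = "map (\<lambda>\<sigma>. card \<sigma> - 1) \<sigma>s"
  let ?W = "wedge_of_spheres ?ds"
  have mem: "\<sigma>s ! i \<in> \<Sigma>" if "i < length \<sigma>s" for i using that \<sigma>s(1) by auto
  define q where "q f = (if f \<in> A then None
    else Some (SOME i. i < length \<sigma>s \<and> support f = \<sigma>s ! i, to_sphere (support f) f))" for f
  have A_iff: "f \<in> A \<longleftrightarrow> support f \<in> T" if "f \<in> topspace X" for f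
    using that unfolding topspace_realization[OF complex_T] topspace_realization[OF complex_K] by simp
  have qA: "q f = None" if "f \<in> A" for f using that by (simp add: q_def)
  have q_cell: "q f = Some (i, to_sphere (\<sigma>s ! i) f)"
    if "f \<in> topspace X" "i < length \<sigma>s" "support f = \<sigma>s ! i" for f i
  proof -
    have "(SOME j. j < length \<sigma>s \<and> support f = \<sigma>s ! j) = i"
      using that \<sigma>s(2) by (intro some_equality) (auto simp: nth_eq_iff_index_eq)
    moreover have "f \<notin> A" using A_iff[OF that(1)] that(3) mem[OF that(2)] disjoint by auto
    ultimately show ?thesis using that(3) by (simp add: q_def)
  qed
  have q_cases: "f \<in> A \<or> (\<exists>i<length \<sigma>s. support f = \<sigma>s ! i)" if "f \<in> topspace X" for f
    using A_iff[OF that] realizationD(2)[OF complex_K that] K_eq \<sigma>s(1)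
    by (metis UnE in_set_conv_nth)
  have q_point: "q f = wedge_point (i, to_sphere (\<sigma>s ! i) f)"
    if f: "f \<in> topspace X" and i: "i < length \<sigma>s" and cl: "f \<in> A \<or> support f = \<sigma>s ! i" for f i
  proof (cases "support f = \<sigma>s ! i")
    case True
    then have "to_sphere (\<sigma>s ! i) f \<noteq> sphere_base"
      using to_sphere_eq_base_iff[OF f mem[OF i]] depth_pos_iff[OF f mem[OF i]] by auto
    then show ?thesis using q_cell[OF f i True] by (simp add: wedge_point_def)
  next
    case False
    then have "f \<in> A" "to_sphere (\<sigma>s ! i) f = sphere_base"
      using cl to_sphere_eq_base_iff[OF f mem[OF i]] depth_eq_0[OF f mem[OF i]] by auto
    then show ?thesis using qA by (simp add: wedge_point_def)
  qed
  have cq: "continuous_map X ?W q"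
  \<comment> \<open>The \<open>i\<close>-th closed piece consists of the skeleton and the
    \<open>i\<close>-th open facet. On the overlap of two distinct pieces all depths vanish, so both
    maps give the wedge point.\<close>
  proof (rule pasting_lemma_closed[where I = "{..<length \<sigma>s}"
        and T = "\<lambda>i. {f \<in> topspace X. \<forall>j\<in>{..<length \<sigma>s} - {i}. depth (\<sigma>s ! j) f = 0}"
        and f = "\<lambda>i f. wedge_point (i, to_sphere (\<sigma>s ! i) f)"])
    fix i assume i: "i \<in> {..<length \<sigma>s}"
    have cl: "closedin X {f \<in> topspace X. depth (\<sigma>s ! j) f \<in> {0}}" if "j < length \<sigma>s" for j
      by (rule closedin_continuous_map_preimage[OF continuous_depth[OF mem[OF that]]]) simp
    show "closedin X {f \<in> topspace X. \<forall>j\<in>{..<length \<sigma>s} - {i}. depth (\<sigma>s ! j) f = 0}"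
    proof (cases "{..<length \<sigma>s} - {i} = {}")
      case True
      then show ?thesis by (simp only: ball_empty) simp
    next
      case False
      then have "{f \<in> topspace X. \<forall>j\<in>{..<length \<sigma>s} - {i}. depth (\<sigma>s ! j) f = 0} =
        (\<Inter>j\<in>{..<length \<sigma>s} - {i}. {f \<in> topspace X. depth (\<sigma>s ! j) f \<in> {0}})" by auto
      then show ?thesis using False cl by (auto intro!: closedin_Inter)
    qed
    have "continuous_map X ?W (\<lambda>f. wedge_point (i, to_sphere (\<sigma>s ! i) f))"
      using continuous_map_compose[OF continuous_to_sphere[OF mem], of i ?W "\<lambda>x. wedge_point (i, x)"]
        continuous_map_wedge_point[of i ?ds] i by (simp add: o_def)
    then show "continuous_map (subtopology X {f \<in> topspace X. \<forall>j\<in>{..<length \<sigma>s} - {i}. depth (\<sigma>s ! j) f = 0})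
       ?W (\<lambda>f. wedge_point (i, to_sphere (\<sigma>s ! i) f))" by (rule continuous_map_from_subtopology)
  next
    fix i j f
    assume ij: "i \<in> {..<length \<sigma>s}" "j \<in> {..<length \<sigma>s}"
      and f: "f \<in> topspace X \<inter> {f \<in> topspace X. \<forall>j\<in>{..<length \<sigma>s} - {i}. depth (\<sigma>s ! j) f = 0} \<inter>
        {f \<in> topspace X. \<forall>i\<in>{..<length \<sigma>s} - {j}. depth (\<sigma>s ! i) f = 0}"
    show "wedge_point (i, to_sphere (\<sigma>s ! i) f) = wedge_point (j, to_sphere (\<sigma>s ! j) f)"
    proof (cases "i = j")
      case False
      then have "to_sphere (\<sigma>s ! i) f = sphere_base" "to_sphere (\<sigma>s ! j) f = sphere_base"
        using f ij to_sphere_eq_base_iff mem by auto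
      then show ?thesis by (simp add: wedge_point_def)
    qed simp
  next
    fix f assume f: "f \<in> topspace X"
    obtain i where i: "i < length \<sigma>s" "f \<in> A \<or> support f = \<sigma>s ! i" using q_cases[OF f] \<sigma>s(3) by auto
    have "depth (\<sigma>s ! j) f = 0" if j: "j < length \<sigma>s" "j \<noteq> i" for j
    proof (rule depth_eq_0[OF f mem[OF j(1)]])
      show "support f \<noteq> \<sigma>s ! j"
        using i j \<sigma>s(2) A_iff[OF f] mem[OF j(1)] disjoint by (auto simp: nth_eq_iff_index_eq)
    qed
    then show "\<exists>i. i \<in> {..<length \<sigma>s} \<and> f \<in> {f \<in> topspace X. \<forall>j\<in>{..<length \<sigma>s} - {i}. depth (\<sigma>s ! j) f = 0} \<and>
        q f = wedge_point (i, to_sphere (\<sigma>s ! i) f)"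
      using q_point[OF f i] i f by (intro exI[of _ i]) auto
  qed simp
  have "q ` topspace X = topspace ?W"
  proof (intro subset_antisym subsetI)
    show "w \<in> topspace ?W" if "w \<in> q ` topspace X" for w
      using that continuous_map_image_subset_topspace[OF cq] by blast
  next
    fix w assume "w \<in> topspace ?W"
    then obtain i x where w: "w = wedge_point (i, x)" and i: "i < length \<sigma>s"
      and x: "x \<in> topspace (nsphere (card (\<sigma>s ! i) - 1))"
      by (auto simp: topspace_wedge_of_spheres)
    show "w \<in> q ` topspace X"
    proof (cases "x = sphere_base")
      case True
      \<comment> \<open>The wedge point needs a preimage in the skeleton; a vertex of the nonempty
        face \<open>S\<close> of \<open>T\<close> provides it.\<close>
      obtain v where "v \<in> S" using ne(2) by blast
      then have v: "{v} \<in> T" "v \<in> V"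
        using finite_complexD(4)[OF complex_T ne(1), of "{v}"] finite_complexD(2)[OF complex_T ne(1)] by auto
      define e where "e u = (if u = v then 1 else 0 :: real)" for u
      have supp: "support e = {v}" by (auto simp: e_def)
      have "e \<in> A" unfolding topspace_realization[OF complex_T] supp
        using v finite_complexD(1)[OF complex_T] by (simp add: e_def)
      moreover have "w = None" using True w by (simp add: wedge_point_def)
      ultimately show ?thesis using qA A_subset by force
    next
      case False
      obtain f where f: "f \<in> topspace X" "support f = \<sigma>s ! i" "to_sphere (\<sigma>s ! i) f = x"
        using to_sphere_surj[OF mem[OF i] x False] .
      have "q f = w" using q_point[OF f(1) i] f w by simp
      then show ?thesis using f(1) by blast
    qed
  qed
  then have Q: "quotient_map X ?W q"
    using continuous_imp_quotient_map[OF cq compact_realization[OF complex_K] Hausdorff_wedge_of_spheres] by blast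
  have fib: "q f = q g \<longleftrightarrow> f = g \<or> f \<in> A \<and> g \<in> A" if f: "f \<in> topspace X" and g: "g \<in> topspace X" for f g
  proof
    assume eq: "q f = q g"
    show "f = g \<or> f \<in> A \<and> g \<in> A"
    proof (cases "f \<in> A \<or> g \<in> A")
      case True
      then show ?thesis using eq by (auto simp: q_def split: if_splits)
    next
      case False
      obtain i where i: "i < length \<sigma>s" "support f = \<sigma>s ! i" using q_cases[OF f] False by auto
      obtain j where j: "j < length \<sigma>s" "support g = \<sigma>s ! j" using q_cases[OF g] False by auto
      have ij: "i = j" and ts: "to_sphere (\<sigma>s ! i) f = to_sphere (\<sigma>s ! i) g"
        using eq q_cell[OF f i] q_cell[OF g j] by auto
      have "0 < depth (\<sigma>s ! i) f" "0 < depth (\<sigma>s ! i) g"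
        using depth_pos_iff mem[OF i(1)] f g i j ij by auto
      then show ?thesis using to_sphere_inj[OF f g mem[OF i(1)] _ _ ts] by blast
    qed
  qed (auto simp: qA)
  obtain h where h: "homotopic_with (\<lambda>\<phi>. \<phi> ` A \<subseteq> A) X X id h" "\<And>x y. x \<in> A \<Longrightarrow> y \<in> A \<Longrightarrow> h x = h y"
    using contraction_extends[OF contractible] by blast
  show ?thesis by (rule homotopy_equivalent_quotient[OF Q fib A_subset h])
qed

end

lemma finite_complex_remove_facets:
  assumes K: "finite_complex V K"
    and facet: "\<And>S \<sigma>. S \<in> K \<Longrightarrow> \<sigma> \<in> F \<Longrightarrow> \<sigma> \<subseteq> S \<Longrightarrow> S = \<sigma>"
  shows "finite_complex V (K - F)"
proof (rule finite_complex_subset[OF K])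
  fix S S' assume S: "S \<in> K - F" "S' \<subseteq> S" "S' \<noteq> {}"
  then have "S' \<notin> F" using facet[of S S'] by blast
  then show "S' \<in> K - F" using finite_complexD(4)[OF K, of S S'] S by blast
qed blast

theorem realization_equivalent_wedge_of_spheres:
  assumes K: "finite_complex V K" and \<sigma>s: "set \<sigma>s \<subseteq> K" "{} \<notin> set \<sigma>s" "distinct \<sigma>s" "\<sigma>s \<noteq> []"
    and facet: "\<And>S \<sigma>. S \<in> K \<Longrightarrow> \<sigma> \<in> set \<sigma>s \<Longrightarrow> \<sigma> \<subseteq> S \<Longrightarrow> S = \<sigma>"
    and contractible: "contractible_space (geometric_realization (K - set \<sigma>s))"
    and ne: "S \<in> K - set \<sigma>s" "S \<noteq> {}"
  shows "geometric_realization K homotopy_equivalent_space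
    wedge_of_spheres (map (\<lambda>\<sigma>. card \<sigma> - 1) \<sigma>s)"
proof -
  have "finite_complex V (K - set \<sigma>s)"
    by (rule finite_complex_remove_facets[OF K facet])
  then interpret facet_attachment V K "K - set \<sigma>s" "set \<sigma>s"
  proof (rule facet_attachment.intro[OF K])
    show "K = (K - set \<sigma>s) \<union> set \<sigma>s" using \<sigma>s(1) by blast
    show "(K - set \<sigma>s) \<inter> set \<sigma>s = {}" by blast
  qed (fact \<sigma>s(2), rule facet)
  show ?thesis using equivalent_wedge_of_spheres[OF contractible ne] \<sigma>s(3,4) by blast
qed

section \<open>Independence complexes of cycles\<close>

lemma cycle_complex_Suc:
  assumes "S \<in> cycle_complex n" "i \<in> S"
  shows "Suc i \<notin> S"
proof
  assume "Suc i \<in> S"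
  then have "Suc i < n" using assms(1) by (auto simp: cycle_complex_def)
  then show False using assms \<open>Suc i \<in> S\<close> by (auto simp: cycle_complex_def dest!: spec[of _ i])
qed

text \<open>Separating the pair of \<open>0\<close> and \<open>n - 1\<close> from the others
  replaces addition modulo \<open>n\<close> by successors, so that calculations with residues modulo
  3 are not disturbed by a second modulus.\<close>

lemma cycle_complex_iff:
  assumes "2 \<le> n"
  shows "S \<in> cycle_complex n \<longleftrightarrow>
    S \<subseteq> {..<n} \<and> (\<forall>i. i \<in> S \<longrightarrow> Suc i \<notin> S) \<and> (0 \<in> S \<longrightarrow> n - 1 \<notin> S)"
proof
  assume "S \<in> cycle_complex n"
  then have S: "S \<subseteq> {..<n}" and *: "\<And>i. i < n \<Longrightarrow> \<not> {i, (i + 1) mod n} \<subseteq> S"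
    by (auto simp: cycle_complex_def)
  have "Suc i \<notin> S" if "i \<in> S" for i
    using cycle_complex_Suc[OF \<open>S \<in> cycle_complex n\<close> that] .
  moreover have "n - 1 \<notin> S" if "0 \<in> S" using *[of "n - 1"] that assms by auto
  ultimately show "S \<subseteq> {..<n} \<and> (\<forall>i. i \<in> S \<longrightarrow> Suc i \<notin> S) \<and> (0 \<in> S \<longrightarrow> n - 1 \<notin> S)"
    using S by blast
next
  assume S: "S \<subseteq> {..<n} \<and> (\<forall>i. i \<in> S \<longrightarrow> Suc i \<notin> S) \<and> (0 \<in> S \<longrightarrow> n - 1 \<notin> S)"
  have "\<not> {i, (i + 1) mod n} \<subseteq> S" if "i < n" for i
  proof (cases "i = n - 1")
    case True
    then show ?thesis using S assms by auto
  next
    case False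
    then have "(i + 1) mod n = Suc i" using that by simp
    then show ?thesis using S by auto
  qed
  then show "S \<in> cycle_complex n" using S by (auto simp: cycle_complex_def)
qed

lemma finite_complex_cycle: "finite_complex {..<n} (cycle_complex n)"
  unfolding finite_complex_def cycle_complex_def by blast

lemma cycle_complex_insert:
  assumes "2 \<le> n" "S \<in> cycle_complex n" "Suc v < n" "v \<notin> S" "Suc (Suc v) \<notin> S"
    "Suc v = n - 1 \<Longrightarrow> 0 \<notin> S"
  shows "insert (Suc v) S \<in> cycle_complex n"
  using assms unfolding cycle_complex_iff[OF assms(1)] by auto

lemma cycle_complex_singleton: "2 \<le> n \<Longrightarrow> v < n \<Longrightarrow> {v} \<in> cycle_complex n"
  by (simp add: cycle_complex_iff)

lemma finite_complex_avoid_family: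
  fixes M :: nat
  assumes "finite_complex V K"
  shows "finite_complex V {S \<in> K. \<forall>j<M. \<not> \<sigma> j \<subseteq> S}"
proof -
  have "{S \<in> K. \<forall>j<M. \<not> \<sigma> j \<subseteq> S} = {S \<in> K. \<forall>\<tau>\<in>\<sigma> ` {..<M}. \<not> \<tau> \<subseteq> S}" by auto
  then show ?thesis using finite_complex_avoid[OF assms, of "\<sigma> ` {..<M}"] by simp
qed

section \<open>Matching faces along residue classes modulo 3\<close>

definition residue0 :: "nat \<Rightarrow> nat set" where
  "residue0 j = (\<lambda>i. 3 * i) ` {..j}"

text \<open>The bound is strict here but not in \<open>residue0\<close>:
  \<open>residue0 0 = {0}\<close> singles out the faces through \<open>0\<close>, whereas
  \<open>residue2 0 = {}\<close> holds no face back.\<close>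

definition residue2 :: "nat \<Rightarrow> nat set" where
  "residue2 j = (\<lambda>i. 3 * i + 2) ` {..<j}"

lemma residue0_Suc: "residue0 (Suc j) = insert (3 * j + 3) (residue0 j)"
  by (simp add: residue0_def atMost_Suc add.commute)

lemma residue2_Suc: "residue2 (Suc j) = insert (3 * j + 2) (residue2 j)"
  by (simp add: residue2_def lessThan_Suc)

lemma mult3_in_residue0: "3 * i \<in> residue0 j \<longleftrightarrow> i \<le> j"
  by (auto simp: residue0_def)

lemma mult3_in_residue2: "3 * i + 2 \<in> residue2 j \<longleftrightarrow> i < j"
  by (auto simp: residue2_def)

lemma card_residue0: "card (residue0 j) = j + 1"
  by (simp add: residue0_def card_image inj_on_def)

lemma card_residue2: "card (residue2 j) = j"
  by (simp add: residue2_def card_image inj_on_def)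

lemma mod3_cases:
  fixes x :: nat
  obtains i where "x = 3 * i" | i where "x = 3 * i + 1" | i where "x = 3 * i + 2"
proof -
  have "x = 3 * (x div 3) \<or> x = 3 * (x div 3) + 1 \<or> x = 3 * (x div 3) + 2" by presburger
  then show thesis using that by blast
qed

text \<open>A face \<open>S\<close> containing \<open>0\<close> is matched by toggling \<open>3 j + 2\<close>, where \<open>j\<close> is maximal with
  \<open>residue0 j \<subseteq> S\<close>; a face \<open>S\<close> not containing \<open>0\<close> is matched by toggling \<open>3 j + 1\<close>, where \<open>j\<close> is
  maximal with \<open>residue2 j \<subseteq> S\<close>.\<close>

lemma contractible_residue_matching:
  assumes T: "finite_complex {..<n} T" and one: "{1} \<in> T" and L: "0 < L"
    and bounds: "\<And>j. j < M \<Longrightarrow> 3 * j + 2 < n" "\<And>j. j < L \<Longrightarrow> 3 * j + 1 < n"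
    and with0: "\<And>j S. j < M \<Longrightarrow> S \<in> T \<Longrightarrow> residue0 j \<subseteq> S \<Longrightarrow> 3 * j + 3 \<notin> S \<Longrightarrow> insert (3 * j + 2) S \<in> T"
    and end0: "\<And>S. S \<in> T \<Longrightarrow> \<not> residue0 M \<subseteq> S"
    and without0: "\<And>j S. j < L \<Longrightarrow> S \<in> T \<Longrightarrow> 0 \<notin> S \<Longrightarrow> residue2 j \<subseteq> S \<Longrightarrow> 3 * j + 2 \<notin> S
      \<Longrightarrow> insert (3 * j + 1) S \<in> T"
    and end2: "\<And>S. S \<in> T \<Longrightarrow> 0 \<notin> S \<Longrightarrow> \<not> residue2 L \<subseteq> S"
  shows "contractible_space (geometric_realization T)"
proof -
  define T1 where "T1 = {S \<in> T. \<forall>j<M. \<not> residue0 j \<subseteq> S}"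
  \<comment> \<open>The index 0 is left out because \<open>residue2 0\<close> is empty and nothing
    can be collapsed along the empty set. The faces that belong to it form the final cone with apex
    \<open>1\<close>.\<close>
  define T2 where "T2 = {S \<in> T1. \<forall>j<L - 1. \<not> residue2 (Suc j) \<subseteq> S}"
  have T1: "finite_complex {..<n} T1"
    unfolding T1_def by (rule finite_complex_avoid_family[OF T])
  have T2: "finite_complex {..<n} T2"
    unfolding T2_def by (rule finite_complex_avoid_family[OF T1])
  \<comment> \<open>Every \<open>residue0 j\<close> contains \<open>0\<close> and
    \<open>residue0 0 = {0}\<close>, so this stage removes exactly the faces through
    \<open>0\<close>. For \<open>M = 0\<close> there are none, by \<open>end0\<close>.\<close>
  have T1_eq: "T1 = {S \<in> T. 0 \<notin> S}"
  proof -
    have 0: "0 \<in> residue0 j" for j using mult3_in_residue0[of 0 j] by simp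
    have "residue0 0 = {0}" by (simp add: residue0_def)
    then have "0 \<notin> S" if "S \<in> T1" for S
      using that end0[of S] by (cases "M = 0") (auto simp: T1_def)
    then show ?thesis using 0 by (auto simp: T1_def)
  qed
  have "geometric_realization T homotopy_equivalent_space geometric_realization T1"
    unfolding T1_def
  proof (rule realization_collapse_sequence[OF T, where p = "\<lambda>j. 3 * j + 2"])
    fix j assume j: "j < M"
    show "finite (residue0 j) \<and> residue0 j \<noteq> {} \<and> 3 * j + 2 \<in> {..<n} - residue0 j"
      using bounds(1)[OF j] by (auto simp: residue0_def; presburger)
    fix S assume S: "S \<in> T" "residue0 j \<subseteq> S" and max: "\<And>i. j < i \<Longrightarrow> i < M \<Longrightarrow> \<not> residue0 i \<subseteq> S"
    \<comment> \<open>Otherwise \<open>S\<close> would contain \<open>residue0 (Suc j)\<close>,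
      against the maximality of \<open>j\<close> or, at the last index, against
      \<open>end0\<close>.\<close>
    have n: "3 * j + 3 \<notin> S"
    proof
      assume "3 * j + 3 \<in> S"
      then have "residue0 (Suc j) \<subseteq> S" using S(2) by (simp add: residue0_Suc)
      then show False using max[of "Suc j"] end0[OF S(1)] j by (cases "Suc j = M") auto
    qed
    have "\<not> residue0 i \<subseteq> insert (3 * j + 2) S" if "j < i" for i
    proof -
      have "3 * j + 3 \<in> residue0 i" using mult3_in_residue0[of "Suc j" i] that by (simp add: add.commute)
      moreover have "3 * j + 3 \<notin> insert (3 * j + 2) S" using n by simp
      ultimately show ?thesis by blast
    qed
    then show "insert (3 * j + 2) S \<in> T \<and> (\<forall>i. j < i \<longrightarrow> i < M \<longrightarrow> \<not> residue0 i \<subseteq> insert (3 * j + 2) S)"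
      using with0[OF j S n] by blast
  qed
  also have "geometric_realization T1 homotopy_equivalent_space geometric_realization T2"
    unfolding T2_def
  proof (rule realization_collapse_sequence[OF T1, where p = "\<lambda>j. 3 * Suc j + 1"])
    fix j assume j: "j < L - 1"
    show "finite (residue2 (Suc j)) \<and> residue2 (Suc j) \<noteq> {} \<and> 3 * Suc j + 1 \<in> {..<n} - residue2 (Suc j)"
      using bounds(2)[of "Suc j"] j by (auto simp: residue2_def; presburger)
    fix S assume S: "S \<in> T1" "residue2 (Suc j) \<subseteq> S"
      and max: "\<And>i. j < i \<Longrightarrow> i < L - 1 \<Longrightarrow> \<not> residue2 (Suc i) \<subseteq> S"
    have ST: "S \<in> T" "0 \<notin> S" using S(1) by (auto simp: T1_eq)
    have n: "3 * Suc j + 2 \<notin> S"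
    proof
      assume "3 * Suc j + 2 \<in> S"
      then have "residue2 (Suc (Suc j)) \<subseteq> S" using S(2) by (simp add: residue2_Suc[of "Suc j"])
      then show False using max[of "Suc j"] end2[OF ST] j by (cases "Suc (Suc j) = L") auto
    qed
    have "\<not> residue2 (Suc i) \<subseteq> insert (3 * Suc j + 1) S" if "j < i" for i
    proof -
      have "3 * Suc j + 2 \<in> residue2 (Suc i)" unfolding mult3_in_residue2 using that by simp
      moreover have "3 * Suc j + 2 \<notin> insert (3 * Suc j + 1) S" using n by simp
      ultimately show ?thesis by blast
    qed
    moreover have "insert (3 * Suc j + 1) S \<in> T1"
      using without0[OF _ ST S(2) n] j ST(2) by (simp add: T1_eq)
    ultimately show "insert (3 * Suc j + 1) S \<in> T1 \<and>
      (\<forall>i. j < i \<longrightarrow> i < L - 1 \<longrightarrow> \<not> residue2 (Suc i) \<subseteq> insert (3 * Suc j + 1) S)" by blast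
  qed
  finally have "geometric_realization T homotopy_equivalent_space geometric_realization T2" .
  moreover have "contractible_space (geometric_realization T2)"
  proof (rule contractible_cone[OF T2])
    have two: "2 \<in> residue2 (Suc j)" for j using mult3_in_residue2[of 0 "Suc j"] by (simp add: numeral_2_eq_2)
    have avoid: "S \<in> T2" if "S \<in> T" "0 \<notin> S" "2 \<notin> S" for S
      using that two by (auto simp: T2_def T1_eq)
    show "{1} \<in> T2" using one by (intro avoid) auto
    fix S assume S: "S \<in> T2"
    then have ST: "S \<in> T" "0 \<notin> S" by (auto simp: T2_def T1_eq)
    have "residue2 (Suc 0) = {2}" "residue2 0 = {}" by (auto simp: residue2_def)
    then have 2: "2 \<notin> S"
    proof (cases "L = 1")
      case True
      then show ?thesis using end2[OF ST] \<open>residue2 (Suc 0) = {2}\<close> by simp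
    next
      case False
      then have "0 < L - 1" using L by simp
      then have "\<not> residue2 (Suc 0) \<subseteq> S" using S unfolding T2_def by blast
      then show ?thesis using \<open>residue2 (Suc 0) = {2}\<close> by simp
    qed
    have "insert 1 S \<in> T" using without0[OF L ST] 2 \<open>residue2 0 = {}\<close> by (simp add: numeral_2_eq_2)
    then show "insert 1 S \<in> T2" using ST 2 by (intro avoid) auto
  qed
  ultimately show ?thesis using homotopy_equivalent_space_contractibility by blast
qed

text \<open>Every other vertex has a neighbour in the class: \<open>3 * i + 1\<close> follows a
  multiple of 3, \<open>3 * i + 2\<close> precedes one, and \<open>3 * m - 1\<close> is next to
  \<open>0\<close> around the cycle.\<close>

lemma facet_residue0_mult3:
  assumes "S \<in> cycle_complex (3 * m)" "0 < m" "residue0 (m - 1) \<subseteq> S"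
  shows "S = residue0 (m - 1)"
proof -
  have S: "S \<subseteq> {..<3 * m}" "\<And>i. i \<in> S \<Longrightarrow> Suc i \<notin> S" "0 \<in> S \<Longrightarrow> 3 * m - 1 \<notin> S"
    using assms cycle_complex_iff[of "3 * m" S] by auto
  have mem: "3 * i \<in> S" if "i < m" for i using assms(3) mult3_in_residue0[of i "m - 1"] that by auto
  have "x \<in> residue0 (m - 1)" if x: "x \<in> S" for x
  proof (cases x rule: mod3_cases)
    case (1 i)
    then show ?thesis using x S(1) by (auto simp: mult3_in_residue0)
  next
    case (2 i)
    then show ?thesis using x S(1) S(2)[OF mem[of i]] by auto
  next
    case (3 i)
    then have i: "i < m" using x S(1) by auto
    show ?thesis
    proof (cases "Suc i = m")
      case True
      then have "x = 3 * m - 1" using 3 by auto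
      then show ?thesis using x S(3) mem[of 0] assms(2) by simp
    next
      case False
      then have "Suc i < m" using i by simp
      moreover have "Suc x = 3 * Suc i" using 3 by simp
      ultimately have "Suc x \<in> S" using mem by metis
      then show ?thesis using S(2)[OF x] by blast
    qed
  qed
  then show ?thesis using assms(3) by blast
qed

lemma facet_residue2_mult3:
  assumes "S \<in> cycle_complex (3 * m)" "0 < m" "residue2 m \<subseteq> S"
  shows "S = residue2 m"
proof -
  have S: "S \<subseteq> {..<3 * m}" "\<And>i. i \<in> S \<Longrightarrow> Suc i \<notin> S" "0 \<in> S \<Longrightarrow> 3 * m - 1 \<notin> S"
    using assms cycle_complex_iff[of "3 * m" S] by auto
  have mem: "3 * i + 2 \<in> S" if "i < m" for i using assms(3) mult3_in_residue2[of i m] that by auto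
  have "x \<in> residue2 m" if x: "x \<in> S" for x
  proof (cases x rule: mod3_cases)
    case (1 i)
    show ?thesis
    proof (cases i)
      case 0
      have "3 * (m - 1) + 2 = 3 * m - 1" using assms(2) by simp
      then have "3 * m - 1 \<in> S" using mem[of "m - 1"] assms(2) by simp
      then show ?thesis using 0 1 x S(3) by simp
    next
      case (Suc i')
      then have "i' < m" using 1 x S(1) by auto
      then have "Suc (3 * i' + 2) \<notin> S" using S(2) mem by blast
      moreover have "x = Suc (3 * i' + 2)" using 1 Suc by simp
      ultimately show ?thesis using x by metis
    qed
  next
    case (2 i)
    then show ?thesis using x S(1) S(2)[OF x] mem[of i] by auto
  next
    case (3 i)
    then show ?thesis using x S(1) mult3_in_residue2 by auto
  qed
  then show ?thesis using assms(3) by blast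
qed

text \<open>The matching leaves two faces unmatched, and removing them supplies \<open>end0\<close>
  and \<open>end2\<close>. They never occur as partners: adding \<open>3 * j + 1\<close> leaves both
  classes, and adding \<open>3 * j + 2\<close> to a face through \<open>0\<close> gives a set with
  elements of two classes.\<close>

lemma contractible_cycle_mult3:
  assumes m: "0 < m"
  shows "contractible_space (geometric_realization (cycle_complex (3 * m) - {residue0 (m - 1), residue2 m}))"
    (is "contractible_space (geometric_realization ?T)")
proof (rule contractible_residue_matching[where n = "3 * m" and M = "m - 1" and L = m])
  have n: "2 \<le> 3 * m" using m by simp
  have not_mod1: "3 * i + 1 \<notin> residue0 j" "3 * i + 1 \<notin> residue2 j" "3 * i + 2 \<notin> residue0 j" for i j :: nat
    by (auto simp: residue0_def residue2_def; presburger)+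
  have not_0: "0 \<notin> residue2 j" for j by (auto simp: residue2_def)
  show "finite_complex {..<3 * m} ?T"
  proof (rule finite_complex_remove_facets[OF finite_complex_cycle])
    fix S \<sigma> assume "S \<in> cycle_complex (3 * m)" "\<sigma> \<in> {residue0 (m - 1), residue2 m}" "\<sigma> \<subseteq> S"
    then show "S = \<sigma>" using facet_residue0_mult3[of S m] facet_residue2_mult3[of S m] m by auto
  qed
  have "{1} \<in> cycle_complex (3 * m)" using m by (intro cycle_complex_singleton) auto
  then show "{1} \<in> ?T" using not_mod1[of 0] by auto
  show "0 < m" by fact
  show "3 * j + 2 < 3 * m" if "j < m - 1" for j using that by simp
  show "3 * j + 1 < 3 * m" if "j < m" for j using that by simp
  show "insert (3 * j + 2) S \<in> ?T" if "j < m - 1" "S \<in> ?T" "residue0 j \<subseteq> S" "3 * j + 3 \<notin> S" for j S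
  proof -
    have "3 * j \<in> S" "0 \<in> S" using that(3) mult3_in_residue0[of j j] mult3_in_residue0[of 0 j] by auto
    then have "Suc (3 * j) \<notin> S" using that(2) cycle_complex_Suc by blast
    then have "insert (Suc (Suc (3 * j))) S \<in> cycle_complex (3 * m)"
      using that by (intro cycle_complex_insert[OF n]) (auto simp: numeral_eq_Suc)
    moreover have "insert (3 * j + 2) S \<noteq> residue0 (m - 1)" using not_mod1(3)[of j] by blast
    moreover have "insert (3 * j + 2) S \<noteq> residue2 m" using not_0 \<open>0 \<in> S\<close> by blast
    ultimately show ?thesis by simp
  qed
  show "\<not> residue0 (m - 1) \<subseteq> S" if "S \<in> ?T" for S
    using facet_residue0_mult3[of S m] m that by blast
  show "insert (3 * j + 1) S \<in> ?T" if "j < m" "S \<in> ?T" "0 \<notin> S" "residue2 j \<subseteq> S" "3 * j + 2 \<notin> S" for j S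
  proof -
    have "3 * j \<notin> S"
    proof (cases j)
      case (Suc i)
      then have "3 * i + 2 \<in> S" using that(4) mult3_in_residue2[of i j] by auto
      moreover have "3 * j = Suc (3 * i + 2)" using Suc by simp
      ultimately show ?thesis using that(2) cycle_complex_Suc by (metis DiffD1)
    qed (use that in simp)
    then have "insert (Suc (3 * j)) S \<in> cycle_complex (3 * m)"
      using that by (intro cycle_complex_insert[OF n]) (auto simp: numeral_eq_Suc)
    moreover have "insert (3 * j + 1) S \<noteq> residue0 (m - 1)" using not_mod1(1)[of j] by blast
    moreover have "insert (3 * j + 1) S \<noteq> residue2 m" using not_mod1(2)[of j] by blast
    ultimately show ?thesis by simp
  qed
  show "\<not> residue2 m \<subseteq> S" if "S \<in> ?T" for S
    using facet_residue2_mult3[of S m] m that by blast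
qed

text \<open>The step from \<open>3 * m\<close> around to \<open>0\<close> has length 2 and all
  others have length 3, so every vertex off the set still has a neighbour in it.\<close>

lemma facet_residue0_mult3_plus2:
  assumes "S \<in> cycle_complex (3 * m + 2)" "residue0 m \<subseteq> S"
  shows "S = residue0 m"
proof -
  have S: "S \<subseteq> {..<3 * m + 2}" "\<And>i. i \<in> S \<Longrightarrow> Suc i \<notin> S"
    using assms cycle_complex_iff[of "3 * m + 2" S] by auto
  have mem: "3 * i \<in> S" if "i \<le> m" for i using assms(2) mult3_in_residue0[of i m] that by auto
  have "x \<in> residue0 m" if x: "x \<in> S" for x
  proof (cases x rule: mod3_cases)
    case (1 i)
    then show ?thesis using x S(1) by (auto simp: mult3_in_residue0)
  next
    case (2 i)
    then show ?thesis using x S(1) S(2)[OF mem[of i]] by auto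
  next
    case (3 i)
    then have "Suc i \<le> m" using x S(1) by auto
    moreover have "Suc x = 3 * Suc i" using 3 by simp
    ultimately have "Suc x \<in> S" using mem by metis
    then show ?thesis using S(2)[OF x] by blast
  qed
  then show ?thesis using assms(2) by blast
qed

text \<open>Only one face is unmatched: \<open>residue2 (m + 1)\<close> contains
  \<open>3 * m + 2\<close>, which is not a vertex, so the matching of the faces without
  \<open>0\<close> has no exception.\<close>

lemma contractible_cycle_mult3_plus2:
  "contractible_space (geometric_realization (cycle_complex (3 * m + 2) - {residue0 m}))"
    (is "contractible_space (geometric_realization ?T)")
proof (rule contractible_residue_matching[where n = "3 * m + 2" and M = m and L = "m + 1"])
  let ?n = "3 * m + 2"
  have n: "2 \<le> ?n" by simp
  have not_residue0: "3 * i + 1 \<notin> residue0 j" "3 * i + 2 \<notin> residue0 j" for i j :: nat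
    by (auto simp: residue0_def; presburger)+
  show "finite_complex {..<?n} ?T"
    by (rule finite_complex_remove_facets[OF finite_complex_cycle])
      (use facet_residue0_mult3_plus2 in auto)
  have "{1} \<in> cycle_complex ?n" by (intro cycle_complex_singleton) auto
  then show "{1} \<in> ?T" using not_residue0[of 0] by auto
  show "0 < m + 1" by simp
  show "3 * j + 2 < ?n" if "j < m" for j using that by simp
  show "3 * j + 1 < ?n" if "j < m + 1" for j using that by simp
  show "insert (3 * j + 2) S \<in> ?T" if "j < m" "S \<in> ?T" "residue0 j \<subseteq> S" "3 * j + 3 \<notin> S" for j S
  proof -
    have "3 * j \<in> S" using that(3) mult3_in_residue0[of j j] by auto
    then have "Suc (3 * j) \<notin> S" using that(2) cycle_complex_Suc by blast
    then have "insert (Suc (Suc (3 * j))) S \<in> cycle_complex ?n"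
      using that by (intro cycle_complex_insert[OF n]) (auto simp: numeral_eq_Suc)
    moreover have "insert (3 * j + 2) S \<noteq> residue0 m" using not_residue0(2)[of j] by blast
    ultimately show ?thesis by simp
  qed
  show "\<not> residue0 m \<subseteq> S" if "S \<in> ?T" for S
    using facet_residue0_mult3_plus2[of S m] that by blast
  show "insert (3 * j + 1) S \<in> ?T" if "j < m + 1" "S \<in> ?T" "0 \<notin> S" "residue2 j \<subseteq> S" "3 * j + 2 \<notin> S" for j S
  proof -
    have "3 * j \<notin> S"
    proof (cases j)
      case (Suc i)
      then have "3 * i + 2 \<in> S" using that(4) mult3_in_residue2[of i j] by auto
      moreover have "3 * j = Suc (3 * i + 2)" using Suc by simp
      ultimately show ?thesis using that(2) cycle_complex_Suc by (metis DiffD1)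
    qed (use that in simp)
    then have "insert (Suc (3 * j)) S \<in> cycle_complex ?n"
      using that by (intro cycle_complex_insert[OF n]) (auto simp: numeral_eq_Suc)
    moreover have "insert (3 * j + 1) S \<noteq> residue0 m" using not_residue0(1)[of j] by blast
    ultimately show ?thesis by simp
  qed
  show "\<not> residue2 (m + 1) \<subseteq> S" if "S \<in> ?T" for S
    using mult3_in_residue2[of m "m + 1"] that cycle_complex_iff[OF n] by auto
qed

text \<open>No face of dimension \<open>m - 1\<close> is maximal in \<open>cycle_complex (3 * m + 1)\<close>. Collapsing away the faces
  that contain one of the following sets turns \<open>residue2 m\<close> into a facet and, for \<open>m \<ge> 3\<close>, does not
  affect faces whose vertices all have the same parity.\<close>

definition bridge :: "nat \<Rightarrow> nat \<Rightarrow> nat set" where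
  "bridge m j = residue0 j \<union> (\<lambda>i. 3 * i + 2) ` {Suc j..<m}"

lemma in_bridge:
  "3 * i \<in> bridge m j \<longleftrightarrow> i \<le> j" "3 * i + 2 \<in> bridge m j \<longleftrightarrow> j < i \<and> i < m" "3 * i + 1 \<notin> bridge m j"
  unfolding bridge_def residue0_def by (auto; presburger)+

lemma bridge_subset_iff:
  "bridge m j \<subseteq> S \<longleftrightarrow> (\<forall>i\<le>j. 3 * i \<in> S) \<and> (\<forall>i. j < i \<longrightarrow> i < m \<longrightarrow> 3 * i + 2 \<in> S)"
  unfolding bridge_def residue0_def by auto

definition without_bridges :: "nat \<Rightarrow> nat set set \<Rightarrow> nat set set" where
  "without_bridges m K = {S \<in> K. \<forall>j<m. \<not> bridge m j \<subseteq> S}"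

text \<open>A bridge has its widest gap between \<open>3 * j\<close> and \<open>3 * j + 5\<close>,
  and \<open>3 * j + 2\<close> fits into it: \<open>3 * j + 1\<close> is excluded by
  \<open>3 * j\<close>, and \<open>3 * j + 3\<close> would complete the next bridge or, for
  \<open>j = m - 1\<close>, be the neighbour \<open>3 * m\<close> of \<open>0\<close>. The
  hypothesis \<open>insert\<close> is stated so that \<open>K\<close> may be the full complex or the
  one without the parity facets.\<close>

lemma collapse_bridges:
  assumes K: "finite_complex {..<3 * m + 1} K" "K \<subseteq> cycle_complex (3 * m + 1)"
    and insert: "\<And>j S. j < m \<Longrightarrow> S \<in> K \<Longrightarrow> bridge m j \<subseteq> S
      \<Longrightarrow> insert (3 * j + 2) S \<in> cycle_complex (3 * m + 1) \<Longrightarrow> insert (3 * j + 2) S \<in> K"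
  shows "geometric_realization K homotopy_equivalent_space geometric_realization (without_bridges m K)"
  unfolding without_bridges_def
proof (rule realization_collapse_sequence[OF K(1), where p = "\<lambda>j. 3 * j + 2"])
  fix j assume j: "j < m"
  have n: "2 \<le> 3 * m + 1" using j by simp
  show "finite (bridge m j) \<and> bridge m j \<noteq> {} \<and> 3 * j + 2 \<in> {..<3 * m + 1} - bridge m j"
    using j in_bridge by (auto simp: bridge_def residue0_def)
  fix S assume S: "S \<in> K" "bridge m j \<subseteq> S" and max: "\<And>i. j < i \<Longrightarrow> i < m \<Longrightarrow> \<not> bridge m i \<subseteq> S"
  have SC: "S \<in> cycle_complex (3 * m + 1)" using S K(2) by blast
  note indep = SC[unfolded cycle_complex_iff[OF n]]
  have "3 * j \<in> S" "0 \<in> S" using S(2) unfolding bridge_subset_iff by force+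
  have "3 * j + 3 \<notin> S"
  proof
    assume *: "3 * j + 3 \<in> S"
    show False
    proof (cases "Suc j = m")
      case True
      then have "3 * m \<in> S" using * by (auto simp: add.commute)
      then show False using indep \<open>0 \<in> S\<close> by simp
    next
      case False
      have "3 * Suc j \<in> S" using * by (simp add: add.commute)
      then have "bridge m (Suc j) \<subseteq> S"
        using S(2) unfolding bridge_subset_iff by (metis Suc_lessD le_Suc_eq)
      then show False using max[of "Suc j"] False j by simp
    qed
  qed
  moreover have "Suc (3 * j) \<notin> S" using indep \<open>3 * j \<in> S\<close> by blast
  ultimately have "insert (Suc (Suc (3 * j))) S \<in> cycle_complex (3 * m + 1)"
    using j SC by (intro cycle_complex_insert[OF n]) (auto simp: numeral_eq_Suc)
  then have "insert (3 * j + 2) S \<in> K" using insert[OF j S] by simp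
  moreover have "\<not> bridge m i \<subseteq> insert (3 * j + 2) S" if "j < i" "i < m" for i
  proof -
    have "3 * j + 2 \<notin> bridge m i" using in_bridge(2)[of j m i] that by simp
    then show ?thesis using max[OF that] by (simp add: subset_insert)
  qed
  ultimately show "insert (3 * j + 2) S \<in> K \<and>
    (\<forall>i. j < i \<longrightarrow> i < m \<longrightarrow> \<not> bridge m i \<subseteq> insert (3 * j + 2) S)" by blast
qed

text \<open>Around the end of the cycle the class leaves \<open>3 * m\<close>, \<open>0\<close> and
  \<open>1\<close>, of which only \<open>0\<close> has no neighbour in it. Adding \<open>0\<close>
  would produce a superset of \<open>bridge m 0\<close>.\<close>

lemma facet_residue2_without_bridges:
  assumes "S \<in> without_bridges m (cycle_complex (3 * m + 1))" "0 < m" "residue2 m \<subseteq> S"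
  shows "S = residue2 m"
proof -
  have n: "2 \<le> 3 * m + 1" using assms(2) by simp
  have SC: "S \<in> cycle_complex (3 * m + 1)" and "\<not> bridge m 0 \<subseteq> S"
    using assms(1,2) by (auto simp: without_bridges_def)
  then have S: "S \<subseteq> {..<3 * m + 1}" "\<And>i. i \<in> S \<Longrightarrow> Suc i \<notin> S" "\<not> bridge m 0 \<subseteq> S"
    unfolding cycle_complex_iff[OF n] by auto
  have mem: "3 * i + 2 \<in> S" if "i < m" for i using assms(3) mult3_in_residue2[of i m] that by auto
  have "x \<in> residue2 m" if x: "x \<in> S" for x
  proof (cases x rule: mod3_cases)
    case (1 i)
    show ?thesis
    proof (cases i)
      case 0
      then have "bridge m 0 \<subseteq> S" using mem x 1 unfolding bridge_subset_iff by auto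
      then show ?thesis using S(3) by blast
    next
      case (Suc i')
      then have "i' < m" using 1 x S(1) by auto
      then have "Suc (3 * i' + 2) \<notin> S" using S(2) mem by blast
      moreover have "x = Suc (3 * i' + 2)" using 1 Suc by simp
      ultimately show ?thesis using x by metis
    qed
  next
    case (2 i)
    then show ?thesis using x S(1) S(2)[OF x] mem[of i] by auto
  next
    case (3 i)
    then show ?thesis using x S(1) mult3_in_residue2 by auto
  qed
  then show ?thesis using assms(3) by blast
qed

lemma finite_complex_without_bridges:
  "finite_complex V K \<Longrightarrow> finite_complex V (without_bridges m K)"
  unfolding without_bridges_def by (rule finite_complex_avoid_family)

lemma contractible_cycle_mult3_plus1:
  assumes m: "0 < m"
  shows "contractible_space (geometric_realization
    (without_bridges m (cycle_complex (3 * m + 1)) - {residue2 m}))"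
    (is "contractible_space (geometric_realization ?T)")
proof (rule contractible_residue_matching[where n = "3 * m + 1" and M = m and L = m])
  let ?n = "3 * m + 1" and ?K = "without_bridges m (cycle_complex (3 * m + 1))"
  have n: "2 \<le> ?n" using m by simp
  have not_residue2: "3 * i + 1 \<notin> residue2 j" "0 \<notin> residue2 j" for i j :: nat
    by (auto simp: residue2_def; presburger)+
  have bridge0: "0 \<in> bridge m j" for j using in_bridge(1)[of 0 m j] by simp
  have T_iff: "S \<in> ?T \<longleftrightarrow> S \<in> cycle_complex ?n \<and> (\<forall>j<m. \<not> bridge m j \<subseteq> S) \<and> S \<noteq> residue2 m" for S
    by (auto simp: without_bridges_def)
  show "finite_complex {..<?n} ?T"
    by (rule finite_complex_remove_facets[OF finite_complex_without_bridges[OF finite_complex_cycle]])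
      (use facet_residue2_without_bridges m in auto)
  have "{1} \<in> cycle_complex ?n" using m by (intro cycle_complex_singleton) auto
  then show "{1} \<in> ?T" using not_residue2(1)[of 0 m] bridge0 unfolding T_iff by auto
  show "0 < m" by fact
  show "3 * j + 2 < ?n" if "j < m" for j using that by simp
  show "3 * j + 1 < ?n" if "j < m" for j using that by simp
  show "insert (3 * j + 2) S \<in> ?T" if j: "j < m" and S: "S \<in> ?T" "residue0 j \<subseteq> S" and n3: "3 * j + 3 \<notin> S" for j S
  proof -
    have SC: "S \<in> cycle_complex ?n" and no_bridge: "\<And>i. i < m \<Longrightarrow> \<not> bridge m i \<subseteq> S"
      using S(1) unfolding T_iff by auto
    have r0: "3 * i \<in> S" if "i \<le> j" for i using S(2) mult3_in_residue0[of i j] that by auto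
    have "0 \<in> S" using r0[of 0] by simp
    have "Suc (3 * j) \<notin> S" using r0[of j] SC cycle_complex_Suc by blast
    then have "insert (Suc (Suc (3 * j))) S \<in> cycle_complex ?n"
      using j SC n3 by (intro cycle_complex_insert[OF n]) (auto simp: numeral_eq_Suc)
    \<comment> \<open>The new vertex creates no bridge. Since \<open>3 * j + 3\<close> is missing,
      \<open>i \<le> j\<close>; then the part of the bridge beyond \<open>j\<close>, together with
      \<open>residue0 j\<close>, shows that \<open>bridge m j\<close> was already contained in
      \<open>S\<close>.\<close>
    moreover have "\<not> bridge m i \<subseteq> insert (3 * j + 2) S" if i: "i < m" for i
    proof
      assume b: "bridge m i \<subseteq> insert (3 * j + 2) S"
      have "\<not> bridge m j \<subseteq> S" using no_bridge[OF j] .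
      moreover have "i \<le> j"
      proof (rule ccontr)
        assume "\<not> i \<le> j"
        then have "3 * Suc j \<in> bridge m i" unfolding in_bridge(1) by simp
        then have "3 * j + 3 \<in> bridge m i" by (simp add: add.commute)
        then show False using subsetD[OF b] n3 by fastforce
      qed
      moreover have "3 * l + 2 \<in> S" if "j < l" "l < m" for l
        using b in_bridge(2)[of l m i] that \<open>i \<le> j\<close> by auto
      ultimately show False using r0 unfolding bridge_subset_iff by blast
    qed
    moreover have "insert (3 * j + 2) S \<noteq> residue2 m" using not_residue2(2) \<open>0 \<in> S\<close> by blast
    ultimately show ?thesis unfolding T_iff by simp
  qed
  show "\<not> residue0 m \<subseteq> S" if "S \<in> ?T" for S
  proof
    assume "residue0 m \<subseteq> S"
    then have "0 \<in> S" "3 * m \<in> S" using mult3_in_residue0[of 0 m] mult3_in_residue0[of m m] by auto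
    then show False using that cycle_complex_iff[OF n] unfolding T_iff by auto
  qed
  show "insert (3 * j + 1) S \<in> ?T" if "j < m" "S \<in> ?T" "0 \<notin> S" "residue2 j \<subseteq> S" "3 * j + 2 \<notin> S" for j S
  proof -
    have SC: "S \<in> cycle_complex ?n" using that(2) unfolding T_iff by blast
    have "3 * j \<notin> S"
    proof (cases j)
      case (Suc i)
      then have "3 * i + 2 \<in> S" using that(4) mult3_in_residue2[of i j] by auto
      moreover have "3 * j = Suc (3 * i + 2)" using Suc by simp
      ultimately show ?thesis using SC cycle_complex_Suc by metis
    qed (use that in simp)
    then have "insert (Suc (3 * j)) S \<in> cycle_complex ?n"
      using that SC by (intro cycle_complex_insert[OF n]) (auto simp: numeral_eq_Suc)
    moreover have "insert (3 * j + 1) S \<noteq> residue2 m" using not_residue2(1)[of j] by blast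
    moreover have "\<not> bridge m i \<subseteq> insert (3 * j + 1) S" for i using bridge0[of i] that(3) by auto
    ultimately show ?thesis unfolding T_iff by simp
  qed
  show "\<not> residue2 m \<subseteq> S" if "S \<in> ?T" for S
    using facet_residue2_without_bridges[of S m] m that by blast
qed

lemma residue0_mixed: "0 < j \<Longrightarrow> 0 \<in> residue0 j \<and> 3 \<in> residue0 j"
  using mult3_in_residue0[of 0 j] mult3_in_residue0[of 1 j] by simp

lemma residue2_mixed: "1 < j \<Longrightarrow> 2 \<in> residue2 j \<and> 5 \<in> residue2 j"
  using mult3_in_residue2[of 0 j] mult3_in_residue2[of 1 j] by (simp add: numeral_2_eq_2)

lemma residues_are_faces:
  "0 < m \<Longrightarrow> residue0 (m - 1) \<in> cycle_complex (3 * m)"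
  "0 < m \<Longrightarrow> residue2 m \<in> cycle_complex (3 * m)"
  "residue0 m \<in> cycle_complex (3 * m + 2)"
  "0 < m \<Longrightarrow> residue2 m \<in> without_bridges m (cycle_complex (3 * m + 1))"
proof -
  have 0: "Suc i \<notin> residue0 j" if "i \<in> residue0 j" for i j
    using that by (auto simp: residue0_def; presburger)
  have 2: "Suc i \<notin> residue2 j" if "i \<in> residue2 j" for i j
    using that by (auto simp: residue2_def; presburger)
  have z: "0 \<notin> residue2 j" for j by (auto simp: residue2_def)
  show "residue0 (m - 1) \<in> cycle_complex (3 * m)" if "0 < m"
  proof (subst cycle_complex_iff, use that in simp, intro conjI allI impI 0)
    show "residue0 (m - 1) \<subseteq> {..<3 * m}" using that by (auto simp: residue0_def)
    show "3 * m - 1 \<notin> residue0 (m - 1)" using that by (auto simp: residue0_def; presburger)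
  qed
  show "residue2 m \<in> cycle_complex (3 * m)" if "0 < m"
  proof (subst cycle_complex_iff, use that in simp, intro conjI allI impI 2)
    show "residue2 m \<subseteq> {..<3 * m}" by (auto simp: residue2_def)
    show "3 * m - 1 \<notin> residue2 m" if "0 \<in> residue2 m" using z[of m] that by simp
  qed
  show "residue0 m \<in> cycle_complex (3 * m + 2)"
  proof (subst cycle_complex_iff, simp, intro conjI allI impI 0)
    show "residue0 m \<subseteq> {..<3 * m + 2}" by (auto simp: residue0_def)
    show "3 * m + 2 - 1 \<notin> residue0 m" by (auto simp: residue0_def; presburger)
  qed
  have "residue2 m \<in> cycle_complex (3 * m + 1)" if "0 < m"
  proof (subst cycle_complex_iff, use that in simp, intro conjI allI impI 2)
    show "residue2 m \<subseteq> {..<3 * m + 1}" by (auto simp: residue2_def)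
    show "3 * m + 1 - 1 \<notin> residue2 m" if "0 \<in> residue2 m" using z[of m] that by simp
  qed
  moreover have "\<not> bridge m j \<subseteq> residue2 m" for j using in_bridge(1)[of 0 m j] z by auto
  ultimately show "0 < m \<Longrightarrow> residue2 m \<in> without_bridges m (cycle_complex (3 * m + 1))"
    by (simp add: without_bridges_def)
qed

section \<open>The two parity facets of an even cycle\<close>

definition evens :: "nat \<Rightarrow> nat set" where
  "evens n = {x. x < 2 * n \<and> even x}"

definition odds :: "nat \<Rightarrow> nat set" where
  "odds n = {x. x < 2 * n \<and> odd x}"

lemma card_evens_odds: "card (evens n) = n" "card (odds n) = n"
proof -
  have "evens n = (\<lambda>i. 2 * i) ` {..<n}"
  proof
    show "evens n \<subseteq> (\<lambda>i. 2 * i) ` {..<n}" by (auto simp: evens_def elim!: evenE)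
  qed (auto simp: evens_def)
  moreover have "odds n = (\<lambda>i. 2 * i + 1) ` {..<n}"
  proof
    show "odds n \<subseteq> (\<lambda>i. 2 * i + 1) ` {..<n}" by (auto simp: odds_def elim!: oddE)
  qed (auto simp: odds_def)
  ultimately show "card (evens n) = n" "card (odds n) = n"
    by (simp_all add: card_image inj_on_def)
qed

lemma evens_odds_faces:
  assumes "1 \<le> n"
  shows "evens n \<in> cycle_complex (2 * n)" "odds n \<in> cycle_complex (2 * n)"
  using assms by (auto simp: cycle_complex_iff evens_def odds_def)

text \<open>Even without \<open>0\<close>, each odd number keeps a neighbour: \<open>1\<close> has
  \<open>2\<close>, and any other \<open>x\<close> has \<open>x - 1\<close>. So
  \<open>evens n - {0}\<close> is a free face of \<open>evens n\<close>.\<close>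

lemma face_above_evens:
  assumes S: "S \<in> cycle_complex (2 * n)" and n: "2 \<le> n" and sub: "evens n - {0} \<subseteq> S"
  shows "S \<subseteq> evens n"
proof
  fix x assume x: "x \<in> S"
  then have "x < 2 * n" using S by (auto simp: cycle_complex_def)
  moreover have "even x"
  proof (rule ccontr)
    assume odd: "odd x"
    show False
    proof (cases "x = 1")
      case True
      have "2 \<in> S" using sub n by (auto simp: evens_def)
      then show False using cycle_complex_Suc[OF S x] True by (simp add: numeral_2_eq_2)
    next
      case False
      then have "x - 1 \<in> evens n - {0}" using odd \<open>x < 2 * n\<close> by (auto simp: evens_def elim: oddE)
      then have "x - 1 \<in> S" using sub by blast
      then show False using cycle_complex_Suc[OF S, of "x - 1"] x odd by (simp add: odd_pos)
    qed
  qed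
  ultimately show "x \<in> evens n" by (simp add: evens_def)
qed

text \<open>Here \<open>0\<close> keeps its neighbour \<open>2 * n - 1\<close> around the cycle, and
  any other even \<open>x\<close> keeps \<open>x + 1\<close>.\<close>

lemma face_above_odds:
  assumes S: "S \<in> cycle_complex (2 * n)" and n: "2 \<le> n" and sub: "odds n - {1} \<subseteq> S"
  shows "S \<subseteq> odds n"
proof
  fix x assume x: "x \<in> S"
  then have lt: "x < 2 * n" using S by (auto simp: cycle_complex_def)
  moreover have "odd x"
  proof
    assume even: "even x"
    show False
    proof (cases "x = 0")
      case True
      have "2 * n - 1 \<in> S" using sub n by (auto simp: odds_def)
      then show False using S x True n by (simp add: cycle_complex_iff)
    next
      case False
      then have "Suc x \<in> odds n - {1}" using even lt by (auto simp: odds_def elim!: evenE)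
      then show False using cycle_complex_Suc[OF S x] sub by blast
    qed
  qed
  ultimately show "x \<in> odds n" by (simp add: odds_def)
qed

lemma finite_complex_punctured_cycle:
  assumes "2 \<le> n"
  shows "finite_complex {..<2 * n} (cycle_complex (2 * n) - {evens n, odds n})"
proof (rule finite_complex_remove_facets[OF finite_complex_cycle])
  fix S \<sigma> assume S: "S \<in> cycle_complex (2 * n)" "\<sigma> \<in> {evens n, odds n}" "\<sigma> \<subseteq> S"
  then show "S = \<sigma>" using face_above_evens[OF S(1) assms] face_above_odds[OF S(1) assms] by auto
qed

text \<open>Each parity facet is collapsed together with its free face, which preserves
  contractibility. The remaining complex is also the punctured complex without the facets
  \<open>\<rho>s\<close>, \<open>evens n - {0}\<close> and \<open>odds n - {1}\<close>; the last two
  have \<open>n - 1\<close> vertices, whence the dimension \<open>n - 2\<close>. Here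
  \<open>B\<close> is the full complex or the one without bridges.\<close>

lemma wedge_after_removing_parity_facets:
  assumes n: "3 \<le> n" and B: "finite_complex {..<2 * n} B" "B \<subseteq> cycle_complex (2 * n)"
    and EO: "evens n \<in> B" "odds n \<in> B"
    and \<rho>s: "set \<rho>s \<subseteq> B" "distinct \<rho>s" "\<And>\<rho>. \<rho> \<in> set \<rho>s \<Longrightarrow> \<not> \<rho> \<subseteq> evens n \<and> \<not> \<rho> \<subseteq> odds n"
    and facet: "\<And>S \<rho>. S \<in> B \<Longrightarrow> \<rho> \<in> set \<rho>s \<Longrightarrow> \<rho> \<subseteq> S \<Longrightarrow> S = \<rho>"
    and contractible: "contractible_space (geometric_realization (B - set \<rho>s))"
  shows "geometric_realization (B - {evens n, odds n}) homotopy_equivalent_space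
    wedge_of_spheres (map (\<lambda>\<sigma>. card \<sigma> - 1) \<rho>s @ [n - 2, n - 2])"
proof -
  define E O' where "E = evens n - {0}" and "O' = odds n - {1}"
  define \<sigma> where "\<sigma> j = (if j = 0 then E else O')" for j :: nat
  have mem: "0 \<in> evens n" "1 \<in> odds n" "2 \<in> E" "3 \<in> O'" "2 \<notin> O'" "3 \<notin> E" "2 \<in> evens n" "3 \<notin> evens n"
    "3 \<in> odds n" "2 \<notin> odds n"
    using n by (auto simp: evens_def odds_def E_def O'_def)
  have aboveE: "S = evens n \<or> S = E" if "S \<in> B" "E \<subseteq> S" for S
  proof -
    have "S \<subseteq> evens n" by (rule face_above_evens) (use that B(2) n in \<open>auto simp: E_def\<close>)
    then show ?thesis using that(2) unfolding E_def by blast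
  qed
  have aboveO: "S = odds n \<or> S = O'" if "S \<in> B" "O' \<subseteq> S" for S
  proof -
    have "S \<subseteq> odds n" by (rule face_above_odds) (use that B(2) n in \<open>auto simp: O'_def\<close>)
    then show ?thesis using that(2) unfolding O'_def by blast
  qed
  have EB: "E \<in> B" and OB: "O' \<in> B"
  proof -
    have "E \<noteq> {}" "O' \<noteq> {}" using mem(3,4) by blast+
    then show "E \<in> B" "O' \<in> B"
      using finite_complexD(4)[OF B(1) EO(1), of E] finite_complexD(4)[OF B(1) EO(2), of O']
      unfolding E_def O'_def by blast+
  qed
  have not\<rho>: "evens n \<notin> set \<rho>s" "odds n \<notin> set \<rho>s" "E \<notin> set \<rho>s" "O' \<notin> set \<rho>s"
    using \<rho>s(3) by (auto simp: E_def O'_def)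
  let ?T = "B - set \<rho>s" and ?K = "B - {evens n, odds n}"
  have T: "finite_complex {..<2 * n} ?T"
    by (rule finite_complex_remove_facets[OF B(1) facet])
  have K: "finite_complex {..<2 * n} ?K"
  proof (rule finite_complex_remove_facets[OF B(1)])
    fix S \<sigma> assume S: "S \<in> B" "\<sigma> \<in> {evens n, odds n}" "\<sigma> \<subseteq> S"
    then have SC: "S \<in> cycle_complex (2 * n)" using B(2) by blast
    show "S = \<sigma>" using S face_above_evens[OF SC] face_above_odds[OF SC] n by auto
  qed
  have "geometric_realization ?T homotopy_equivalent_space geometric_realization {S \<in> ?T. \<forall>j<2. \<not> \<sigma> j \<subseteq> S}"
  \<comment> \<open>The indices 0 and 1 are at the same time the vertices missing from
    \<open>E\<close> and \<open>O'\<close>, so they serve as apices.\<close>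
  proof (rule realization_collapse_sequence[OF T, where p = "\<lambda>j. j"])
    fix j :: nat assume j: "j < 2"
    have fin: "finite E" "finite O'" by (auto simp: E_def O'_def evens_def odds_def)
    show "finite (\<sigma> j) \<and> \<sigma> j \<noteq> {} \<and> j \<in> {..<2 * n} - \<sigma> j"
      using j n mem(3,4) fin by (auto simp: \<sigma>_def less_2_cases_iff) (auto simp: E_def O'_def)
    fix S assume S: "S \<in> ?T" "\<sigma> j \<subseteq> S"
    show "insert j S \<in> ?T \<and> (\<forall>i. j < i \<longrightarrow> i < 2 \<longrightarrow> \<not> \<sigma> i \<subseteq> insert j S)"
    proof (cases "j = 0")
      case True
      then have "insert j S = evens n" using aboveE[of S] S mem(1) by (auto simp: \<sigma>_def E_def)
      moreover have "\<not> O' \<subseteq> evens n" using mem by blast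
      ultimately show ?thesis using EO(1) not\<rho> by (simp add: \<sigma>_def)
    next
      case False
      then have "j = 1" using j by simp
      then have "insert j S = odds n" using aboveO[of S] S mem(2) by (auto simp: \<sigma>_def O'_def)
      then show ?thesis using EO(2) not\<rho> \<open>j = 1\<close> by simp
    qed
  qed
  \<comment> \<open>The two descriptions of the skeleton: the result of the collapses in
    \<open>B\<close>, and what the new facets of \<open>?K\<close> are attached to.\<close>
  moreover have "{S \<in> ?T. \<forall>j<2. \<not> \<sigma> j \<subseteq> S} = ?K - set (\<rho>s @ [E, O'])"
  proof -
    have "(\<forall>j<2. \<not> \<sigma> j \<subseteq> S) \<longleftrightarrow> \<not> E \<subseteq> S \<and> \<not> O' \<subseteq> S" for S
      by (auto simp: \<sigma>_def less_2_cases_iff)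
    moreover have "E \<subseteq> S \<longleftrightarrow> S = evens n \<or> S = E" if "S \<in> B" for S
      using aboveE[OF that] by (auto simp: E_def)
    moreover have "O' \<subseteq> S \<longleftrightarrow> S = odds n \<or> S = O'" if "S \<in> B" for S
      using aboveO[OF that] by (auto simp: O'_def)
    ultimately have "S \<in> {S \<in> ?T. \<forall>j<2. \<not> \<sigma> j \<subseteq> S} \<longleftrightarrow> S \<in> ?K - set (\<rho>s @ [E, O'])" for S
      by (cases "S \<in> B") auto
    then show ?thesis by (rule set_eqI)
  qed
  ultimately have c: "contractible_space (geometric_realization (?K - set (\<rho>s @ [E, O'])))"
    using contractible homotopy_equivalent_space_contractibility by metis
  have "geometric_realization ?K homotopy_equivalent_space
    wedge_of_spheres (map (\<lambda>\<sigma>. card \<sigma> - 1) (\<rho>s @ [E, O']))"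
  proof (rule realization_equivalent_wedge_of_spheres[OF K _ _ _ _ _ c])
    have neq: "E \<noteq> evens n" "E \<noteq> odds n" "O' \<noteq> evens n" "O' \<noteq> odds n" "E \<noteq> O'"
    proof -
      have "0 \<notin> E" "1 \<notin> O'" by (auto simp: E_def O'_def)
      then show "E \<noteq> evens n" "E \<noteq> odds n" "O' \<noteq> evens n" "O' \<noteq> odds n" "E \<noteq> O'"
        using mem by metis+
    qed
    show "set (\<rho>s @ [E, O']) \<subseteq> ?K" using \<rho>s(1) EB OB neq not\<rho> by auto
    show "{} \<notin> set (\<rho>s @ [E, O'])" using \<rho>s(3)[of "{}"] mem by auto
    show "distinct (\<rho>s @ [E, O'])" using \<rho>s(2) not\<rho> neq by auto
    show "\<rho>s @ [E, O'] \<noteq> []" by simp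
    show "S = \<tau>" if "S \<in> ?K" "\<tau> \<in> set (\<rho>s @ [E, O'])" "\<tau> \<subseteq> S" for S \<tau>
      using that aboveE[of S] aboveO[of S] facet[of S \<tau>] by auto
    have "{1} \<in> B" using finite_complexD(4)[OF B(1) EO(2), of "{1}"] mem by simp
    moreover have "{1} \<notin> set \<rho>s" using \<rho>s(3)[of "{1}"] mem by auto
    moreover have "{1} \<noteq> S" if "2 \<in> S \<or> 3 \<in> S" for S :: "nat set" using that by auto
    then have "{1} \<noteq> evens n" "{1} \<noteq> odds n" "{1} \<noteq> E" "{1} \<noteq> O'" using mem by metis+
    ultimately show "{1} \<in> ?K - set (\<rho>s @ [E, O'])" by simp
  qed simp
  moreover have "card E = n - 1" "card O' = n - 1"
    using card_evens_odds[of n] mem by (simp_all add: E_def O'_def)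
  ultimately show ?thesis by (simp add: numeral_2_eq_2)
qed

section \<open>Homotopy types of the cycle complexes\<close>

lemma cycle_complex_mult3:
  assumes "0 < m"
  shows "geometric_realization (cycle_complex (3 * m)) homotopy_equivalent_space
    wedge_of_spheres [m - 1, m - 1]"
proof -
  let ?\<rho>s = "[residue0 (m - 1), residue2 m]"
  have neq: "residue0 (m - 1) \<noteq> residue2 m"
    using mult3_in_residue0[of 0 "m - 1"] by (auto simp: residue2_def)
  have "geometric_realization (cycle_complex (3 * m)) homotopy_equivalent_space
    wedge_of_spheres (map (\<lambda>\<sigma>. card \<sigma> - 1) ?\<rho>s)"
  proof (rule realization_equivalent_wedge_of_spheres[OF finite_complex_cycle])
    show "set ?\<rho>s \<subseteq> cycle_complex (3 * m)" using residues_are_faces assms by simp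
    show "{} \<notin> set ?\<rho>s"
      using card_residue0[of "m - 1"] card_residue2[of m] assms by (auto dest: arg_cong[of _ _ card])
    show "distinct ?\<rho>s" using neq by simp
    show "?\<rho>s \<noteq> []" by simp
    show "S = \<sigma>" if "S \<in> cycle_complex (3 * m)" "\<sigma> \<in> set ?\<rho>s" "\<sigma> \<subseteq> S" for S \<sigma>
      using that facet_residue0_mult3[of S m] facet_residue2_mult3[of S m] assms by auto
    show "contractible_space (geometric_realization (cycle_complex (3 * m) - set ?\<rho>s))"
      using contractible_cycle_mult3[OF assms] by simp
    have "{1} \<in> cycle_complex (3 * m)" using assms by (intro cycle_complex_singleton) auto
    moreover have "1 \<notin> residue0 (m - 1)" "1 \<notin> residue2 m" by (auto simp: residue0_def residue2_def; presburger)+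
    ultimately show "{1} \<in> cycle_complex (3 * m) - set ?\<rho>s" by auto
  qed simp
  then show ?thesis using assms by (simp add: card_residue0 card_residue2)
qed

lemma cycle_complex_mult3_plus2:
  "geometric_realization (cycle_complex (3 * m + 2)) homotopy_equivalent_space nsphere m"
proof -
  have "geometric_realization (cycle_complex (3 * m + 2)) homotopy_equivalent_space
    wedge_of_spheres (map (\<lambda>\<sigma>. card \<sigma> - 1) [residue0 m])"
  proof (rule realization_equivalent_wedge_of_spheres[OF finite_complex_cycle])
    show "set [residue0 m] \<subseteq> cycle_complex (3 * m + 2)" using residues_are_faces by simp
    show "{} \<notin> set [residue0 m]" using mult3_in_residue0[of 0 m] by auto
    show "S = \<sigma>" if "S \<in> cycle_complex (3 * m + 2)" "\<sigma> \<in> set [residue0 m]" "\<sigma> \<subseteq> S" for S \<sigma>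
      using that facet_residue0_mult3_plus2[of S m] by auto
    show "contractible_space (geometric_realization (cycle_complex (3 * m + 2) - set [residue0 m]))"
      using contractible_cycle_mult3_plus2 by simp
    have "{1} \<in> cycle_complex (3 * m + 2)" by (intro cycle_complex_singleton) auto
    moreover have "1 \<notin> residue0 m" by (auto simp: residue0_def; presburger)
    ultimately show "{1} \<in> cycle_complex (3 * m + 2) - set [residue0 m]" by auto
  qed simp_all
  also have "wedge_of_spheres (map (\<lambda>\<sigma>. card \<sigma> - 1) [residue0 m]) homotopy_equivalent_space nsphere m"
    using wedge_of_one_sphere[of m] by (simp add: card_residue0 homeomorphic_imp_homotopy_equivalent_space)
  finally show ?thesis .
qed

lemma cycle_complex_mult3_plus1:
  assumes "0 < m"
  shows "geometric_realization (cycle_complex (3 * m + 1)) homotopy_equivalent_space nsphere (m - 1)"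
proof -
  let ?B = "without_bridges m (cycle_complex (3 * m + 1))"
  have "geometric_realization (cycle_complex (3 * m + 1)) homotopy_equivalent_space geometric_realization ?B"
    by (rule collapse_bridges[OF finite_complex_cycle]) auto
  also have "geometric_realization ?B homotopy_equivalent_space
    wedge_of_spheres (map (\<lambda>\<sigma>. card \<sigma> - 1) [residue2 m])"
  proof (rule realization_equivalent_wedge_of_spheres[OF finite_complex_without_bridges[OF finite_complex_cycle]])
    show "set [residue2 m] \<subseteq> ?B" using residues_are_faces assms by simp
    show "{} \<notin> set [residue2 m]" using mult3_in_residue2[of 0 m] assms by auto
    show "S = \<sigma>" if "S \<in> ?B" "\<sigma> \<in> set [residue2 m]" "\<sigma> \<subseteq> S" for S \<sigma>
      using that facet_residue2_without_bridges[of S m] assms by auto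
    show "contractible_space (geometric_realization (?B - set [residue2 m]))"
      using contractible_cycle_mult3_plus1[OF assms] by simp
    have "{1} \<in> cycle_complex (3 * m + 1)" using assms by (intro cycle_complex_singleton) auto
    moreover have "\<not> bridge m j \<subseteq> {1}" for j using in_bridge(1)[of 0 m j] by auto
    moreover have "1 \<notin> residue2 m" by (auto simp: residue2_def)
    ultimately show "{1} \<in> ?B - set [residue2 m]" by (auto simp: without_bridges_def)
  qed simp_all
  also have "wedge_of_spheres (map (\<lambda>\<sigma>. card \<sigma> - 1) [residue2 m]) homotopy_equivalent_space nsphere (m - 1)"
    using wedge_of_one_sphere[of "m - 1"] by (simp add: card_residue2 homeomorphic_imp_homotopy_equivalent_space)
  finally show ?thesis .
qed

section \<open>Even cycles without the parity facets\<close>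

lemma mixed_parity:
  "x \<in> \<rho> \<Longrightarrow> y \<in> \<rho> \<Longrightarrow> even x \<Longrightarrow> odd y \<Longrightarrow> \<not> \<rho> \<subseteq> evens n \<and> \<not> \<rho> \<subseteq> odds n"
  by (auto simp: evens_def odds_def)

lemma punctured_cycle_complex_mult3:
  assumes "0 < k"
  shows "geometric_realization (cycle_complex (2 * (3 * k)) - {evens (3 * k), odds (3 * k)})
    homotopy_equivalent_space wedge_of_spheres [2 * k - 1, 2 * k - 1, 3 * k - 2, 3 * k - 2]"
proof -
  let ?m = "2 * k" and ?\<rho>s = "[residue0 (2 * k - 1), residue2 (2 * k)]"
  have N: "2 * (3 * k) = 3 * ?m" by simp
  have "geometric_realization (cycle_complex (2 * (3 * k)) - {evens (3 * k), odds (3 * k)})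
    homotopy_equivalent_space wedge_of_spheres (map (\<lambda>\<sigma>. card \<sigma> - 1) ?\<rho>s @ [3 * k - 2, 3 * k - 2])"
  proof (rule wedge_after_removing_parity_facets[OF _ finite_complex_cycle])
    show "set ?\<rho>s \<subseteq> cycle_complex (2 * (3 * k))"
      unfolding N using residues_are_faces(1,2)[of ?m] assms by simp
    show "distinct ?\<rho>s" using residue0_mixed[of "?m - 1"] assms by (auto simp: residue2_def)
    show "\<not> \<rho> \<subseteq> evens (3 * k) \<and> \<not> \<rho> \<subseteq> odds (3 * k)" if "\<rho> \<in> set ?\<rho>s" for \<rho>
      using that residue0_mixed[of "?m - 1"] residue2_mixed[of ?m] assms
        mixed_parity[of 0 \<rho> 3] mixed_parity[of 2 \<rho> 5] by auto
    show "S = \<rho>" if "S \<in> cycle_complex (2 * (3 * k))" "\<rho> \<in> set ?\<rho>s" "\<rho> \<subseteq> S" for S \<rho>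
      using that facet_residue0_mult3[of S ?m] facet_residue2_mult3[of S ?m] assms unfolding N by auto
    show "contractible_space (geometric_realization (cycle_complex (2 * (3 * k)) - set ?\<rho>s))"
      unfolding N using contractible_cycle_mult3[of ?m] assms by simp
  qed (use assms evens_odds_faces[of "3 * k"] in auto)
  then show ?thesis using assms by (simp add: card_residue0 card_residue2)
qed

lemma punctured_cycle_complex_mult3_plus1:
  assumes "0 < k"
  shows "geometric_realization (cycle_complex (2 * (3 * k + 1)) - {evens (3 * k + 1), odds (3 * k + 1)})
    homotopy_equivalent_space wedge_of_spheres [2 * k, 3 * k - 1, 3 * k - 1]"
proof -
  let ?m = "2 * k" and ?n = "3 * k + 1" and ?\<rho>s = "[residue0 (2 * k)]"
  have N: "2 * ?n = 3 * ?m + 2" by simp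
  have "geometric_realization (cycle_complex (2 * ?n) - {evens ?n, odds ?n})
    homotopy_equivalent_space wedge_of_spheres (map (\<lambda>\<sigma>. card \<sigma> - 1) ?\<rho>s @ [?n - 2, ?n - 2])"
  proof (rule wedge_after_removing_parity_facets[OF _ finite_complex_cycle])
    show "set ?\<rho>s \<subseteq> cycle_complex (2 * ?n)"
      unfolding N using residues_are_faces(3)[of ?m] by simp
    show "\<not> \<rho> \<subseteq> evens ?n \<and> \<not> \<rho> \<subseteq> odds ?n" if "\<rho> \<in> set ?\<rho>s" for \<rho>
      using that residue0_mixed[of ?m] assms mixed_parity[of 0 \<rho> 3] by auto
    show "S = \<rho>" if "S \<in> cycle_complex (2 * ?n)" "\<rho> \<in> set ?\<rho>s" "\<rho> \<subseteq> S" for S \<rho>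
      using that facet_residue0_mult3_plus2[of S ?m] unfolding N by auto
    show "contractible_space (geometric_realization (cycle_complex (2 * ?n) - set ?\<rho>s))"
      unfolding N using contractible_cycle_mult3_plus2[of ?m] by simp
  qed (use assms evens_odds_faces[of ?n] in auto)
  moreover have "?n - 2 = 3 * k - 1" by simp
  ultimately show ?thesis by (simp add: card_residue0)
qed

lemma bridge_mixed:
  assumes "3 \<le> m" "j < m"
  shows "\<exists>x\<in>bridge m j. \<exists>y\<in>bridge m j. even x \<and> odd y"
proof (cases "j = 0")
  case True
  have "0 \<in> bridge m j" using in_bridge(1)[of 0 m j] by simp
  moreover have "5 \<in> bridge m j" using in_bridge(2)[of 1 m j] assms True by simp
  ultimately show ?thesis by (intro bexI[of _ 0] bexI[of _ 5]) auto
next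
  case False
  have "0 \<in> bridge m j" using in_bridge(1)[of 0 m j] by simp
  moreover have "3 \<in> bridge m j" using in_bridge(1)[of 1 m j] False by simp
  ultimately show ?thesis by (intro bexI[of _ 0] bexI[of _ 3]) auto
qed

lemma punctured_cycle_complex_mult3_plus2:
  assumes "0 < k"
  shows "geometric_realization (cycle_complex (2 * (3 * k + 2)) - {evens (3 * k + 2), odds (3 * k + 2)})
    homotopy_equivalent_space wedge_of_spheres [2 * k, 3 * k, 3 * k]"
proof -
  let ?m = "2 * k + 1" and ?n = "3 * k + 2" and ?\<rho>s = "[residue2 (2 * k + 1)]"
  let ?C = "cycle_complex (2 * (3 * k + 2))" and ?EO = "{evens (3 * k + 2), odds (3 * k + 2)}"
  \<comment> \<open>The length is \<open>6 * k + 4\<close>, so \<open>m = 2 * k + 1\<close>; the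
    facet has \<open>m\<close> vertices and contributes dimension \<open>2 * k\<close>.\<close>
  have N: "2 * ?n = 3 * ?m + 1" by simp
  have m: "3 \<le> ?m" "0 < ?m" using assms by auto
  have bridge: "\<not> bridge ?m j \<subseteq> evens ?n \<and> \<not> bridge ?m j \<subseteq> odds ?n" if "j < ?m" for j
    using bridge_mixed[OF m(1) that] mixed_parity by metis
  have K: "finite_complex {..<2 * ?n} (?C - ?EO)"
    by (rule finite_complex_punctured_cycle) simp
  \<comment> \<open>Every bridge contains both parities, so no face above a bridge is a parity
    facet: the collapses work in the punctured complex as in the full one.\<close>
  have "geometric_realization (?C - ?EO) homotopy_equivalent_space
    geometric_realization (without_bridges ?m (?C - ?EO))"
  proof (rule collapse_bridges)
    show "finite_complex {..<3 * ?m + 1} (?C - ?EO)" using K unfolding N .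
    show "?C - ?EO \<subseteq> cycle_complex (3 * ?m + 1)" unfolding N by blast
    fix j S assume j: "j < ?m" "bridge ?m j \<subseteq> S" and S: "insert (3 * j + 2) S \<in> cycle_complex (3 * ?m + 1)"
    have "bridge ?m j \<subseteq> insert (3 * j + 2) S" using j(2) by (rule subset_insertI2)
    then have "insert (3 * j + 2) S \<noteq> evens ?n" "insert (3 * j + 2) S \<noteq> odds ?n"
      using bridge[OF j(1)] by metis+
    then show "insert (3 * j + 2) S \<in> ?C - ?EO" using S unfolding N by simp
  qed
  also have "without_bridges ?m (?C - ?EO) = without_bridges ?m ?C - ?EO"
    by (auto simp: without_bridges_def)
  also have "geometric_realization (without_bridges ?m ?C - ?EO) homotopy_equivalent_space
    wedge_of_spheres (map (\<lambda>\<sigma>. card \<sigma> - 1) ?\<rho>s @ [?n - 2, ?n - 2])"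
  proof (rule wedge_after_removing_parity_facets[OF _ finite_complex_without_bridges[OF finite_complex_cycle]])
    show "without_bridges ?m ?C \<subseteq> ?C" by (auto simp: without_bridges_def)
    show "evens ?n \<in> without_bridges ?m ?C" "odds ?n \<in> without_bridges ?m ?C"
      using evens_odds_faces[of ?n] bridge by (auto simp: without_bridges_def)
    show "set ?\<rho>s \<subseteq> without_bridges ?m ?C"
      unfolding N using residues_are_faces(4)[of ?m] by simp
    show "\<not> \<rho> \<subseteq> evens ?n \<and> \<not> \<rho> \<subseteq> odds ?n" if "\<rho> \<in> set ?\<rho>s" for \<rho>
      using that residue2_mixed[of ?m] assms mixed_parity[of 2 \<rho> 5] by auto
    show "S = \<rho>" if "S \<in> without_bridges ?m ?C" "\<rho> \<in> set ?\<rho>s" "\<rho> \<subseteq> S" for S \<rho>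
      using that facet_residue2_without_bridges[of S ?m] unfolding N by auto
    show "contractible_space (geometric_realization (without_bridges ?m ?C - set ?\<rho>s))"
      unfolding N using contractible_cycle_mult3_plus1[of ?m] by simp
  qed (use assms in auto)
  finally show ?thesis by (simp add: card_residue2)
qed

section \<open>Directed forests in the double directed cycle\<close>

text \<open>Walks are split at the last arc because in a forest it is the incoming arc of a vertex
  that is determined.\<close>

lemma (in pre_digraph) awalk_snoc:
  "awalk u (p @ [e]) v \<longleftrightarrow> awalk u p (tail G e) \<and> e \<in> arcs G \<and> head G e = v"
proof -
  have "cas u (p @ [e]) v \<longleftrightarrow> cas u p (tail G e) \<and> head G e = v"
    by (induction p arbitrary: u) auto
  then show ?thesis by (auto simp: awalk_def)
qed

text \<open>Extending the walk from the root to \<open>tail T e\<close> produces a competing walk in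
  each case: against the empty walk at the root, against a walk with another last arc, and, once
  around a 2-cycle, against the walk that was extended.\<close>

lemma directed_tree_arcs:
  assumes T: "directed_tree T x" and e: "e \<in> arcs T"
  shows "head T e \<noteq> x"
    and "e' \<in> arcs T \<Longrightarrow> head T e' = head T e \<Longrightarrow> e' = e"
    and "e' \<in> arcs T \<Longrightarrow> head T e = tail T e' \<Longrightarrow> head T e' \<noteq> tail T e"
proof -
  interpret wf_digraph T using T by (simp add: directed_tree_def)
  have x: "x \<in> verts T" and uniq: "\<And>p q v. awalk x p v \<Longrightarrow> awalk x q v \<Longrightarrow> p = q"
    and ex: "\<And>v. v \<in> verts T \<Longrightarrow> \<exists>p. awalk x p v"
    using T awalk_last_in_verts unfolding directed_tree_def by blast+
  obtain p where p: "awalk x p (tail T e)" using ex[OF tail_in_verts[OF e]] by blast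
  then have pe: "awalk x (p @ [e]) (head T e)" using e by (simp add: awalk_snoc del: awalk_append_iff)
  show "head T e \<noteq> x"
  proof
    assume h: "head T e = x"
    have "awalk x [] x" using x by (simp add: awalk_Nil_iff)
    from uniq[OF this pe[unfolded h]] show False by simp
  qed
  show "e' = e" if e': "e' \<in> arcs T" "head T e' = head T e"
  proof -
    obtain q where "awalk x q (tail T e')" using ex[OF tail_in_verts[OF e'(1)]] by blast
    then have "awalk x (q @ [e']) (head T e)" using e' by (simp add: awalk_snoc del: awalk_append_iff)
    from uniq[OF this pe] show ?thesis by simp
  qed
  show "head T e' \<noteq> tail T e" if e': "e' \<in> arcs T" "head T e = tail T e'"
  proof
    assume "head T e' = tail T e"
    then have "awalk x ((p @ [e]) @ [e']) (tail T e)" using pe e' by (simp only: awalk_snoc)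
    from uniq[OF this p] show False by simp
  qed
qed

lemma directed_forest_arcs:
  assumes F: "directed_forest F"
  shows "e \<in> arcs F \<Longrightarrow> e' \<in> arcs F \<Longrightarrow> head F e' = head F e \<Longrightarrow> e' = e"
    and "e \<in> arcs F \<Longrightarrow> e' \<in> arcs F \<Longrightarrow> head F e = tail F e' \<Longrightarrow> head F e' \<noteq> tail F e"
    and "verts F \<noteq> {} \<Longrightarrow> \<exists>v\<in>verts F. \<forall>e\<in>arcs F. head F e \<noteq> v"
proof -
  obtain \<T> where \<T>: "\<forall>T\<in>\<T>. subgraph T F \<and> (\<exists>x. directed_tree T x)"
    "\<forall>T\<in>\<T>. \<forall>T'\<in>\<T>. T \<noteq> T' \<longrightarrow> verts T \<inter> verts T' = {}"
    and V: "verts F = (\<Union>T \<in> \<T>. verts T)" and A: "arcs F = (\<Union>T \<in> \<T>. arcs T)"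
    using F unfolding directed_forest_def by (elim exE conjE)
  then have sub: "\<And>T. T \<in> \<T> \<Longrightarrow> subgraph T F" and tree: "\<And>T. T \<in> \<T> \<Longrightarrow> \<exists>x. directed_tree T x"
    and disj: "\<And>T T'. T \<in> \<T> \<Longrightarrow> T' \<in> \<T> \<Longrightarrow> verts T \<inter> verts T' \<noteq> {} \<Longrightarrow> T = T'"
    by auto
  have fn: "head T = head F" "tail T = tail F" if "T \<in> \<T>" for T
    using sub[OF that] by (auto simp: subgraph_def compatible_def)
  have ends: "head F e \<in> verts T" "tail F e \<in> verts T" if "T \<in> \<T>" "e \<in> arcs T" for T e
    using sub[OF that(1)] that(2) wf_digraph.head_in_verts[of T e] wf_digraph.tail_in_verts[of T e]
    unfolding fn[OF that(1), symmetric] by (auto simp: subgraph_def)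
  \<comment> \<open>Such arcs share a vertex, and distinct trees have no common vertex.\<close>
  have same: "\<exists>T x. T \<in> \<T> \<and> directed_tree T x \<and> e \<in> arcs T \<and> e' \<in> arcs T"
    if "e \<in> arcs F" "e' \<in> arcs F" "head F e' = head F e \<or> head F e = tail F e'" for e e'
  proof -
    obtain T T' where T: "T \<in> \<T>" "e \<in> arcs T" and T': "T' \<in> \<T>" "e' \<in> arcs T'"
      using \<open>e \<in> arcs F\<close> \<open>e' \<in> arcs F\<close> unfolding A by blast
    have "head F e \<in> verts T \<inter> verts T'" using ends[OF T] ends[OF T'] that(3) by auto
    then have "T = T'" using disj[OF T(1) T'(1)] by blast
    then show ?thesis using T T' tree by blast
  qed
  show "e' = e" if ee: "e \<in> arcs F" "e' \<in> arcs F" "head F e' = head F e"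
  proof -
    obtain T x where T: "T \<in> \<T>" "directed_tree T x" "e \<in> arcs T" "e' \<in> arcs T"
      using same ee by metis
    then show ?thesis using directed_tree_arcs(2)[OF T(2-4)] ee(3) fn[OF T(1)] by simp
  qed
  show "head F e' \<noteq> tail F e" if ee: "e \<in> arcs F" "e' \<in> arcs F" "head F e = tail F e'"
  proof -
    obtain T x where T: "T \<in> \<T>" "directed_tree T x" "e \<in> arcs T" "e' \<in> arcs T"
      using same ee by metis
    then show ?thesis using directed_tree_arcs(3)[OF T(2-4)] ee(3) fn[OF T(1)] by simp
  qed
  show "\<exists>v\<in>verts F. \<forall>e\<in>arcs F. head F e \<noteq> v" if ne: "verts F \<noteq> {}"
  proof -
    obtain T where T: "T \<in> \<T>" using ne V by blast
    obtain x where x: "directed_tree T x" using tree[OF T] by blast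
    then have xT: "x \<in> verts T" by (simp add: directed_tree_def)
    have "head F e \<noteq> x" if "e \<in> arcs F" for e
    proof
      assume h: "head F e = x"
      obtain T' where T': "T' \<in> \<T>" "e \<in> arcs T'" using \<open>e \<in> arcs F\<close> A by blast
      then have "T' = T" using ends(1)[OF T'] h xT disj[OF T'(1) T] by blast
      then show False using directed_tree_arcs(1)[OF x, of e] T'(2) h fn[OF T] by simp
    qed
    then show ?thesis using xT T V by blast
  qed
qed

text \<open>The trees of the forest are the sets of vertices reachable from a vertex without incoming arc.\<close>

lemma directed_forestI:
  fixes F (structure)
  assumes wf: "wf_digraph F"
    and indeg: "\<And>e e'. e \<in> arcs F \<Longrightarrow> e' \<in> arcs F \<Longrightarrow> head F e' = head F e \<Longrightarrow> e' = e"
    and reach: "\<And>v. v \<in> verts F \<Longrightarrow>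
      \<exists>r\<in>verts F. (\<forall>e\<in>arcs F. head F e \<noteq> r) \<and> (\<exists>p. pre_digraph.awalk F r p v)"
  shows "directed_forest F"
proof -
  interpret wf_digraph F by (rule wf)
  define R where "R = {r \<in> verts F. \<forall>e\<in>arcs F. head F e \<noteq> r}"
  define comp where "comp r = \<lparr>verts = {v. \<exists>p. awalk r p v},
    arcs = {e \<in> arcs F. \<exists>p. awalk r p (tail F e)}, tail = tail F, head = head F\<rparr>" for r
  \<comment> \<open>Read from their ends, two walks to \<open>v\<close> use the same incoming arc at
    every vertex, and a vertex of \<open>R\<close> has none, so they begin together. This gives
    unique walks within a component as well as disjointness of the components.\<close>
  have uniq: "p = q \<and> r = r'" if "r \<in> R" "r' \<in> R" "awalk r p v" "awalk r' q v" for r r' p q v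
    using that(3,4)
  proof (induction p arbitrary: q v rule: rev_induct)
    case Nil
    then have v: "v = r" by (simp add: awalk_Nil_iff)
    show ?case
    proof (cases q rule: rev_cases)
      case Nil
      then show ?thesis using v \<open>awalk r' q v\<close> by (simp add: awalk_Nil_iff)
    next
      case (snoc q' e)
      then have "e \<in> arcs F" "head F e = r" using \<open>awalk r' q v\<close> v by (auto simp: awalk_snoc)
      then show ?thesis using \<open>r \<in> R\<close> by (auto simp: R_def)
    qed
  next
    case (snoc e p)
    then have e: "e \<in> arcs F" "head F e = v" "awalk r p (tail F e)" by (auto simp: awalk_snoc)
    show ?case
    proof (cases q rule: rev_cases)
      case Nil
      then have "head F e = r'" using snoc.prems(2) e by (simp add: awalk_Nil_iff)
      then show ?thesis using e \<open>r' \<in> R\<close> by (auto simp: R_def)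
    next
      case (snoc q' e')
      then have e': "e' \<in> arcs F" "head F e' = v" "awalk r' q' (tail F e')"
        using \<open>awalk r' q v\<close> by (auto simp: awalk_snoc)
      then have "e' = e" using indeg e by simp
      then show ?thesis using snoc snoc.IH[OF e(3)] e'(3) by simp
    qed
  qed
  have cas_comp: "pre_digraph.cas (comp r) u p v = cas u p v" for r u p v
  proof (induction p arbitrary: u)
    case (Cons e p)
    then show ?case by (simp add: pre_digraph.cas.simps comp_def)
  qed (simp add: pre_digraph.cas.simps)
  have to_comp: "pre_digraph.awalk (comp r) r p v" if "awalk r p v" for r p v
    using that
  proof (induction p arbitrary: v rule: rev_induct)
    case Nil
    then have v: "v = r" "awalk r [] r" by (auto simp: awalk_Nil_iff)
    then have "r \<in> verts (comp r)" by (auto simp: comp_def)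
    then show ?case by (simp add: pre_digraph.awalk_def pre_digraph.cas.simps v)
  next
    case (snoc e p)
    then have "awalk r p (tail F e)" "e \<in> arcs F" "head F e = v" by (auto simp: awalk_snoc)
    then show ?case using snoc.IH by (auto simp: pre_digraph.awalk_snoc) (auto simp: comp_def)
  qed
  have from_comp: "awalk r p v" if "pre_digraph.awalk (comp r) r p v" for r p v
    using that by (auto simp: pre_digraph.awalk_def cas_comp) (auto simp: comp_def awalk_def)
  have "wf_digraph (comp r)" for r
  proof
    fix e assume "e \<in> arcs (comp r)"
    then obtain p where "e \<in> arcs F" "awalk r p (tail F e)" by (auto simp: comp_def)
    then have "awalk r (p @ [e]) (head F e)" by (simp add: awalk_snoc del: awalk_append_iff)
    then have "\<exists>q. awalk r q (head F e)" by (rule exI)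
    then show "tail (comp r) e \<in> verts (comp r)" "head (comp r) e \<in> verts (comp r)"
      using \<open>awalk r p (tail F e)\<close> by (auto simp: comp_def)
  qed
  note wf_comp = this
  show ?thesis
    unfolding directed_forest_def
  proof (intro exI[of _ "comp ` R"] conjI ballI impI)
    fix T assume "T \<in> comp ` R"
    then obtain r where r: "r \<in> R" "T = comp r" by blast
    show "subgraph T F"
      unfolding r(2) subgraph_def using wf wf_comp[of r] awalk_last_in_verts
      by (auto simp: comp_def compatible_def)
    have "awalk r [] r" using r(1) by (simp add: awalk_Nil_iff R_def)
    then have "r \<in> verts (comp r)" by (auto simp: comp_def)
    moreover have "\<exists>!p. pre_digraph.awalk (comp r) r p v" if v: "v \<in> verts (comp r)" for v
    proof -
      obtain p where "awalk r p v" using v by (auto simp: comp_def)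
      then show ?thesis using to_comp from_comp uniq[OF r(1) r(1)] by blast
    qed
    ultimately show "\<exists>x. directed_tree T x"
      unfolding directed_tree_def r(2) using wf_comp by blast
  next
    fix T T' assume "T \<in> comp ` R" "T' \<in> comp ` R" and neq: "T \<noteq> T'"
    then obtain r r' where r: "r \<in> R" "T = comp r" "r' \<in> R" "T' = comp r'" by blast
    show "verts T \<inter> verts T' = {}"
    proof (rule ccontr)
      assume "verts T \<inter> verts T' \<noteq> {}"
      then obtain v p q where "awalk r p v" "awalk r' q v" using r by (auto simp: comp_def)
      then show False using uniq[OF r(1,3)] neq r by blast
    qed
  next
    have "\<exists>r\<in>R. \<exists>p. awalk r p v" if "v \<in> verts F" for v
      using reach[OF that] by (auto simp: R_def)
    note reach' = this
    show "verts F = (\<Union>T\<in>comp ` R. verts T)"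
      using reach' awalk_last_in_verts by (auto simp: comp_def)
    show "arcs F = (\<Union>T\<in>comp ` R. arcs T)"
      using reach' by (auto simp: comp_def)
  qed
qed

section \<open>Arc sets of forests in the double cycle\<close>

lemma Suc_mod_inj:
  fixes i j n :: nat
  assumes "i < n" "j < n" "(i + 1) mod n = (j + 1) mod n"
  shows "i = j"
proof -
  have "(l + 1) mod n = (if l + 1 = n then 0 else l + 1)" if "l < n" for l using that by auto
  then show ?thesis using assms by (auto split: if_splits)
qed

lemma rotation_closed:
  assumes A: "A \<subseteq> {..<n}" "a \<in> A" and closed: "\<And>i. i \<in> A \<Longrightarrow> (i + 1) mod n \<in> A"
  shows "A = {..<n :: nat}"
proof -
  have *: "(a + k) mod n \<in> A" for k
  proof (induction k)
    case 0
    then show ?case using A by auto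
  next
    case (Suc k)
    then show ?case using closed[OF Suc] by (simp add: mod_Suc_eq)
  qed
  have "b \<in> A" if "b < n" for b
  proof -
    have "a < n" using A by auto
    then have "(a + (n - a + b)) mod n = b" using that by simp
    then show ?thesis using *[of "n - a + b"] by simp
  qed
  then show ?thesis using A(1) by auto
qed

definition forward_arc :: "nat \<Rightarrow> nat \<Rightarrow> nat \<times> nat" where
  "forward_arc n i = (i, (i + 1) mod n)"

definition backward_arc :: "nat \<Rightarrow> nat \<Rightarrow> nat \<times> nat" where
  "backward_arc n i = ((i + 1) mod n, i)"

lemma arcs_double_directed_cycle:
  "arcs (double_directed_cycle n) = forward_arc n ` {..<n} \<union> backward_arc n ` {..<n}"
  by (auto simp: double_directed_cycle_def forward_arc_def backward_arc_def)

lemma wf_double_directed_cycle: "wf_digraph (double_directed_cycle n)"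
proof
  fix e assume "e \<in> arcs (double_directed_cycle n)"
  then show "tail (double_directed_cycle n) e \<in> verts (double_directed_cycle n)"
    "head (double_directed_cycle n) e \<in> verts (double_directed_cycle n)"
    by (auto simp: double_directed_cycle_def)
qed

text \<open>The exclusions are, in order: 2-cycles, pairs of arcs with a common head, and the two
  full directed cycles.\<close>

definition cycle_forest_arcs :: "nat \<Rightarrow> (nat \<times> nat) set \<Rightarrow> bool" where
  "cycle_forest_arcs n X \<longleftrightarrow> X \<subseteq> forward_arc n ` {..<n} \<union> backward_arc n ` {..<n} \<and>
    (\<forall>i<n. \<not> (forward_arc n i \<in> X \<and> backward_arc n i \<in> X)) \<and>
    (\<forall>i<n. \<not> (forward_arc n i \<in> X \<and> backward_arc n ((i + 1) mod n) \<in> X)) \<and>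
    \<not> forward_arc n ` {..<n} \<subseteq> X \<and> \<not> backward_arc n ` {..<n} \<subseteq> X"

text \<open>For two vertices the arcs coincide: \<open>forward_arc 2 0 = backward_arc 2 1\<close>.
  This is a source of the bound \<open>3 \<le> n\<close>.\<close>

lemma forward_neq_backward:
  assumes "3 \<le> n" "i < n" "j < n"
  shows "forward_arc n i \<noteq> backward_arc n j"
  using assms by (auto simp: forward_arc_def backward_arc_def mod_Suc split: if_splits)

lemma forest_imp_cycle_forest_arcs:
  assumes n: "3 \<le> n" and sub: "subgraph F (double_directed_cycle n)" and F: "directed_forest F"
  shows "cycle_forest_arcs n (arcs F)"
proof -
  have fn: "head F = snd" "tail F = fst" and V: "verts F \<subseteq> {..<n}" and A: "arcs F \<subseteq> arcs (double_directed_cycle n)"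
    and wf: "wf_digraph F"
    using sub by (auto simp: subgraph_def compatible_def double_directed_cycle_def)
  \<comment> \<open>The root of a tree has no incoming arc, so the arcs of a forest cannot end in
    all vertices; those of either directed cycle do.\<close>
  have all: False if heads: "\<And>v. v < n \<Longrightarrow> \<exists>e\<in>arcs F. head F e = v"
  proof -
    have "0 < n" using n by simp
    then obtain e where "e \<in> arcs F" using heads by blast
    then have "verts F \<noteq> {}" using wf_digraph.head_in_verts[OF wf] by blast
    then show False using directed_forest_arcs(3)[OF F] heads V by blast
  qed
  have "\<not> (forward_arc n i \<in> arcs F \<and> backward_arc n i \<in> arcs F)" if "i < n" for i
    using directed_forest_arcs(2)[OF F, of "forward_arc n i" "backward_arc n i"]
    by (auto simp: fn forward_arc_def backward_arc_def)
  moreover have "\<not> (forward_arc n i \<in> arcs F \<and> backward_arc n ((i + 1) mod n) \<in> arcs F)" if "i < n" for i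
  proof
    assume *: "forward_arc n i \<in> arcs F \<and> backward_arc n ((i + 1) mod n) \<in> arcs F"
    have "forward_arc n i = backward_arc n ((i + 1) mod n)"
      using * by (intro directed_forest_arcs(1)[OF F]) (auto simp: fn forward_arc_def backward_arc_def)
    then show False using forward_neq_backward[OF n that] n by simp
  qed
  moreover have "\<not> forward_arc n ` {..<n} \<subseteq> arcs F"
  proof
    assume *: "forward_arc n ` {..<n} \<subseteq> arcs F"
    show False
    proof (rule all)
      fix v assume v: "v < n"
      have "\<exists>i<n. (i + 1) mod n = v"
      proof (cases v)
        case 0
        then show ?thesis using n by (intro exI[of _ "n - 1"]) simp
      next
        case (Suc i)
        then show ?thesis using v by (intro exI[of _ i]) simp
      qed
      then obtain i where "i < n" "(i + 1) mod n = v" by blast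
      then show "\<exists>e\<in>arcs F. head F e = v"
        using * by (intro bexI[of _ "forward_arc n i"]) (auto simp: fn forward_arc_def)
    qed
  qed
  moreover have "\<not> backward_arc n ` {..<n} \<subseteq> arcs F"
  proof
    assume *: "backward_arc n ` {..<n} \<subseteq> arcs F"
    show False
    proof (rule all)
      fix v assume "v < n"
      then show "\<exists>e\<in>arcs F. head F e = v"
        using * by (intro bexI[of _ "backward_arc n v"]) (auto simp: fn backward_arc_def)
    qed
  qed
  ultimately show ?thesis
    using A unfolding cycle_forest_arcs_def arcs_double_directed_cycle by blast
qed

text \<open>Walking backwards from a vertex that is not reachable from a root never changes direction,
  so that it runs through all forward or through all backward arcs.\<close>

lemma cycle_forest_arcs_imp_forest:
  assumes n: "3 \<le> n" and X: "cycle_forest_arcs n X"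
  shows "\<exists>F. subgraph F (double_directed_cycle n) \<and> directed_forest F \<and> arcs F = X"
proof -
  \<comment> \<open>All vertices are kept; those that meet no arc of \<open>X\<close> become trees
    with one vertex.\<close>
  define F where "F = \<lparr>verts = {..<n}, arcs = X, tail = fst, head = snd\<rparr>"
  have F_simps [simp]: "verts F = {..<n}" "arcs F = X" "tail F = fst" "head F = snd"
    by (simp_all add: F_def)
  have XA: "X \<subseteq> forward_arc n ` {..<n} \<union> backward_arc n ` {..<n}"
    and opp: "\<And>i. i < n \<Longrightarrow> forward_arc n i \<in> X \<Longrightarrow> backward_arc n i \<notin> X"
    and hd: "\<And>i. i < n \<Longrightarrow> forward_arc n i \<in> X \<Longrightarrow> backward_arc n ((i + 1) mod n) \<notin> X"
    and notall: "\<not> forward_arc n ` {..<n} \<subseteq> X" "\<not> backward_arc n ` {..<n} \<subseteq> X"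
    using X unfolding cycle_forest_arcs_def by blast+
  have wf: "wf_digraph F"
    using XA by (auto simp: wf_digraph_def forward_arc_def backward_arc_def)
  interpret wf_digraph F by (rule wf)
  have sub: "subgraph F (double_directed_cycle n)"
    using XA wf wf_double_directed_cycle[of n] arcs_double_directed_cycle[of n]
    by (auto simp: subgraph_def compatible_def double_directed_cycle_def)
  have X_cases: "(\<exists>i<n. e = forward_arc n i \<and> snd e = (i + 1) mod n) \<or> (\<exists>i<n. e = backward_arc n i \<and> snd e = i)"
    if "e \<in> X" for e
    using that XA by (auto simp: forward_arc_def backward_arc_def)
  have indeg: "e' = e" if ee: "e \<in> X" "e' \<in> X" "snd e' = snd e" for e e'
    using X_cases[OF ee(1)] X_cases[OF ee(2)]
  proof (elim disjE exE conjE)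
    fix i j assume "i < n" "j < n" "e = forward_arc n i" "e' = forward_arc n j"
      "snd e = (i + 1) mod n" "snd e' = (j + 1) mod n"
    then show ?thesis using Suc_mod_inj ee(3) by metis
  next
    fix i j assume "i < n" "e = forward_arc n i" "snd e = (i + 1) mod n" "e' = backward_arc n j" "snd e' = j"
    then show ?thesis using hd[of i] ee by simp
  next
    fix i j assume "j < n" "e' = forward_arc n j" "snd e' = (j + 1) mod n" "e = backward_arc n i" "snd e = i"
    then show ?thesis using hd[of j] ee by simp
  next
    fix i j assume "e = backward_arc n i" "snd e = i" "e' = backward_arc n j" "snd e' = j"
    then show ?thesis using ee(3) by simp
  qed
  define bad where "bad v \<longleftrightarrow> v < n \<and> (\<forall>r p. (\<forall>e\<in>X. snd e \<noteq> r) \<longrightarrow> \<not> awalk r p v)" for v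
  have bad_pred: "\<exists>e\<in>X. snd e = v \<and> bad (fst e)" if v: "bad v" for v
  proof -
    have "awalk v [] v" using v by (simp add: awalk_Nil_iff bad_def)
    then obtain e where e: "e \<in> X" "snd e = v" using v unfolding bad_def by blast
    have "\<not> awalk r p (fst e)" if "\<forall>e\<in>X. snd e \<noteq> r" for r p
    proof
      assume "awalk r p (fst e)"
      then have "awalk r (p @ [e]) v" using e by (simp add: awalk_snoc del: awalk_append_iff)
      then show False using v that unfolding bad_def by blast
    qed
    moreover have "fst e < n" using tail_in_verts[of e] e by simp
    ultimately show ?thesis using e unfolding bad_def by blast
  qed
  define Fw Bw where "Fw = {i. i < n \<and> forward_arc n i \<in> X \<and> bad ((i + 1) mod n)}"
    and "Bw = {i. i < n \<and> backward_arc n i \<in> X \<and> bad i}"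
  have bad_cases: "(\<exists>i\<in>Fw. (i + 1) mod n = v) \<or> v \<in> Bw" if v: "bad v" for v
  proof -
    obtain e where e: "e \<in> X" "snd e = v" using bad_pred[OF v] by blast
    show ?thesis using X_cases[OF e(1)] e v by (auto simp: Fw_def Bw_def)
  qed
  have tail_bad: "bad (fst e)" if e: "e \<in> X" "bad (snd e)" for e
  proof -
    obtain e' where "e' \<in> X" "snd e' = snd e" "bad (fst e')" using bad_pred[OF e(2)] by blast
    then show ?thesis using indeg[of e e'] e(1) by simp
  qed
  \<comment> \<open>The tail \<open>i\<close> of such an arc is bad as well and therefore has an
    incoming arc. This cannot be \<open>backward_arc n i\<close>, the opposite arc, so it is again a
    forward arc.\<close>
  have Fw_pred: "\<exists>j\<in>Fw. (j + 1) mod n = i" if i: "i \<in> Fw" for i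
  proof -
    have "bad i" using tail_bad[of "forward_arc n i"] i by (auto simp: Fw_def forward_arc_def)
    then show ?thesis using bad_cases[of i] i opp[of i] by (auto simp: Fw_def Bw_def)
  qed
  have "Fw = {}"
  proof (rule ccontr)
    assume ne: "Fw \<noteq> {}"
    \<comment> \<open>\<open>Fw\<close> is closed under predecessors whereas
      \<open>rotation_closed\<close> speaks of successors, so it is applied to the
      complement.\<close>
    have "{..<n} - Fw = {}"
    proof (rule ccontr)
      assume "{..<n} - Fw \<noteq> {}"
      then obtain a where a: "a \<in> {..<n} - Fw" by blast
      have "{..<n} - Fw = {..<n}"
      proof (rule rotation_closed[OF _ a])
        fix i assume i: "i \<in> {..<n} - Fw"
        have "(i + 1) mod n \<notin> Fw"
        proof
          assume "(i + 1) mod n \<in> Fw"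
          then obtain j where "j \<in> Fw" "(j + 1) mod n = (i + 1) mod n" using Fw_pred by blast
          then show False using i Suc_mod_inj[of j n i] by (auto simp: Fw_def)
        qed
        then show "(i + 1) mod n \<in> {..<n} - Fw" using n by simp
      qed blast
      then show False using ne by (auto simp: Fw_def)
    qed
    then have "{..<n} \<subseteq> Fw" by simp
    then have "forward_arc n ` {..<n} \<subseteq> X" unfolding Fw_def by blast
    then show False using notall by blast
  qed
  have "Bw = {}"
  proof (rule ccontr)
    assume "Bw \<noteq> {}"
    then obtain a where a: "a \<in> Bw" by blast
    have "Bw = {..<n}"
    proof (rule rotation_closed[OF _ a])
      fix i assume i: "i \<in> Bw"
      then have "bad ((i + 1) mod n)" using tail_bad[of "backward_arc n i"] by (auto simp: Bw_def backward_arc_def)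
      then show "(i + 1) mod n \<in> Bw" using bad_cases \<open>Fw = {}\<close> by blast
    qed (auto simp: Bw_def)
    then have "{..<n} \<subseteq> Bw" by simp
    then have "backward_arc n ` {..<n} \<subseteq> X" unfolding Bw_def by blast
    then show False using notall by blast
  qed
  have "directed_forest F"
  proof (rule directed_forestI[OF wf])
    show "e' = e" if "e \<in> arcs F" "e' \<in> arcs F" "head F e' = head F e" for e e'
      using indeg that by simp
    fix v assume v: "v \<in> verts F"
    have "\<not> bad v" using bad_cases[of v] \<open>Fw = {}\<close> \<open>Bw = {}\<close> by blast
    then obtain r p where r: "\<forall>e\<in>X. snd e \<noteq> r" "awalk r p v" using v by (auto simp: bad_def)
    then show "\<exists>r\<in>verts F. (\<forall>e\<in>arcs F. head F e \<noteq> r) \<and> (\<exists>p. awalk r p v)"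
      using awalk_hd_in_verts[OF r(2)] by auto
  qed
  then show ?thesis using sub by (intro exI[of _ F]) simp
qed

lemma directed_forest_complex_double_cycle:
  assumes "3 \<le> n"
  shows "directed_forest_complex (double_directed_cycle n) = {X. cycle_forest_arcs n X}"
  using forest_imp_cycle_forest_arcs[OF assms] cycle_forest_arcs_imp_forest[OF assms]
  unfolding directed_forest_complex_def by blast

text \<open>Two arcs of the double cycle are incompatible precisely if they are neighbours in the
  following cyclic enumeration: they form a 2-cycle or have a common head.\<close>

definition arc_enum :: "nat \<Rightarrow> nat \<Rightarrow> nat \<times> nat" where
  "arc_enum n x = (if even x then backward_arc n (x div 2) else forward_arc n (x div 2))"

lemma inj_arc_enum:
  assumes n: "3 \<le> n"
  shows "inj_on (arc_enum n) {..<2 * n}"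
proof (rule inj_onI)
  fix x y assume xy: "x \<in> {..<2 * n}" "y \<in> {..<2 * n}" "arc_enum n x = arc_enum n y"
  then have lt: "x div 2 < n" "y div 2 < n" by auto
  have "even x = even y"
    using forward_neq_backward[OF n lt(1) lt(2)] forward_neq_backward[OF n lt(2) lt(1)] xy(3)
    by (auto simp: arc_enum_def split: if_splits)
  moreover have "x div 2 = y div 2"
    using xy(3) \<open>even x = even y\<close> by (auto simp: arc_enum_def forward_arc_def backward_arc_def split: if_splits)
  ultimately show "x = y" by (metis div_mult_mod_eq even_iff_mod_2_eq_zero odd_iff_mod_2_eq_one)
qed

text \<open>With position \<open>2 * i\<close> standing for \<open>backward_arc n i\<close> and
  \<open>2 * i + 1\<close> for \<open>forward_arc n i\<close>, the two families of neighbouring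
  positions are the 2-cycles and the pairs with a common head.\<close>

lemma cycle_complex_double_iff:
  assumes n: "1 \<le> n" and S: "S \<subseteq> {..<2 * n}"
  shows "S \<in> cycle_complex (2 * n) \<longleftrightarrow>
    (\<forall>i<n. \<not> (2 * i + 1 \<in> S \<and> 2 * i \<in> S)) \<and> (\<forall>i<n. \<not> (2 * i + 1 \<in> S \<and> 2 * ((i + 1) mod n) \<in> S))"
    (is "_ \<longleftrightarrow> ?R")
proof -
  have 1: "(2 * i + 1) mod (2 * n) = 2 * i + 1" if "i < n" for i using that by simp
  have 2: "(2 * i + 1 + 1) mod (2 * n) = 2 * ((i + 1) mod n)" for i
    using mult_mod_right[of 2 "i + 1" n] by simp
  have "(\<forall>x<2 * n. \<not> {x, (x + 1) mod (2 * n)} \<subseteq> S) \<longleftrightarrow> ?R" (is "?L \<longleftrightarrow> _")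
  proof
    assume L: ?L
    have "\<not> {2 * i, (2 * i + 1) mod (2 * n)} \<subseteq> S" "\<not> {2 * i + 1, (2 * i + 1 + 1) mod (2 * n)} \<subseteq> S"
      if "i < n" for i by (rule L[rule_format], use that in simp)+
    then show ?R unfolding 2 using 1 by (metis empty_subsetI insert_subset)
  next
    assume R: ?R
    show ?L
    proof (intro allI impI)
      fix x assume x: "x < 2 * n"
      then have i: "x div 2 < n" by auto
      show "\<not> {x, (x + 1) mod (2 * n)} \<subseteq> S"
      proof (cases "even x")
        case True
        then have "x = 2 * (x div 2)" by simp
        then show ?thesis using R i 1[OF i] by (metis insert_subset)
      next
        case False
        then have "x = 2 * (x div 2) + 1" by simp
        then show ?thesis using R i 2[of "x div 2"] by (metis insert_subset)
      qed
    qed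
  qed
  then show ?thesis using S by (simp add: cycle_complex_def)
qed

text \<open>The even positions are the backward directed cycle and the odd ones the forward cycle.
  As both are maximal independent sets, a face contains one of them only if it equals it, so
  excluding these cycles just deletes two faces.\<close>

lemma cycle_forest_arcs_image_iff:
  assumes n: "3 \<le> n" and S: "S \<subseteq> {..<2 * n}"
  shows "cycle_forest_arcs n (arc_enum n ` S) \<longleftrightarrow> S \<in> cycle_complex (2 * n) - {evens n, odds n}"
proof -
  have mem: "arc_enum n x \<in> arc_enum n ` S \<longleftrightarrow> x \<in> S" if "x < 2 * n" for x
    using inj_on_image_mem_iff[OF inj_arc_enum[OF n]] S that by simp
  have fw: "forward_arc n i \<in> arc_enum n ` S \<longleftrightarrow> 2 * i + 1 \<in> S" if "i < n" for i
    using mem[of "2 * i + 1"] that by (simp add: arc_enum_def)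
  have bw: "backward_arc n i \<in> arc_enum n ` S \<longleftrightarrow> 2 * i \<in> S" if "i < n" for i
    using mem[of "2 * i"] that by (simp add: arc_enum_def)
  have sub: "arc_enum n ` S \<subseteq> forward_arc n ` {..<n} \<union> backward_arc n ` {..<n}"
    using S by (auto simp: arc_enum_def)
  have fall: "forward_arc n ` {..<n} \<subseteq> arc_enum n ` S \<longleftrightarrow> odds n \<subseteq> S"
  proof
    assume *: "forward_arc n ` {..<n} \<subseteq> arc_enum n ` S"
    show "odds n \<subseteq> S"
    proof
      fix x assume "x \<in> odds n"
      then have "x div 2 < n" "x = 2 * (x div 2) + 1" by (auto simp: odds_def)
      then show "x \<in> S" using * fw[of "x div 2"] by auto
    qed
  next
    assume "odds n \<subseteq> S"
    then have "2 * i + 1 \<in> S" if "i < n" for i using that by (auto simp: odds_def)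
    then show "forward_arc n ` {..<n} \<subseteq> arc_enum n ` S" using fw by (intro image_subsetI) simp
  qed
  have ball: "backward_arc n ` {..<n} \<subseteq> arc_enum n ` S \<longleftrightarrow> evens n \<subseteq> S"
  proof
    assume *: "backward_arc n ` {..<n} \<subseteq> arc_enum n ` S"
    show "evens n \<subseteq> S"
    proof
      fix x assume "x \<in> evens n"
      then have "x div 2 < n" "x = 2 * (x div 2)" by (auto simp: evens_def)
      then show "x \<in> S" using * bw[of "x div 2"] by auto
    qed
  next
    assume "evens n \<subseteq> S"
    then have "2 * i \<in> S" if "i < n" for i using that by (auto simp: evens_def)
    then show "backward_arc n ` {..<n} \<subseteq> arc_enum n ` S" using bw by (intro image_subsetI) simp
  qed
  have "cycle_forest_arcs n (arc_enum n ` S) \<longleftrightarrow>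
    S \<in> cycle_complex (2 * n) \<and> \<not> odds n \<subseteq> S \<and> \<not> evens n \<subseteq> S"
    unfolding cycle_forest_arcs_def fall ball using sub fw bw S n
    by (subst cycle_complex_double_iff) auto
  also have "\<dots> \<longleftrightarrow> S \<in> cycle_complex (2 * n) - {evens n, odds n}"
  proof -
    have "S \<subseteq> evens n" if "S \<in> cycle_complex (2 * n)" "evens n \<subseteq> S"
      by (rule face_above_evens) (use that n in auto)
    moreover have "S \<subseteq> odds n" if "S \<in> cycle_complex (2 * n)" "odds n \<subseteq> S"
      by (rule face_above_odds) (use that n in auto)
    ultimately show ?thesis by auto
  qed
  finally show ?thesis .
qed

lemma homeomorphic_directed_forest_complex:
  assumes n: "3 \<le> n"
  shows "geometric_realization (cycle_complex (2 * n) - {evens n, odds n}) homeomorphic_space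
    geometric_realization (directed_forest_complex (double_directed_cycle n))"
proof -
  let ?K = "cycle_complex (2 * n) - {evens n, odds n}"
  have KP: "?K \<subseteq> Pow {..<2 * n}" by (auto simp: cycle_complex_def)
  have img: "arc_enum n ` {..<2 * n} = forward_arc n ` {..<n} \<union> backward_arc n ` {..<n}"
  proof (intro subset_antisym subsetI)
    fix e assume "e \<in> forward_arc n ` {..<n} \<union> backward_arc n ` {..<n}"
    then obtain i where "i < n" "e = arc_enum n (2 * i + 1) \<or> e = arc_enum n (2 * i)"
      by (auto simp: arc_enum_def)
    then show "e \<in> arc_enum n ` {..<2 * n}" by auto
  qed (auto simp: arc_enum_def)
  have "(`) (arc_enum n) ` ?K = {X. cycle_forest_arcs n X}"
  proof (intro subset_antisym subsetI)
    fix X assume "X \<in> (`) (arc_enum n) ` ?K"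
    then obtain S where S: "S \<in> ?K" "X = arc_enum n ` S" by (rule imageE) metis
    moreover have "S \<subseteq> {..<2 * n}" using S(1) KP by blast
    ultimately show "X \<in> {X. cycle_forest_arcs n X}" using cycle_forest_arcs_image_iff[OF n] by simp
  next
    fix X assume X: "X \<in> {X. cycle_forest_arcs n X}"
    then have "X \<subseteq> arc_enum n ` {..<2 * n}" unfolding img by (simp add: cycle_forest_arcs_def)
    then obtain S where S: "S \<subseteq> {..<2 * n}" "X = arc_enum n ` S" by (auto simp: subset_image_iff)
    then have "S \<in> ?K" using cycle_forest_arcs_image_iff[OF n S(1)] X by simp
    then show "X \<in> (`) (arc_enum n) ` ?K" using S(2) by (rule rev_image_eqI)
  qed
  then show ?thesis
    using homeomorphic_realization_image(1)[OF finite_complex_punctured_cycle inj_arc_enum[OF n]] n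
    unfolding directed_forest_complex_double_cycle[OF n] by simp
qed

theorem proposition4p4p8:
  fixes n k :: nat
  assumes "n \<ge> 3"
  shows
    "(n = 3 * k \<longrightarrow>
        geometric_realization (cycle_complex n)
          homotopy_equivalent_space wedge_of_spheres [k - 1, k - 1]) \<and>
     (n = 3 * k + 1 \<longrightarrow>
        geometric_realization (cycle_complex n)
          homotopy_equivalent_space nsphere (k - 1)) \<and>
     (n = 3 * k + 2 \<longrightarrow>
        geometric_realization (cycle_complex n)
          homotopy_equivalent_space nsphere k) \<and>
     (n = 3 * k \<longrightarrow>
        geometric_realization (directed_forest_complex (double_directed_cycle n))
          homotopy_equivalent_space
            wedge_of_spheres [2 * k - 1, 2 * k - 1, 3 * k - 2, 3 * k - 2]) \<and>
     (n = 3 * k + 1 \<longrightarrow>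
        geometric_realization (directed_forest_complex (double_directed_cycle n))
          homotopy_equivalent_space wedge_of_spheres [2 * k, 3 * k - 1, 3 * k - 1]) \<and>
     (n = 3 * k + 2 \<longrightarrow>
        geometric_realization (directed_forest_complex (double_directed_cycle n))
          homotopy_equivalent_space wedge_of_spheres [2 * k, 3 * k, 3 * k])"
proof -
  \<comment> \<open>\<open>n \<ge> 3\<close> rules out \<open>k = 0\<close>, so none of the
    subtractions in the dimensions is truncated.\<close>
  have k: "0 < k" if "n = 3 * k \<or> n = 3 * k + 1 \<or> n = 3 * k + 2"
    using that assms by auto
  have forest: "geometric_realization (directed_forest_complex (double_directed_cycle n))
    homotopy_equivalent_space W"
    if "geometric_realization (cycle_complex (2 * n) - {evens n, odds n}) homotopy_equivalent_space W" for W
    using homotopy_eqv_trans[OF _ that] homeomorphic_directed_forest_complex[OF assms]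
      homeomorphic_imp_homotopy_equivalent_space homotopy_equivalent_space_sym by metis
  show ?thesis
  proof (intro conjI impI forest)
    assume "n = 3 * k"
    then show "geometric_realization (cycle_complex n) homotopy_equivalent_space wedge_of_spheres [k - 1, k - 1]"
      "geometric_realization (cycle_complex (2 * n) - {evens n, odds n}) homotopy_equivalent_space
        wedge_of_spheres [2 * k - 1, 2 * k - 1, 3 * k - 2, 3 * k - 2]"
      using cycle_complex_mult3 punctured_cycle_complex_mult3 k by auto
  next
    assume "n = 3 * k + 1"
    then show "geometric_realization (cycle_complex n) homotopy_equivalent_space nsphere (k - 1)"
      "geometric_realization (cycle_complex (2 * n) - {evens n, odds n}) homotopy_equivalent_space
        wedge_of_spheres [2 * k, 3 * k - 1, 3 * k - 1]"
      using cycle_complex_mult3_plus1 punctured_cycle_complex_mult3_plus1 k by auto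
  next
    assume "n = 3 * k + 2"
    then show "geometric_realization (cycle_complex n) homotopy_equivalent_space nsphere k"
      "geometric_realization (cycle_complex (2 * n) - {evens n, odds n}) homotopy_equivalent_space
        wedge_of_spheres [2 * k, 3 * k, 3 * k]"
      using cycle_complex_mult3_plus2 punctured_cycle_complex_mult3_plus2 k by auto
  qed
qed

end
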